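(* Let $p$ be a prime number such that $p-2$ is also prime and $p \equiv 5 \pmod 8$. Let $E_p$ be the elliptic curve over $\mathbb{Q}$ defined by \[ E_p : y^2 = x(x-p)(x-2). \] Then $\operatorname{rank} E_p(\mathbb{Q}) \leq 1$. In particular, either \[ E_p(\mathbb{Q}) \cong \mathbb{Z}/2\mathbb{Z} \times \mathbb{Z}/2\mathbb{Z} \quad\text{or}\quad E_p(\mathbb{Q}) \cong \mathbb{Z} \times \mathbb{Z}/2\mathbb{Z} \times \mathbb{Z}/2\mathbb{Z}. \]
   Context: By the Mordell–Weil theorem, $E_p(\mathbb{Q}) \cong \mathbb{Z}^r \oplus E_p(\mathbb{Q})_{\mathrm{tors}}$ with $r \geq 0$ finite; $r$ is the rank of $E_p$. *)

theory Defs
  imports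
    "HOL-Algebra.Product_Groups"
    "HOL-Algebra.Elementary_Groups"
    "HOL-Computational_Algebra.Computational_Algebra"
    "HOL-Number_Theory.Cong"
begin

(* Elliptic curves are given by an equation y^2 = f(x) with f a monic cubic polynomial
   over a field of characteristic 0; coprimality of f and f' expresses
   that the curve is nonsingular. *)
definition elliptic_cubic :: "'a::field_char_0 poly \<Rightarrow> bool" where
  "elliptic_cubic f \<longleftrightarrow> degree f = 3 \<and> lead_coeff f = 1 \<and> coprime f (pderiv f)"

datatype 'a curve_point = Infinity | Affine 'a 'a

definition curve_points :: "'a::field poly \<Rightarrow> 'a curve_point set" where
  "curve_points f = insert Infinity {Affine x y | x y. y ^ 2 = poly f x}"

(* Chord-tangent law: the line of slope m through two points of y^2 = f(x) meets the curve in
   points whose x-coordinates sum to m^2 - coeff f 2, as f is monic of degree 3. *)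
fun curve_add :: "'a::field poly \<Rightarrow> 'a curve_point \<Rightarrow> 'a curve_point \<Rightarrow> 'a curve_point" where
  "curve_add f Infinity Q = Q"
| "curve_add f P Infinity = P"
| "curve_add f (Affine x1 y1) (Affine x2 y2) =
    (if x1 = x2 \<and> y1 = - y2 then Infinity
     else let m = (if x1 = x2 then poly (pderiv f) x1 / (2 * y1) else (y2 - y1) / (x2 - x1));
              x3 = m ^ 2 - coeff f 2 - x1 - x2
          in Affine x3 (m * (x1 - x3) - y1))"

definition curve_group :: "'a::field poly \<Rightarrow> 'a curve_point monoid" where
  "curve_group f = \<lparr>carrier = curve_points f, monoid.mult = curve_add f, one = Infinity\<rparr>"

definition torsion_subgroup :: "('a, 'b) monoid_scheme \<Rightarrow> ('a, 'b) monoid_scheme" where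
  "torsion_subgroup G =
    G\<lparr>carrier := {x \<in> carrier G. \<exists>n::nat. n > 0 \<and> x [^]\<^bsub>G\<^esub> n = \<one>\<^bsub>G\<^esub>}\<rparr>"

definition free_group_Z :: "nat \<Rightarrow> (nat \<Rightarrow> int) monoid" where
  "free_group_Z r = product_group {..<r} (\<lambda>_. integer_group)"

(* Meaningful for finitely generated abelian groups, for which such an r exists and is unique. *)
definition abelian_rank :: "('a, 'b) monoid_scheme \<Rightarrow> nat" where
  "abelian_rank G = (THE r. G \<cong> free_group_Z r \<times>\<times> torsion_subgroup G)"

definition E_cubic :: "nat \<Rightarrow> rat poly" where
  "E_cubic p = [:0, 1:] * [:- of_nat p, 1:] * [:- 2, 1:]"

abbreviation E_group :: "nat \<Rightarrow> rat curve_point monoid" where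
  "E_group p \<equiv> curve_group (E_cubic p)"

lemma Affine_in_E_group:
  "Affine x y \<in> carrier (E_group p) \<longleftrightarrow> y ^ 2 = x * (x - of_nat p) * (x - 2)"
  by (simp add: curve_group_def curve_points_def E_cubic_def algebra_simps)

lemma bezout_linear_poly:
  fixes g :: "'a::field poly"
  assumes "poly g c \<noteq> 0"
  shows "\<exists>u v. u * [:- c, 1:] + v * g = 1"
proof -
  let ?k = "inverse (poly g c)"
  have "g = [:- c, 1:] * synthetic_div g c + [:poly g c:]"
    using synthetic_div_correct'[of c g] by simp
  then have "smult ?k g = smult ?k ([:- c, 1:] * synthetic_div g c) + 1"
    using assms by (metis field_class.field_inverse one_pCons smult_0_right smult_add_right smult_pCons)
  then have "(- smult ?k (synthetic_div g c)) * [:- c, 1:] + [:?k:] * g = 1"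
    by (simp add: algebra_simps)
  then show ?thesis by blast
qed

lemma bezout_mult_poly:
  fixes a b g :: "'a::field poly"
  assumes "\<exists>u v. u * a + v * g = 1" "\<exists>u v. u * b + v * g = 1"
  shows "\<exists>u v. u * (a * b) + v * g = 1"
proof -
  obtain u v u' v' where uv: "u * a + v * g = 1" "u' * b + v' * g = 1"
    using assms by blast
  have "(u * u') * (a * b) + (u * a * v' + v * (u' * b + v' * g)) * g
      = (u * a + v * g) * (u' * b + v' * g)"
    by (simp add: algebra_simps)
  then show ?thesis unfolding uv by auto
qed

lemma elliptic_E_cubic:
  assumes "p \<noteq> 0" "p \<noteq> 2"
  shows "elliptic_cubic (E_cubic p)"
proof -
  have f: "E_cubic p = [:0, 2 * of_nat p, - (of_nat p + 2), 1:]"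
    by (simp add: E_cubic_def algebra_simps)
  have p2: "(of_nat p :: rat) \<noteq> 2"
    using assms(2) by (metis of_nat_eq_iff of_nat_numeral)
  let ?g = "pderiv (E_cubic p)"
  have "poly ?g 0 \<noteq> 0"
    using assms(1) by (simp add: f pderiv_pCons)
  moreover have "poly ?g (of_nat p) = of_nat p * (of_nat p - 2)"
    by (simp add: f pderiv_pCons algebra_simps)
  then have "poly ?g (of_nat p) \<noteq> 0"
    using assms(1) p2 by simp
  moreover have "poly ?g 2 = 2 * (2 - of_nat p)"
    by (simp add: f pderiv_pCons algebra_simps)
  then have "poly ?g 2 \<noteq> 0"
    using p2 by simp
  ultimately have "\<exists>u v. u * E_cubic p + v * ?g = 1"
    using bezout_mult_poly[OF bezout_mult_poly[OF bezout_linear_poly[of ?g 0]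
      bezout_linear_poly[of ?g "of_nat p"]] bezout_linear_poly[of ?g 2]]
    by (simp add: E_cubic_def)
  then have "coprime (E_cubic p) ?g"
    by (metis coprimeI dvd_add dvd_mult)
  then show ?thesis
    by (simp add: elliptic_cubic_def f)
qed

end

(* The curve is identified with the intersection of quadrics c^2 + 2 s^2 = 1, d^2 + p s^2 = 1, whose
   addition law (that of the Jacobi functions sn, cn, dn) has no exceptional points over an ordered
   field when p > 2; associativity is then a polynomial identity, and the chord-tangent law inherits it.

   A nonzero point of 2E has x and x - 2 squares, which forces x to have even denominator, and doubling
   such a point strictly increases the power of 2 in the denominator.  Hence 2E is torsion-free and the
   torsion subgroup is E[2].

   In the 2-descent every point can be moved by E[2] to one whose x is a square.  As 2 is not a square
   modulo p - 2 = 3 (mod 8), x - 2 and x - p are then both squares (a point of 2E) or both negatives of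
   squares, so E / (2E + E[2]) has at most two elements.

   For 2E this gives a single coset representative g, and the height descent x = e g + 2 x' ends in a
   finite set.  Periodicity there shows that a fixed multiple N x of every x lies in the cyclic group
   generated by g; being torsion-free, 2E is cyclic, and E is E[2] or Z x E[2]. *)
theory Submission
  imports Defs "HOL-Number_Theory.Gauss"
begin

section \<open>The Jacobi model\<close>

text \<open>The roots 0, 2, p differ by 2, p and p - 2, so only these primes can enter the
  2-descent. On the curve x >= 0, which leaves the classes 1, 2, p, 2p for x modulo squares; these
  are exactly the classes attached to the four points of E[2] (2p for the point (0, 0)), so
  translation by E[2] can make x a square. After that only the prime p - 2 and a common sign can
  keep x - 2 and x - p from being squares. The nonresidue removes the prime, and the sign is the one
  class that may survive. The structure is read off from 2E because torsion-freeness turns "a fixed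
  multiple of every point lies in one cyclic group" into "the whole subgroup is cyclic". Halving a
  generator of 2E then splits off the factor Z. Since the rank is a definite description, an
  explicit isomorphism alone does not determine it: uniqueness of the free rank is a separate
  argument, resting on the same two cosets modulo 2E + E[2].\<close>

definition jacobi :: "'a::linordered_field \<Rightarrow> ('a \<times> 'a \<times> 'a) set" where
  "jacobi p = {(s, c, d). c ^ 2 + 2 * s ^ 2 = 1 \<and> d ^ 2 + p * s ^ 2 = 1}"

text \<open>The classical addition formulas for sn, cn, dn with sn = sqrt 2 * s and squared modulus
  p / 2; the rescaling keeps all coefficients rational.\<close>

fun jacobi_add :: "'a::linordered_field \<Rightarrow> 'a \<times> 'a \<times> 'a \<Rightarrow> 'a \<times> 'a \<times> 'a \<Rightarrow> 'a \<times> 'a \<times> 'a" where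
  "jacobi_add p (s, c, d) (s', c', d') =
    (let z = 1 - 2 * p * s ^ 2 * s' ^ 2
     in ((s * c' * d' + s' * c * d) / z,
         (c * c' - 2 * s * s' * d * d') / z,
         (d * d' - p * s * s' * c * c') / z))"

text \<open>As \<open>d ^ 2\<close> is nonnegative, \<open>p * s ^ 2\<close> is at most 1, and
  likewise for \<open>s'\<close>; the subtracted term is therefore at most 2 / p < 1. Positivity of
  squares is what frees the addition law of exceptions.\<close>

lemma jacobi_denom_nonzero:
  fixes p :: "'a::linordered_field"
  assumes "p > 2" "(s, c, d) \<in> jacobi p" "(s', c', d') \<in> jacobi p"
  shows "1 - 2 * p * s ^ 2 * s' ^ 2 \<noteq> 0"
proof
  assume z: "1 - 2 * p * s ^ 2 * s' ^ 2 = 0"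
  have "d ^ 2 + p * s ^ 2 = 1" "d' ^ 2 + p * s' ^ 2 = 1"
    using assms(2,3) by (simp_all add: jacobi_def)
  then have "p * s ^ 2 \<le> 1" "p * s' ^ 2 \<le> 1"
    using zero_le_power2[of d] zero_le_power2[of d'] by linarith+
  then have le: "(p * s ^ 2) * (p * s' ^ 2) \<le> 1 * 1"
    using assms(1) by (intro mult_mono) auto
  have "p * (2 * p * s ^ 2 * s' ^ 2) = p * 1" using z by simp
  then have "2 * ((p * s ^ 2) * (p * s' ^ 2)) = p" by (simp add: ac_simps)
  with le assms(1) show False by linarith
qed

lemma jacobi_add_closed:
  fixes p :: "'a::linordered_field"
  assumes "p > 2" "A \<in> jacobi p" "B \<in> jacobi p"
  shows "jacobi_add p A B \<in> jacobi p"
proof -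
  obtain s c d s' c' d' where AB: "A = (s, c, d)" "B = (s', c', d')"
    by (cases A, cases B) auto
  define z where "z = 1 - 2 * p * s ^ 2 * s' ^ 2"
  have z0: "z \<noteq> 0"
    using jacobi_denom_nonzero[OF assms(1), of s c d s' c' d'] assms(2,3)
    unfolding AB z_def by simp
  have h: "c ^ 2 = 1 - 2 * s ^ 2" "d ^ 2 = 1 - p * s ^ 2"
     "c' ^ 2 = 1 - 2 * s' ^ 2" "d' ^ 2 = 1 - p * s' ^ 2"
    using assms(2,3) AB by (auto simp: jacobi_def algebra_simps)
  \<comment> \<open>The mixed terms of the two squares cancel, so only squares of the coordinates
    remain and \<open>h\<close> can eliminate those of c and d.\<close>
  have "(c * c' - 2 * s * s' * d * d') ^ 2 + 2 * (s * c' * d' + s' * c * d) ^ 2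
      = c ^ 2 * c' ^ 2 + 4 * s ^ 2 * s' ^ 2 * d ^ 2 * d' ^ 2
        + 2 * s ^ 2 * c' ^ 2 * d' ^ 2 + 2 * s' ^ 2 * c ^ 2 * d ^ 2"
    by Groebner_Basis.algebra
  also have "\<dots> = z ^ 2"
    unfolding z_def h by Groebner_Basis.algebra
  finally have 1: "(c * c' - 2 * s * s' * d * d') ^ 2 + 2 * (s * c' * d' + s' * c * d) ^ 2 = z ^ 2" .
  have "(d * d' - p * s * s' * c * c') ^ 2 + p * (s * c' * d' + s' * c * d) ^ 2
      = d ^ 2 * d' ^ 2 + p ^ 2 * s ^ 2 * s' ^ 2 * c ^ 2 * c' ^ 2
        + p * s ^ 2 * c' ^ 2 * d' ^ 2 + p * s' ^ 2 * c ^ 2 * d ^ 2"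
    by Groebner_Basis.algebra
  also have "\<dots> = z ^ 2"
    unfolding z_def h by Groebner_Basis.algebra
  finally have 2: "(d * d' - p * s * s' * c * c') ^ 2 + p * (s * c' * d' + s' * c * d) ^ 2 = z ^ 2" .
  have "(N / z) ^ 2 + k * (M / z) ^ 2 = (N ^ 2 + k * M ^ 2) / z ^ 2" for N M k
    by (simp add: power_divide add_divide_distrib)
  then show ?thesis
    using 1 2 z0 unfolding AB jacobi_def jacobi_add.simps Let_def z_def[symmetric] by simp
qed

text \<open>Adds a third point to a sum already written over a common denominator \<open>z\<close>.
  Nested fractions disappear, and associativity becomes an equality of cross products.\<close>

lemma jacobi_add_frac:
  fixes p :: "'a::linordered_field"
  assumes "z \<noteq> 0" "z ^ 2 - 2 * p * S ^ 2 * s ^ 2 \<noteq> 0"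
  shows "jacobi_add p (S / z, C / z, D / z) (s, c, d) =
      ((S * c * d * z + s * C * D) / (z ^ 2 - 2 * p * S ^ 2 * s ^ 2),
       (C * c * z - 2 * S * s * D * d) / (z ^ 2 - 2 * p * S ^ 2 * s ^ 2),
       (D * d * z - p * S * s * C * c) / (z ^ 2 - 2 * p * S ^ 2 * s ^ 2))"
proof -
  define E where "E = z ^ 2 - 2 * p * S ^ 2 * s ^ 2"
  have E: "1 - 2 * p * (S / z) ^ 2 * s ^ 2 = E / z ^ 2"
    using assms(1) by (simp add: E_def field_simps)
  have cancel: "(N / z ^ 2) / (E / z ^ 2) = N / E" for N
    using assms(1) by simp
  have N: "S / z * c * d + s * (C / z) * (D / z) = (S * c * d * z + s * C * D) / z ^ 2"
    "C / z * c - 2 * (S / z) * s * (D / z) * d = (C * c * z - 2 * S * s * D * d) / z ^ 2"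
    "D / z * d - p * (S / z) * s * (C / z) * c = (D * d * z - p * S * s * C * c) / z ^ 2"
    using assms(1) by (simp_all add: add_divide_distrib diff_divide_distrib power2_eq_square)
  show ?thesis
    unfolding jacobi_add.simps Let_def E N cancel unfolding E_def ..
qed

lemma jacobi_add_commute: "jacobi_add p A B = jacobi_add p B A"
  by (cases A; cases B) (simp add: Let_def mult.commute mult.left_commute add.commute)

lemma jacobi_add_assoc:
  fixes p :: "'a::linordered_field"
  assumes p: "p > 2" and mem: "A \<in> jacobi p" "B \<in> jacobi p" "Q \<in> jacobi p"
  shows "jacobi_add p (jacobi_add p A B) Q = jacobi_add p A (jacobi_add p B Q)"
proof -
  obtain s1 c1 d1 s2 c2 d2 s3 c3 d3
    where ABQ: "A = (s1, c1, d1)" "B = (s2, c2, d2)" "Q = (s3, c3, d3)"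
    by (cases A, cases B, cases Q) auto
  define z where "z = 1 - 2 * p * s1 ^ 2 * s2 ^ 2"
  define w where "w = 1 - 2 * p * s2 ^ 2 * s3 ^ 2"
  define S where "S = s1 * c2 * d2 + s2 * c1 * d1"
  define C where "C = c1 * c2 - 2 * s1 * s2 * d1 * d2"
  define D where "D = d1 * d2 - p * s1 * s2 * c1 * c2"
  define S' where "S' = s2 * c3 * d3 + s3 * c2 * d2"
  define C' where "C' = c2 * c3 - 2 * s2 * s3 * d2 * d3"
  define D' where "D' = d2 * d3 - p * s2 * s3 * c2 * c3"
  note defs = z_def w_def S_def C_def D_def S'_def C'_def D'_def
  have z0: "z \<noteq> 0" and w0: "w \<noteq> 0"
    using jacobi_denom_nonzero[OF p, of s1 c1 d1 s2 c2 d2]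
      jacobi_denom_nonzero[OF p, of s2 c2 d2 s3 c3 d3] mem unfolding ABQ z_def w_def by auto
  have 1: "jacobi_add p A B = (S / z, C / z, D / z)" "jacobi_add p B Q = (S' / w, C' / w, D' / w)"
    unfolding ABQ by (simp_all add: defs Let_def)
  have h: "c1 ^ 2 = 1 - 2 * s1 ^ 2" "d1 ^ 2 = 1 - p * s1 ^ 2"
     "c2 ^ 2 = 1 - 2 * s2 ^ 2" "d2 ^ 2 = 1 - p * s2 ^ 2"
     "c3 ^ 2 = 1 - 2 * s3 ^ 2" "d3 ^ 2 = 1 - p * s3 ^ 2"
    using mem ABQ by (auto simp: jacobi_def algebra_simps)
  \<comment> \<open>Up to the factors \<open>z ^ 2\<close> and \<open>w ^ 2\<close>, the new
    denominators belong to additions of points that again lie on the model.\<close>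
  have "1 - 2 * p * (S / z) ^ 2 * s3 ^ 2 \<noteq> 0" "1 - 2 * p * (S' / w) ^ 2 * s1 ^ 2 \<noteq> 0"
    using jacobi_denom_nonzero[OF p] jacobi_add_closed[OF p] mem 1 ABQ by metis+
  then have E0: "z ^ 2 - 2 * p * S ^ 2 * s3 ^ 2 \<noteq> 0" "w ^ 2 - 2 * p * S' ^ 2 * s1 ^ 2 \<noteq> 0"
    using z0 w0 by (auto simp: field_simps)
  \<comment> \<open>Each numerator and denominator is expanded with all c and d as free variables,
    then reduced by \<open>h\<close> to degree at most one in each of them. This keeps the cross
    products in \<open>e1\<close>, \<open>e2\<close>, \<open>e3\<close> manageable; their
    differences vanish after one more reduction by \<open>h\<close>.\<close>
  have "S * c3 * d3 * z + s3 * C * D =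
      2*c1*c2*d1*d2*p*s1^2*s2^2*s3 + c1*c2*d1*d2*s3 - 2*c1*c3*d1*d3*p*s1^2*s2^3 +
      c1*c3*d1*d3*s2 - c1^2*c2^2*p*s1*s2*s3 - 2*c2*c3*d2*d3*p*s1^3*s2^2 + c2*c3*d2*d3*s1 -
      2*d1^2*d2^2*s1*s2*s3"
    unfolding defs by Groebner_Basis.algebra
  also have "\<dots> =
      2*c1*c2*d1*d2*p*s1^2*s2^2*s3 + c1*c2*d1*d2*s3 - 2*c1*c3*d1*d3*p*s1^2*s2^3 +
      c1*c3*d1*d3*s2 - 2*c2*c3*d2*d3*p*s1^3*s2^2 + c2*c3*d2*d3*s1 - p*s1*s2*s3 +
      4*p*s1*s2^3*s3 + 4*p*s1^3*s2*s3 - 4*p*s1^3*s2^3*s3 - 2*p^2*s1^3*s2^3*s3 - 2*s1*s2*s3"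
    unfolding h by Groebner_Basis.algebra
  finally have ls: "S * c3 * d3 * z + s3 * C * D =
      2*c1*c2*d1*d2*p*s1^2*s2^2*s3 + c1*c2*d1*d2*s3 - 2*c1*c3*d1*d3*p*s1^2*s2^3 +
      c1*c3*d1*d3*s2 - 2*c2*c3*d2*d3*p*s1^3*s2^2 + c2*c3*d2*d3*s1 - p*s1*s2*s3 +
      4*p*s1*s2^3*s3 + 4*p*s1^3*s2*s3 - 4*p*s1^3*s2^3*s3 - 2*p^2*s1^3*s2^3*s3 - 2*s1*s2*s3" .
  have "C * c3 * z - 2 * S * s3 * D * d3 =
      c1*c2*c3 - 2*c1*c2*c3*p*s1^2*s2^2 + 2*c1*c2^2*d2*d3*p*s1^2*s2*s3 - 2*c1*d1^2*d2*d3*s2*s3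
      + 2*c1^2*c2*d1*d3*p*s1*s2^2*s3 - 2*c2*d1*d2^2*d3*s1*s3 + 4*c3*d1*d2*p*s1^3*s2^3 -
      2*c3*d1*d2*s1*s2"
    unfolding defs by Groebner_Basis.algebra
  also have "\<dots> =
      c1*c2*c3 - 2*c1*c2*c3*p*s1^2*s2^2 + 4*c1*d2*d3*p*s1^2*s2*s3 - 4*c1*d2*d3*p*s1^2*s2^3*s3
      - 2*c1*d2*d3*s2*s3 + 4*c2*d1*d3*p*s1*s2^2*s3 - 4*c2*d1*d3*p*s1^3*s2^2*s3 -
      2*c2*d1*d3*s1*s3 + 4*c3*d1*d2*p*s1^3*s2^3 - 2*c3*d1*d2*s1*s2"
    unfolding h by Groebner_Basis.algebra
  finally have lc: "C * c3 * z - 2 * S * s3 * D * d3 =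
      c1*c2*c3 - 2*c1*c2*c3*p*s1^2*s2^2 + 4*c1*d2*d3*p*s1^2*s2*s3 - 4*c1*d2*d3*p*s1^2*s2^3*s3
      - 2*c1*d2*d3*s2*s3 + 4*c2*d1*d3*p*s1*s2^2*s3 - 4*c2*d1*d3*p*s1^3*s2^2*s3 -
      2*c2*d1*d3*s1*s3 + 4*c3*d1*d2*p*s1^3*s2^3 - 2*c3*d1*d2*s1*s2" .
  have "D * d3 * z - p * S * s3 * C * c3 =
      - c1*c2*d3*p*s1*s2 + 2*c1*c2*d3*p^2*s1^3*s2^3 - c1*c2^2*c3*d2*p*s1*s3 +
      2*c1*c3*d1^2*d2*p*s1*s2^2*s3 - c1^2*c2*c3*d1*p*s2*s3 + 2*c2*c3*d1*d2^2*p*s1^2*s2*s3 +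
      d1*d2*d3 - 2*d1*d2*d3*p*s1^2*s2^2"
    unfolding defs by Groebner_Basis.algebra
  also have "\<dots> =
      - c1*c2*d3*p*s1*s2 + 2*c1*c2*d3*p^2*s1^3*s2^3 + 4*c1*c3*d2*p*s1*s2^2*s3 -
      c1*c3*d2*p*s1*s3 - 2*c1*c3*d2*p^2*s1^3*s2^2*s3 + 4*c2*c3*d1*p*s1^2*s2*s3 -
      c2*c3*d1*p*s2*s3 - 2*c2*c3*d1*p^2*s1^2*s2^3*s3 + d1*d2*d3 - 2*d1*d2*d3*p*s1^2*s2^2"
    unfolding h by Groebner_Basis.algebra
  finally have ld: "D * d3 * z - p * S * s3 * C * c3 =
      - c1*c2*d3*p*s1*s2 + 2*c1*c2*d3*p^2*s1^3*s2^3 + 4*c1*c3*d2*p*s1*s2^2*s3 -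
      c1*c3*d2*p*s1*s3 - 2*c1*c3*d2*p^2*s1^3*s2^2*s3 + 4*c2*c3*d1*p*s1^2*s2*s3 -
      c2*c3*d1*p*s2*s3 - 2*c2*c3*d1*p^2*s1^2*s2^3*s3 + d1*d2*d3 - 2*d1*d2*d3*p*s1^2*s2^2" .
  have "z ^ 2 - 2 * p * S ^ 2 * s3 ^ 2 =
      1 - 4*c1*c2*d1*d2*p*s1*s2*s3^2 - 2*c1^2*d1^2*p*s2^2*s3^2 - 2*c2^2*d2^2*p*s1^2*s3^2 -
      4*p*s1^2*s2^2 + 4*p^2*s1^4*s2^4"
    unfolding defs by Groebner_Basis.algebra
  also have "\<dots> =
      1 - 4*c1*c2*d1*d2*p*s1*s2*s3^2 - 4*p*s1^2*s2^2 + 8*p*s1^2*s2^2*s3^2 - 2*p*s1^2*s3^2 -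
      2*p*s2^2*s3^2 + 4*p^2*s1^2*s2^2*s3^2 - 4*p^2*s1^2*s2^4*s3^2 - 4*p^2*s1^4*s2^2*s3^2 +
      4*p^2*s1^4*s2^4"
    unfolding h by Groebner_Basis.algebra
  finally have lz: "z ^ 2 - 2 * p * S ^ 2 * s3 ^ 2 =
      1 - 4*c1*c2*d1*d2*p*s1*s2*s3^2 - 4*p*s1^2*s2^2 + 8*p*s1^2*s2^2*s3^2 - 2*p*s1^2*s3^2 -
      2*p*s2^2*s3^2 + 4*p^2*s1^2*s2^2*s3^2 - 4*p^2*s1^2*s2^4*s3^2 - 4*p^2*s1^4*s2^2*s3^2 +
      4*p^2*s1^4*s2^4" .
  have "S' * c1 * d1 * w + s1 * C' * D' =
      - 2*c1*c2*d1*d2*p*s2^2*s3^3 + c1*c2*d1*d2*s3 - 2*c1*c3*d1*d3*p*s2^3*s3^2 +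
      c1*c3*d1*d3*s2 + 2*c2*c3*d2*d3*p*s1*s2^2*s3^2 + c2*c3*d2*d3*s1 - c2^2*c3^2*p*s1*s2*s3 -
      2*d2^2*d3^2*s1*s2*s3"
    unfolding defs by Groebner_Basis.algebra
  also have "\<dots> =
      - 2*c1*c2*d1*d2*p*s2^2*s3^3 + c1*c2*d1*d2*s3 - 2*c1*c3*d1*d3*p*s2^3*s3^2 +
      c1*c3*d1*d3*s2 + 2*c2*c3*d2*d3*p*s1*s2^2*s3^2 + c2*c3*d2*d3*s1 - p*s1*s2*s3 +
      4*p*s1*s2*s3^3 + 4*p*s1*s2^3*s3 - 4*p*s1*s2^3*s3^3 - 2*p^2*s1*s2^3*s3^3 - 2*s1*s2*s3"
    unfolding h by Groebner_Basis.algebra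
  finally have rs: "S' * c1 * d1 * w + s1 * C' * D' =
      - 2*c1*c2*d1*d2*p*s2^2*s3^3 + c1*c2*d1*d2*s3 - 2*c1*c3*d1*d3*p*s2^3*s3^2 +
      c1*c3*d1*d3*s2 + 2*c2*c3*d2*d3*p*s1*s2^2*s3^2 + c2*c3*d2*d3*s1 - p*s1*s2*s3 +
      4*p*s1*s2*s3^3 + 4*p*s1*s2^3*s3 - 4*p*s1*s2^3*s3^3 - 2*p^2*s1*s2^3*s3^3 - 2*s1*s2*s3" .
  have "C' * c1 * w - 2 * S' * s1 * D' * d1 =
      c1*c2*c3 - 2*c1*c2*c3*p*s2^2*s3^2 + 4*c1*d2*d3*p*s2^3*s3^3 - 2*c1*d2*d3*s2*s3 +
      2*c2*c3^2*d1*d3*p*s1*s2^2*s3 - 2*c2*d1*d2^2*d3*s1*s3 + 2*c2^2*c3*d1*d2*p*s1*s2*s3^2 -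
      2*c3*d1*d2*d3^2*s1*s2"
    unfolding defs by Groebner_Basis.algebra
  also have "\<dots> =
      c1*c2*c3 - 2*c1*c2*c3*p*s2^2*s3^2 + 4*c1*d2*d3*p*s2^3*s3^3 - 2*c1*d2*d3*s2*s3 +
      4*c2*d1*d3*p*s1*s2^2*s3 - 4*c2*d1*d3*p*s1*s2^2*s3^3 - 2*c2*d1*d3*s1*s3 +
      4*c3*d1*d2*p*s1*s2*s3^2 - 4*c3*d1*d2*p*s1*s2^3*s3^2 - 2*c3*d1*d2*s1*s2"
    unfolding h by Groebner_Basis.algebra
  finally have rc: "C' * c1 * w - 2 * S' * s1 * D' * d1 =
      c1*c2*c3 - 2*c1*c2*c3*p*s2^2*s3^2 + 4*c1*d2*d3*p*s2^3*s3^3 - 2*c1*d2*d3*s2*s3 +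
      4*c2*d1*d3*p*s1*s2^2*s3 - 4*c2*d1*d3*p*s1*s2^2*s3^3 - 2*c2*d1*d3*s1*s3 +
      4*c3*d1*d2*p*s1*s2*s3^2 - 4*c3*d1*d2*p*s1*s2^3*s3^2 - 2*c3*d1*d2*s1*s2" .
  have "D' * d1 * w - p * S' * s1 * C' * c1 =
      - c1*c2*c3^2*d3*p*s1*s2 + 2*c1*c2*d2^2*d3*p*s1*s2*s3^2 - c1*c2^2*c3*d2*p*s1*s3 +
      2*c1*c3*d2*d3^2*p*s1*s2^2*s3 - c2*c3*d1*p*s2*s3 + 2*c2*c3*d1*p^2*s2^3*s3^3 + d1*d2*d3 -
      2*d1*d2*d3*p*s2^2*s3^2"
    unfolding defs by Groebner_Basis.algebra
  also have "\<dots> =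
      - c1*c2*d3*p*s1*s2 + 4*c1*c2*d3*p*s1*s2*s3^2 - 2*c1*c2*d3*p^2*s1*s2^3*s3^2 +
      4*c1*c3*d2*p*s1*s2^2*s3 - c1*c3*d2*p*s1*s3 - 2*c1*c3*d2*p^2*s1*s2^2*s3^3 -
      c2*c3*d1*p*s2*s3 + 2*c2*c3*d1*p^2*s2^3*s3^3 + d1*d2*d3 - 2*d1*d2*d3*p*s2^2*s3^2"
    unfolding h by Groebner_Basis.algebra
  finally have rd: "D' * d1 * w - p * S' * s1 * C' * c1 =
      - c1*c2*d3*p*s1*s2 + 4*c1*c2*d3*p*s1*s2*s3^2 - 2*c1*c2*d3*p^2*s1*s2^3*s3^2 +
      4*c1*c3*d2*p*s1*s2^2*s3 - c1*c3*d2*p*s1*s3 - 2*c1*c3*d2*p^2*s1*s2^2*s3^3 -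
      c2*c3*d1*p*s2*s3 + 2*c2*c3*d1*p^2*s2^3*s3^3 + d1*d2*d3 - 2*d1*d2*d3*p*s2^2*s3^2" .
  have "w ^ 2 - 2 * p * S' ^ 2 * s1 ^ 2 =
      1 - 4*c2*c3*d2*d3*p*s1^2*s2*s3 - 2*c2^2*d2^2*p*s1^2*s3^2 - 2*c3^2*d3^2*p*s1^2*s2^2 -
      4*p*s2^2*s3^2 + 4*p^2*s2^4*s3^4"
    unfolding defs by Groebner_Basis.algebra
  also have "\<dots> =
      1 - 4*c2*c3*d2*d3*p*s1^2*s2*s3 - 2*p*s1^2*s2^2 + 8*p*s1^2*s2^2*s3^2 - 2*p*s1^2*s3^2 -
      4*p*s2^2*s3^2 + 4*p^2*s1^2*s2^2*s3^2 - 4*p^2*s1^2*s2^2*s3^4 - 4*p^2*s1^2*s2^4*s3^2 +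
      4*p^2*s2^4*s3^4"
    unfolding h by Groebner_Basis.algebra
  finally have rz: "w ^ 2 - 2 * p * S' ^ 2 * s1 ^ 2 =
      1 - 4*c2*c3*d2*d3*p*s1^2*s2*s3 - 2*p*s1^2*s2^2 + 8*p*s1^2*s2^2*s3^2 - 2*p*s1^2*s3^2 -
      4*p*s2^2*s3^2 + 4*p^2*s1^2*s2^2*s3^2 - 4*p^2*s1^2*s2^2*s3^4 - 4*p^2*s1^2*s2^4*s3^2 +
      4*p^2*s2^4*s3^4" .
  have "(S * c3 * d3 * z + s3 * C * D) * (w ^ 2 - 2 * p * S' ^ 2 * s1 ^ 2)
      - (S' * c1 * d1 * w + s1 * C' * D') * (z ^ 2 - 2 * p * S ^ 2 * s3 ^ 2) =
      - 4*c1*c2*c3^2*d1*d2*d3^2*p*s1^2*s2^2*s3 + 8*c1*c2*c3^2*d1*d2*d3^2*p^2*s1^4*s2^4*s3 +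
      4*c1*c2*d1*d2*p*s1^2*s2^2*s3 - 8*c1*c2*d1*d2*p*s1^2*s2^2*s3^3 -
      4*c1*c2*d1*d2*p^2*s1^2*s2^2*s3^3 + 8*c1*c2*d1*d2*p^2*s1^2*s2^2*s3^5 -
      8*c1*c2*d1*d2*p^2*s1^4*s2^4*s3 + 16*c1*c2*d1*d2*p^2*s1^4*s2^4*s3^3 +
      8*c1*c2*d1*d2*p^3*s1^4*s2^4*s3^3 - 16*c1*c2*d1*d2*p^3*s1^4*s2^4*s3^5 +
      8*c1*c2^2*c3*d1*d2^2*d3*p^2*s1^2*s2^3*s3^4 - 8*c1*c2^2*c3*d1*d2^2*d3*p^2*s1^4*s2^3*s3^2
      - 8*c1*c3*d1*d3*p^2*s1^2*s2^3*s3^4 + 16*c1*c3*d1*d3*p^2*s1^2*s2^5*s3^4 +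
      8*c1*c3*d1*d3*p^2*s1^4*s2^3*s3^2 - 16*c1*c3*d1*d3*p^2*s1^4*s2^5*s3^2 +
      8*c1*c3*d1*d3*p^3*s1^2*s2^5*s3^4 - 16*c1*c3*d1*d3*p^3*s1^2*s2^7*s3^4 -
      8*c1*c3*d1*d3*p^3*s1^4*s2^5*s3^2 + 16*c1*c3*d1*d3*p^3*s1^4*s2^7*s3^2 +
      4*c1^2*c2*c3*d1^2*d2*d3*p*s1*s2^2*s3^2 - 8*c1^2*c2*c3*d1^2*d2*d3*p^2*s1*s2^4*s3^4 +
      4*c1^2*c2^2*d1^2*d2^2*p*s1*s2*s3^3 - 8*c1^2*c2^2*d1^2*d2^2*p^2*s1*s2^3*s3^5 -
      4*c2*c3*d2*d3*p*s1*s2^2*s3^2 + 8*c2*c3*d2*d3*p*s1^3*s2^2*s3^2 +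
      8*c2*c3*d2*d3*p^2*s1*s2^4*s3^4 + 4*c2*c3*d2*d3*p^2*s1^3*s2^2*s3^2 -
      16*c2*c3*d2*d3*p^2*s1^3*s2^4*s3^4 - 8*c2*c3*d2*d3*p^2*s1^5*s2^2*s3^2 -
      8*c2*c3*d2*d3*p^3*s1^3*s2^4*s3^4 + 16*c2*c3*d2*d3*p^3*s1^5*s2^4*s3^4 -
      4*c2^2*c3^2*d2^2*d3^2*p*s1^3*s2*s3 + 8*c2^2*c3^2*d2^2*d3^2*p^2*s1^5*s2^3*s3 -
      4*p*s1*s2*s3^3 + 8*p*s1*s2^3*s3^3 + 4*p*s1^3*s2*s3 - 8*p*s1^3*s2^3*s3 +
      4*p^2*s1*s2^3*s3^3 + 8*p^2*s1*s2^3*s3^5 - 8*p^2*s1*s2^5*s3^3 - 16*p^2*s1*s2^5*s3^5 +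
      8*p^2*s1^3*s2*s3^5 - 4*p^2*s1^3*s2^3*s3 - 32*p^2*s1^3*s2^3*s3^5 + 8*p^2*s1^3*s2^5*s3 +
      32*p^2*s1^3*s2^5*s3^5 - 8*p^2*s1^5*s2*s3^3 - 8*p^2*s1^5*s2^3*s3 + 32*p^2*s1^5*s2^3*s3^3
      + 16*p^2*s1^5*s2^5*s3 - 32*p^2*s1^5*s2^5*s3^3 - 8*p^3*s1*s2^5*s3^5 + 16*p^3*s1*s2^7*s3^5
      - 16*p^3*s1^3*s2^3*s3^5 + 48*p^3*s1^3*s2^5*s3^5 - 32*p^3*s1^3*s2^7*s3^5 +
      16*p^3*s1^5*s2^3*s3^3 + 8*p^3*s1^5*s2^5*s3 - 48*p^3*s1^5*s2^5*s3^3 - 16*p^3*s1^5*s2^7*s3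
      + 32*p^3*s1^5*s2^7*s3^3 + 8*p^4*s1^3*s2^5*s3^5 - 16*p^4*s1^3*s2^7*s3^5 -
      8*p^4*s1^5*s2^5*s3^3 + 16*p^4*s1^5*s2^7*s3^3"
    unfolding ls rs lz rz by Groebner_Basis.algebra
  also have "\<dots> = 0"
    unfolding h by Groebner_Basis.algebra
  finally have e1: "(S * c3 * d3 * z + s3 * C * D) * (w ^ 2 - 2 * p * S' ^ 2 * s1 ^ 2)
      = (S' * c1 * d1 * w + s1 * C' * D') * (z ^ 2 - 2 * p * S ^ 2 * s3 ^ 2)"
    by simp
  have "(C * c3 * z - 2 * S * s3 * D * d3) * (w ^ 2 - 2 * p * S' ^ 2 * s1 ^ 2)
      - (C' * c1 * w - 2 * S' * s1 * D' * d1) * (z ^ 2 - 2 * p * S ^ 2 * s3 ^ 2) =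
      - 8*c1*c2*c3*d1^2*d2^2*p*s1^2*s2^2*s3^2 + 16*c1*c2*c3*d1^2*d2^2*p^2*s1^2*s2^2*s3^4 -
      16*c1*c2*c3*d1^2*d2^2*p^2*s1^2*s2^4*s3^4 + 8*c1*c2*c3*d2^2*d3^2*p*s1^2*s2^2*s3^2 -
      16*c1*c2*c3*d2^2*d3^2*p^2*s1^4*s2^2*s3^2 + 16*c1*c2*c3*d2^2*d3^2*p^2*s1^4*s2^4*s3^2 -
      8*c1*c2*c3*p^2*s1^2*s2^2*s3^4 + 16*c1*c2*c3*p^2*s1^2*s2^4*s3^4 +
      8*c1*c2*c3*p^2*s1^4*s2^2*s3^2 - 16*c1*c2*c3*p^2*s1^4*s2^4*s3^2 +
      8*c1*c2*c3*p^3*s1^2*s2^4*s3^4 - 16*c1*c2*c3*p^3*s1^2*s2^6*s3^4 -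
      8*c1*c2*c3*p^3*s1^4*s2^4*s3^2 + 16*c1*c2*c3*p^3*s1^4*s2^6*s3^2 -
      4*c1*c2^2*c3^2*d2*d3*p*s1^2*s2*s3 + 8*c1*c2^2*c3^2*d2*d3*p^2*s1^4*s2^3*s3 -
      8*c1*c2^2*d1^2*d2*d3*p*s1^2*s2*s3^3 + 16*c1*c2^2*d1^2*d2*d3*p^2*s1^2*s2^3*s3^3 -
      16*c1*c2^2*d1^2*d2*d3*p^2*s1^2*s2^3*s3^5 + 4*c1*d2*d3*p*s1^2*s2*s3 -
      8*c1*d2*d3*p*s1^2*s2^3*s3 - 16*c1*d2*d3*p^2*s1^2*s2^3*s3^3 +
      16*c1*d2*d3*p^2*s1^2*s2^3*s3^5 + 32*c1*d2*d3*p^2*s1^2*s2^5*s3^3 -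
      32*c1*d2*d3*p^2*s1^2*s2^5*s3^5 - 8*c1*d2*d3*p^2*s1^4*s2*s3^3 -
      8*c1*d2*d3*p^2*s1^4*s2^3*s3 + 32*c1*d2*d3*p^2*s1^4*s2^3*s3^3 +
      16*c1*d2*d3*p^2*s1^4*s2^5*s3 - 32*c1*d2*d3*p^2*s1^4*s2^5*s3^3 +
      16*c1*d2*d3*p^3*s1^4*s2^3*s3^3 - 16*c1*d2*d3*p^3*s1^4*s2^3*s3^5 -
      32*c1*d2*d3*p^3*s1^4*s2^5*s3^3 + 32*c1*d2*d3*p^3*s1^4*s2^5*s3^5 -
      8*c1^2*c2*d1*d2^2*d3*p*s1*s2^2*s3^3 + 16*c1^2*c2*d1*d2^2*d3*p^2*s1*s2^4*s3^5 +
      4*c1^2*c2^2*c3*d1*d2*p*s1*s2*s3^2 - 8*c1^2*c2^2*c3*d1*d2*p^2*s1*s2^3*s3^4 +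
      8*c2*c3^2*d1*d2^2*d3*p*s1^3*s2^2*s3 - 16*c2*c3^2*d1*d2^2*d3*p^2*s1^5*s2^4*s3 +
      8*c2*d1*d3*p*s1*s2^2*s3^3 - 8*c2*d1*d3*p*s1^3*s2^2*s3 - 8*c2*d1*d3*p^2*s1*s2^4*s3^3 -
      16*c2*d1*d3*p^2*s1*s2^4*s3^5 + 8*c2*d1*d3*p^2*s1^3*s2^4*s3 +
      32*c2*d1*d3*p^2*s1^3*s2^4*s3^5 + 16*c2*d1*d3*p^2*s1^5*s2^4*s3 -
      32*c2*d1*d3*p^2*s1^5*s2^4*s3^3 + 16*c2*d1*d3*p^3*s1*s2^6*s3^5 -
      32*c2*d1*d3*p^3*s1^3*s2^6*s3^5 - 16*c2*d1*d3*p^3*s1^5*s2^6*s3 +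
      32*c2*d1*d3*p^3*s1^5*s2^6*s3^3 + 8*c2^2*c3*d1*d2*d3^2*p*s1^3*s2*s3^2 -
      16*c2^2*c3*d1*d2*d3^2*p^2*s1^3*s2^3*s3^2 + 16*c2^2*c3*d1*d2*d3^2*p^2*s1^5*s2^3*s3^2 -
      4*c3*d1*d2*p*s1*s2*s3^2 + 8*c3*d1*d2*p*s1*s2^3*s3^2 + 8*c3*d1*d2*p^2*s1*s2^3*s3^4 -
      16*c3*d1*d2*p^2*s1*s2^5*s3^4 + 8*c3*d1*d2*p^2*s1^3*s2*s3^4 +
      16*c3*d1*d2*p^2*s1^3*s2^3*s3^2 - 32*c3*d1*d2*p^2*s1^3*s2^3*s3^4 -
      32*c3*d1*d2*p^2*s1^3*s2^5*s3^2 + 32*c3*d1*d2*p^2*s1^3*s2^5*s3^4 -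
      16*c3*d1*d2*p^2*s1^5*s2^3*s3^2 + 32*c3*d1*d2*p^2*s1^5*s2^5*s3^2 -
      16*c3*d1*d2*p^3*s1^3*s2^3*s3^4 + 32*c3*d1*d2*p^3*s1^3*s2^5*s3^4 +
      16*c3*d1*d2*p^3*s1^5*s2^3*s3^4 - 32*c3*d1*d2*p^3*s1^5*s2^5*s3^4"
    unfolding lc rc lz rz by Groebner_Basis.algebra
  also have "\<dots> = 0"
    unfolding h by Groebner_Basis.algebra
  finally have e2: "(C * c3 * z - 2 * S * s3 * D * d3) * (w ^ 2 - 2 * p * S' ^ 2 * s1 ^ 2)
      = (C' * c1 * w - 2 * S' * s1 * D' * d1) * (z ^ 2 - 2 * p * S ^ 2 * s3 ^ 2)"
    by simp
  have "(D * d3 * z - p * S * s3 * C * c3) * (w ^ 2 - 2 * p * S' ^ 2 * s1 ^ 2)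
      - (D' * d1 * w - p * S' * s1 * C' * c1) * (z ^ 2 - 2 * p * S ^ 2 * s3 ^ 2) =
      4*c1*c2*c3^2*d2^2*d3*p^2*s1^3*s2*s3^2 - 16*c1*c2*c3^2*d2^2*d3*p^2*s1^3*s2^3*s3^2 +
      8*c1*c2*c3^2*d2^2*d3*p^3*s1^5*s2^3*s3^2 + 4*c1*c2*d1^2*d2^2*d3*p*s1*s2*s3^2 -
      8*c1*c2*d1^2*d2^2*d3*p^2*s1*s2^3*s3^4 - 4*c1*c2*d3*p*s1*s2*s3^2 +
      4*c1*c2*d3*p^2*s1*s2^3*s3^2 + 8*c1*c2*d3*p^2*s1*s2^3*s3^4 + 8*c1*c2*d3*p^2*s1^3*s2*s3^4
      + 16*c1*c2*d3*p^2*s1^3*s2^3*s3^2 - 32*c1*c2*d3*p^2*s1^3*s2^3*s3^4 -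
      8*c1*c2*d3*p^3*s1*s2^5*s3^4 - 16*c1*c2*d3*p^3*s1^3*s2^3*s3^4 -
      16*c1*c2*d3*p^3*s1^3*s2^5*s3^2 + 32*c1*c2*d3*p^3*s1^3*s2^5*s3^4 -
      8*c1*c2*d3*p^3*s1^5*s2^3*s3^2 + 16*c1*c2*d3*p^3*s1^5*s2^3*s3^4 +
      8*c1*c2*d3*p^4*s1^3*s2^5*s3^4 + 8*c1*c2*d3*p^4*s1^5*s2^5*s3^2 -
      16*c1*c2*d3*p^4*s1^5*s2^5*s3^4 - 4*c1*c2^2*c3*d1^2*d2*p^2*s1*s2^2*s3^3 +
      8*c1*c2^2*c3*d1^2*d2*p^3*s1*s2^4*s3^5 + 4*c1*c2^2*c3*d2*d3^2*p^2*s1^3*s2^2*s3 -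
      8*c1*c2^2*c3*d2*d3^2*p^3*s1^5*s2^4*s3 + 4*c1*c3*d2*p^2*s1*s2^2*s3^3 -
      8*c1*c3*d2*p^2*s1*s2^4*s3^3 - 4*c1*c3*d2*p^2*s1^3*s2^2*s3 + 8*c1*c3*d2*p^2*s1^3*s2^4*s3
      - 8*c1*c3*d2*p^3*s1*s2^4*s3^5 + 16*c1*c3*d2*p^3*s1*s2^6*s3^5 +
      8*c1*c3*d2*p^3*s1^5*s2^4*s3 - 16*c1*c3*d2*p^3*s1^5*s2^6*s3 +
      8*c1*c3*d2*p^4*s1^3*s2^4*s3^5 - 16*c1*c3*d2*p^4*s1^3*s2^6*s3^5 -
      8*c1*c3*d2*p^4*s1^5*s2^4*s3^3 + 16*c1*c3*d2*p^4*s1^5*s2^6*s3^3 -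
      4*c1^2*c2*c3*d1*d2^2*p^2*s1^2*s2*s3^3 + 16*c1^2*c2*c3*d1*d2^2*p^2*s1^2*s2^3*s3^3 -
      8*c1^2*c2*c3*d1*d2^2*p^3*s1^2*s2^3*s3^5 - 4*c1^2*c2^2*d1*d2*d3*p^2*s1^2*s2^2*s3^2 +
      16*c1^2*c2^2*d1*d2*d3*p^2*s1^2*s2^2*s3^4 - 8*c1^2*c2^2*d1*d2*d3*p^3*s1^2*s2^4*s3^4 -
      4*c2*c3*d1*d2^2*d3^2*p*s1^2*s2*s3 + 8*c2*c3*d1*d2^2*d3^2*p^2*s1^4*s2^3*s3 +
      4*c2*c3*d1*p*s1^2*s2*s3 - 4*c2*c3*d1*p^2*s1^2*s2^3*s3 - 16*c2*c3*d1*p^2*s1^2*s2^3*s3^3 -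
      8*c2*c3*d1*p^2*s1^4*s2*s3^3 - 8*c2*c3*d1*p^2*s1^4*s2^3*s3 +
      32*c2*c3*d1*p^2*s1^4*s2^3*s3^3 + 8*c2*c3*d1*p^3*s1^2*s2^3*s3^5 +
      16*c2*c3*d1*p^3*s1^2*s2^5*s3^3 + 16*c2*c3*d1*p^3*s1^4*s2^3*s3^3 -
      16*c2*c3*d1*p^3*s1^4*s2^3*s3^5 + 8*c2*c3*d1*p^3*s1^4*s2^5*s3 -
      32*c2*c3*d1*p^3*s1^4*s2^5*s3^3 - 8*c2*c3*d1*p^4*s1^2*s2^5*s3^5 -
      8*c2*c3*d1*p^4*s1^4*s2^5*s3^3 + 16*c2*c3*d1*p^4*s1^4*s2^5*s3^5 +
      4*c2^2*c3^2*d1*d2*d3*p^2*s1^2*s2^2*s3^2 - 16*c2^2*c3^2*d1*d2*d3*p^2*s1^4*s2^2*s3^2 +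
      8*c2^2*c3^2*d1*d2*d3*p^3*s1^4*s2^4*s3^2 - 8*d1*d2*d3*p^2*s1^2*s2^2*s3^4 +
      16*d1*d2*d3*p^2*s1^2*s2^4*s3^4 + 8*d1*d2*d3*p^2*s1^4*s2^2*s3^2 -
      16*d1*d2*d3*p^2*s1^4*s2^4*s3^2 + 8*d1*d2*d3*p^3*s1^2*s2^4*s3^4 -
      16*d1*d2*d3*p^3*s1^2*s2^6*s3^4 - 8*d1*d2*d3*p^3*s1^4*s2^4*s3^2 +
      16*d1*d2*d3*p^3*s1^4*s2^6*s3^2"
    unfolding ld rd lz rz by Groebner_Basis.algebra
  also have "\<dots> = 0"
    unfolding h by Groebner_Basis.algebra
  finally have e3: "(D * d3 * z - p * S * s3 * C * c3) * (w ^ 2 - 2 * p * S' ^ 2 * s1 ^ 2)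
      = (D' * d1 * w - p * S' * s1 * C' * c1) * (z ^ 2 - 2 * p * S ^ 2 * s3 ^ 2)"
    by simp
  \<comment> \<open>Commutativity moves the compound sum on the right into the first argument, as
    \<open>jacobi_add_frac\<close> expects.\<close>
  show ?thesis
    unfolding 1 jacobi_add_commute[of p A "(S' / w, C' / w, D' / w)"] unfolding ABQ jacobi_add_frac[OF z0 E0(1)]
      jacobi_add_frac[OF w0 E0(2)] prod.inject frac_eq_eq[OF E0]
    using e1 e2 e3 by (intro conjI)
qed

text \<open>Three collinear points of the curve correspond to points of the Jacobi model that are
  coplanar with its neutral element, so they sum to zero there; the equations below have cleared
  denominators. All identities follow from \<open>4 l\<^sup>2 m\<^sup>2 = (2 l m)\<^sup>2\<close> (fact \<open>K\<close>) and the syzygies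
  \<open>lm\<close>; the explicit cofactors come from polynomial division, in the symmetric functions
  \<open>s\<close>, \<open>q\<close> of \<open>x1\<close>, \<open>x2\<close>.\<close>

lemma jacobi_sum_collinear:
  fixes p :: "'a::linordered_field"
  assumes e: "l ^ 2 = x1 + x2 + x3 - p - 2"
    "2 * l * m = 2 * p - (x1 * x2 + x1 * x3 + x2 * x3)" "m ^ 2 = x1 * x2 * x3"
  and y: "y1 = l * x1 + m" "y2 = l * x2 + m" "y3 = l * x3 + m"
  and F: "F = (\<lambda>x. x ^ 2 - 2 * p)" and C: "C = (\<lambda>x. x ^ 2 - 4 * x + 2 * p)"
  and D: "D = (\<lambda>x. x ^ 2 - 2 * p * x + 2 * p)"
  and W: "W = F x1 ^ 2 * F x2 ^ 2 - 32 * p * y1 ^ 2 * y2 ^ 2"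
  shows "- y3 * W = F x3 * (y1 * C x2 * D x2 * F x1 + y2 * C x1 * D x1 * F x2)"
    "C x3 * W = F x3 * (C x1 * C x2 * F x1 * F x2 - 8 * y1 * y2 * D x1 * D x2)"
    "D x3 * W = F x3 * (D x1 * D x2 * F x1 * F x2 - 4 * p * y1 * y2 * C x1 * C x2)"
proof -
  define s where "s = x1 + x2"
  define q where "q = x1 * x2"
  have e': "l ^ 2 = s + x3 - p - 2" "2 * l * m = 2 * p - (q + s * x3)" "m ^ 2 = q * x3"
    using e unfolding s_def q_def by (auto simp: algebra_simps)
  have "4 * l ^ 2 * m ^ 2 - (2 * l * m) ^ 2 = 0"
    by Groebner_Basis.algebra
  then have K: "4 * (s + x3 - p - 2) * (q * x3) - (2 * p - (q + s * x3)) ^ 2 = 0"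
    unfolding e' .
  have "(l * x + m) ^ 2 = l ^ 2 * x ^ 2 + (2 * l * m) * x + m ^ 2" for x
    by Groebner_Basis.algebra
  then have sq: "(l * x + m) ^ 2 = (s + x3 - p - 2) * x ^ 2 + (2 * p - (q + s * x3)) * x + q * x3" for x
    unfolding e' .
  have yy: "y1 ^ 2 * y2 ^ 2 = (x1 * (x1 - p) * (x1 - 2)) * (x2 * (x2 - p) * (x2 - 2))"
    unfolding y sq unfolding s_def q_def by Groebner_Basis.algebra
  have "2 * (y1 * y2) = 2 * l ^ 2 * q + (2 * l * m) * s + 2 * m ^ 2"
    unfolding y s_def q_def by Groebner_Basis.algebra
  then have y12: "2 * (y1 * y2) = 2 * (s + x3 - p - 2) * q + (2 * p - (q + s * x3)) * s + 2 * (q * x3)"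
    unfolding e' .
  have lm: "2 * (q * x3) * l - (2 * p - (q + s * x3)) * m = 0"
    "(2 * p - (q + s * x3)) * l - 2 * (s + x3 - p - 2) * m = 0"
    unfolding e'[symmetric] by Groebner_Basis.algebra+
  have FF: "F x1 * F x2 = 4*p*q - 2*p*s^2 + 4*p^2 + q^2"
    unfolding F s_def q_def by Groebner_Basis.algebra
  have CC: "C x1 * C x2 = - 4*p*q - 8*p*s + 2*p*s^2 + 4*p^2 + 16*q - 4*q*s + q^2"
    unfolding C s_def q_def by Groebner_Basis.algebra
  have DD: "D x1 * D x2 = - 4*p*q - 2*p*q*s + 2*p*s^2 + 4*p^2 + 4*p^2*q - 4*p^2*s + q^2"
    unfolding D s_def q_def by Groebner_Basis.algebra
  have ff: "x1 * (x1 - p) * (x1 - 2) * (x2 * (x2 - p) * (x2 - 2)) =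
      - 4*p*q*s + 2*p*q*s^2 - p*q^2*s + 4*p^2*q - 2*p^2*q*s + p^2*q^2 + 4*q^2 - 2*q^2*s + q^3"
    unfolding s_def q_def by Groebner_Basis.algebra
  have "W = (F x1 * F x2) ^ 2 - 32 * p * (y1 ^ 2 * y2 ^ 2)"
    unfolding W by (simp add: power_mult_distrib mult.assoc)
  then have W': "W = - 128*p*q^2 + 64*p*q^2*s - 4*p*q^2*s^2 - 24*p*q^3 + 128*p^2*q*s - 80*p^2*q*s^2 +
      24*p^2*q^2 + 32*p^2*q^2*s + 4*p^2*s^4 - 96*p^3*q + 64*p^3*q*s - 32*p^3*q^2 - 16*p^3*s^2
      + 16*p^4 + q^4"
    unfolding FF yy ff by Groebner_Basis.algebra
  have "C x3 * W - F x3 * ((C x1 * C x2) * (F x1 * F x2) - 4 * (2 * (y1 * y2)) * (D x1 * D x2))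
    = (- 64*p*q + 16*p*q*s - 8*p*q*s*x3 - 16*p*q*x3 - 4*p*q^2 + 8*p*s^2*x3 + 16*p^2*q +
      16*p^2*q*x3 + 32*p^2*s - 16*p^2*s*x3 - 8*p^2*s^2 + 16*p^2*x3 - 16*p^3 + 4*q^2*x3)
      * (4 * (s + x3 - p - 2) * (q * x3) - (2 * p - (q + s * x3)) ^ 2)"
    unfolding FF CC DD W' y12 unfolding F C by Groebner_Basis.algebra
  then show "C x3 * W = F x3 * (C x1 * C x2 * F x1 * F x2 - 8 * y1 * y2 * D x1 * D x2)"
    unfolding K by (simp add: mult.assoc)
  have "D x3 * W - F x3 * ((D x1 * D x2) * (F x1 * F x2) - 2 * p * (2 * (y1 * y2)) * (C x1 * C x2))
    = (- 8*p*q*s*x3 + 32*p*q*x3 - 4*p*q^2 + 2*p*q^2*x3 + 16*p^2*q + 8*p^2*q*s - 8*p^2*q*x3 -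
      16*p^2*s*x3 - 8*p^2*s^2 + 4*p^2*s^2*x3 - 16*p^3 - 16*p^3*q + 16*p^3*s + 8*p^3*x3)
      * (4 * (s + x3 - p - 2) * (q * x3) - (2 * p - (q + s * x3)) ^ 2)"
    unfolding FF CC DD W' y12 unfolding F D by Groebner_Basis.algebra
  then show "D x3 * W = F x3 * (D x1 * D x2 * F x1 * F x2 - 4 * p * y1 * y2 * C x1 * C x2)"
    unfolding K by (simp add: mult.assoc mult.left_commute)
  have G1: "x1 * C x2 * D x2 * F x1 + x2 * C x1 * D x1 * F x2 =
      - 2*p*q*s^3 + 18*p*q^2*s - 4*p*q^3 + 32*p^2*q - 36*p^2*q*s + 4*p^2*s^3 + 16*p^3*q -
      8*p^3*s - 8*q^3 + q^3*s"
    unfolding F C D s_def q_def by Groebner_Basis.algebra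
  have G0: "C x2 * D x2 * F x1 + C x1 * D x1 * F x2 =
      - 32*p*q*s + 8*p*q*s^2 + 20*p*q^2 - 2*p*q^2*s + 8*p*s^3 - 2*p*s^4 + 40*p^2*q -
      16*p^2*q*s + 16*p^2*s - 20*p^2*s^2 + 4*p^2*s^3 - 16*p^3 + 8*p^3*s - 4*q^2*s + q^2*s^2 -
      2*q^3"
    unfolding F C D s_def q_def by Groebner_Basis.algebra
  define u where "u = - 64*p*q + 32*p*q*s + 4*p*q*s*x3 - 2*p*q*s^2 - 18*p*q^2 - 2*p*q^2*x3 + 8*p*s^2*x3 -
      2*p*s^3*x3 + 12*p^2*q + 16*p^2*q*s + 32*p^2*s - 28*p^2*s*x3 - 20*p^2*s^2 + 4*p^2*s^2*x3
      + 16*p^2*x3 - 24*p^3 - 16*p^3*q + 16*p^3*s + 8*p^3*x3 + q^2*s*x3 - 4*q^2*x3 + q^3"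
  define v where "v = 16*p*q*s*x3 - 2*p*q*s^2*x3 - 16*p*q^2 + 2*p*q^2*s - 10*p*q^2*x3 - 32*p^2*q + 40*p^2*q*s
      + 8*p^2*q*s*x3 - 20*p^2*q*x3 - 8*p^2*q^2 - 4*p^2*s^2*x3 - 4*p^2*s^3 - 16*p^3*q + 8*p^3*s
      + 8*p^3*x3 + q^3*x3"
  have A: "x3 * W + F x3 * (x1 * C x2 * D x2 * F x1 + x2 * C x1 * D x1 * F x2)
    = u * (2 * (q * x3)) + v * (2 * p - (q + s * x3))"
    unfolding G1 W' unfolding F u_def v_def by Groebner_Basis.algebra
  have B: "W + F x3 * (C x2 * D x2 * F x1 + C x1 * D x1 * F x2)
    = - u * (2 * p - (q + s * x3)) - v * (2 * (s + x3 - p - 2))"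
    unfolding G0 W' unfolding F u_def v_def by Groebner_Basis.algebra
  have "y3 * W + F x3 * (y1 * C x2 * D x2 * F x1 + y2 * C x1 * D x1 * F x2)
    = l * (x3 * W + F x3 * (x1 * C x2 * D x2 * F x1 + x2 * C x1 * D x1 * F x2))
      + m * (W + F x3 * (C x2 * D x2 * F x1 + C x1 * D x1 * F x2))"
    unfolding y by (simp add: algebra_simps)
  also have "\<dots> = u * (2 * (q * x3) * l - (2 * p - (q + s * x3)) * m)
      + v * ((2 * p - (q + s * x3)) * l - 2 * (s + x3 - p - 2) * m)"
    unfolding A B by (simp add: algebra_simps)
  finally have "y3 * W + F x3 * (y1 * C x2 * D x2 * F x1 + y2 * C x1 * D x1 * F x2) = 0"
    unfolding lm by simp
  then show "- y3 * W = F x3 * (y1 * C x2 * D x2 * F x1 + y2 * C x1 * D x1 * F x2)"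
    by (metis add.commute add_eq_0_iff minus_mult_left)
qed

section \<open>The group law\<close>

lemma poly_E_cubic: "poly (E_cubic p) x = x * (x - of_nat p) * (x - 2)"
  by (simp add: E_cubic_def algebra_simps)

lemma curve_add_E_cubic:
  "curve_add (E_cubic p) (Affine x1 y1) (Affine x2 y2) =
    (if x1 = x2 \<and> y1 = - y2 then Infinity
     else let m = (if x1 = x2 then (3 * x1 ^ 2 - 2 * (of_nat p + 2) * x1 + 2 * of_nat p) / (2 * y1)
                   else (y2 - y1) / (x2 - x1));
              x3 = m ^ 2 + of_nat p + 2 - x1 - x2
          in Affine x3 (m * (x1 - x3) - y1))"
proof -
  have "E_cubic p = [:0, 2 * of_nat p, - (of_nat p + 2), 1:]"
    by (simp add: E_cubic_def algebra_simps)
  then have c: "poly.coeff (E_cubic p) 2 = - (of_nat p + 2)"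
    and d: "poly (pderiv (E_cubic p)) x1 = 3 * x1 ^ 2 - 2 * (of_nat p + 2) * x1 + 2 * of_nat p"
    by (simp_all add: numeral_2_eq_2 pderiv_pCons algebra_simps power2_eq_square)
  show ?thesis
    unfolding curve_add.simps c d diff_minus_eq_add add.assoc[symmetric] ..
qed

lemma Affine_in_curve_points:
  "Affine x y \<in> curve_points (E_cubic p) \<longleftrightarrow> y ^ 2 = x * (x - of_nat p) * (x - 2)"
  by (simp add: curve_points_def poly_E_cubic)

text \<open>Vieta for the cubic x * (x - p) * (x - 2) - (l * x + m)^2, whose roots are the
  x-coordinates of the three intersection points, counted with multiplicity.\<close>

lemma line_through_points:
  fixes x1 x2 y1 y2 p :: rat
  assumes 1: "y1 ^ 2 = x1 * (x1 - p) * (x1 - 2)" and 2: "y2 ^ 2 = x2 * (x2 - p) * (x2 - 2)"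
    and ne: "\<not> (x1 = x2 \<and> y1 = - y2)"
    and l: "l = (if x1 = x2 then (3 * x1 ^ 2 - 2 * (p + 2) * x1 + 2 * p) / (2 * y1)
                 else (y2 - y1) / (x2 - x1))"
    and x3: "x3 = l ^ 2 + p + 2 - x1 - x2"
    and m: "m = y1 - l * x1"
  shows "l ^ 2 = x1 + x2 + x3 - p - 2"
    "2 * l * m = 2 * p - (x1 * x2 + x1 * x3 + x2 * x3)" "m ^ 2 = x1 * x2 * x3"
    "y1 = l * x1 + m" "y2 = l * x2 + m"
proof -
  show l2: "l ^ 2 = x1 + x2 + x3 - p - 2" and y1: "y1 = l * x1 + m"
    using x3 m by simp_all
  show lm: "2 * l * m = 2 * p - (x1 * x2 + x1 * x3 + x2 * x3)" and y2: "y2 = l * x2 + m"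
  proof (atomize (full), cases "x1 = x2")
    case True
    have "(y1 - y2) * (y1 + y2) = 0"
      using 1 2 True by Groebner_Basis.algebra
    then have yy: "y2 = y1" "y1 \<noteq> 0"
      using ne True by auto
    then have "2 * l * y1 = 3 * x1 ^ 2 - 2 * (p + 2) * x1 + 2 * p"
      using l True by simp
    then have "2 * l * m = 2 * p - (x1 * x1 + x1 * x3 + x1 * x3)"
      using x3 True unfolding m by Groebner_Basis.algebra
    then show "2 * l * m = 2 * p - (x1 * x2 + x1 * x3 + x2 * x3) \<and> y2 = l * x2 + m"
      using True yy y1 by simp
  next
    case False
    then have "l * (x2 - x1) = y2 - y1"
      using l by simp
    then have y2: "y2 = l * x2 + m"
      using m by Groebner_Basis.algebra
    \<comment> \<open>This is the difference of the two curve equations, which is divisible by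
      \<open>x1 - x2\<close>.\<close>
    have "(x1 - x2) * (2 * l * m - (2 * p - (x1 * x2 + x1 * x3 + x2 * x3))) = 0"
      using 1 2 unfolding y1 y2 x3 by Groebner_Basis.algebra
    then show "2 * l * m = 2 * p - (x1 * x2 + x1 * x3 + x2 * x3) \<and> y2 = l * x2 + m"
      using False y2 by simp
  qed
  \<comment> \<open>Since \<open>x1\<close> is a root of the cubic, the relation for the product of
    the roots follows from the other two.\<close>
  have "(l * x1 + m) ^ 2 = l ^ 2 * x1 ^ 2 + (2 * l * m) * x1 + m ^ 2"
    by Groebner_Basis.algebra
  then have "m ^ 2 = x1 * (x1 - p) * (x1 - 2) - l ^ 2 * x1 ^ 2 - (2 * l * m) * x1"
    using 1 y1 by simp
  then show "m ^ 2 = x1 * x2 * x3"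
    unfolding lm l2 by Groebner_Basis.algebra
qed

text \<open>If x^2 = 2p, the curve equation reads y^2 = 2p * (2x - (p + 2)), so 2x >= p + 2 and 8p
  >= (p + 2)^2, against the inequality of arithmetic and geometric means. Such an x would belong to
  a point whose double is (0, 0); its absence makes \<open>to_jacobi\<close> well defined.\<close>

lemma curve_x_square_ne:
  fixes x y p :: rat
  assumes "p > 2" "y ^ 2 = x * (x - p) * (x - 2)"
  shows "x ^ 2 - 2 * p \<noteq> 0"
proof
  assume "x ^ 2 - 2 * p = 0"
  then have x2: "x ^ 2 = 2 * p" by simp
  have "x * (x - p) * (x - 2) = x ^ 2 * x - (p + 2) * x ^ 2 + 2 * p * x" by Groebner_Basis.algebra
  then have "y ^ 2 = 2 * p * (2 * x - (p + 2))"
    unfolding assms(2) x2 by Groebner_Basis.algebra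
  then have "0 \<le> 2 * p * (2 * x - (p + 2))"
    by (metis zero_le_power2)
  then have "p + 2 \<le> 2 * x"
    using assms(1) by (simp add: zero_le_mult_iff)
  then have "(p + 2) ^ 2 \<le> (2 * x) ^ 2"
    using assms(1) by (intro power_mono) auto
  then have "(p + 2) ^ 2 \<le> 8 * p"
    using x2 by (simp add: power_mult_distrib)
  moreover have "(p + 2) ^ 2 = 8 * p + (p - 2) ^ 2" by Groebner_Basis.algebra
  moreover have "(p - 2) ^ 2 > 0" using assms(1) by simp
  ultimately show False by linarith
qed

section \<open>Embedding of the curve into the Jacobi model\<close>

text \<open>The point \<open>(s, c, d)\<close> attached to \<open>Q\<close> records the square roots of \<open>x\<close>, \<open>x - 2\<close>, \<open>x - p\<close>
  at \<open>2 Q\<close>: there \<open>x = 1 / s\<^sup>2\<close>, \<open>x - 2 = (c / s)\<^sup>2\<close> and \<open>x - p = (d / s)\<^sup>2\<close>.\<close>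

fun to_jacobi :: "rat \<Rightarrow> rat curve_point \<Rightarrow> rat \<times> rat \<times> rat" where
  "to_jacobi p Infinity = (0, 1, 1)"
| "to_jacobi p (Affine x y) =
    (2 * y / (x ^ 2 - 2 * p), (x ^ 2 - 4 * x + 2 * p) / (x ^ 2 - 2 * p),
     (x ^ 2 - 2 * p * x + 2 * p) / (x ^ 2 - 2 * p))"

lemma to_jacobi_in:
  assumes "p > 2" "A \<in> curve_points (E_cubic p)"
  shows "to_jacobi (of_nat p) A \<in> jacobi (of_nat p)"
proof (cases A)
  case (Affine x y)
  define P :: rat where "P = of_nat p"
  have P: "P > 2" using assms(1) by (simp add: P_def)
  have y: "y ^ 2 = x * (x - P) * (x - 2)"
    using assms(2) by (simp add: Affine Affine_in_curve_points P_def)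
  have F: "x ^ 2 - 2 * P \<noteq> 0" using curve_x_square_ne P y .
  have c: "(x ^ 2 - 4 * x + 2 * P) ^ 2 + 8 * y ^ 2 = (x ^ 2 - 2 * P) ^ 2"
    unfolding y by Groebner_Basis.algebra
  have d: "(x ^ 2 - 2 * P * x + 2 * P) ^ 2 + 4 * P * y ^ 2 = (x ^ 2 - 2 * P) ^ 2"
    unfolding y by Groebner_Basis.algebra
  have frac: "(M / z) ^ 2 + k * (N / z) ^ 2 = (M ^ 2 + k * N ^ 2) / z ^ 2" for M N k z :: rat
    by (simp add: power_divide add_divide_distrib)
  have "((x ^ 2 - 4 * x + 2 * P) / (x ^ 2 - 2 * P)) ^ 2 + 2 * (2 * y / (x ^ 2 - 2 * P)) ^ 2 = 1"
    "((x ^ 2 - 2 * P * x + 2 * P) / (x ^ 2 - 2 * P)) ^ 2 + P * (2 * y / (x ^ 2 - 2 * P)) ^ 2 = 1"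
    unfolding frac using c d F by (simp_all add: power_mult_distrib mult.left_commute)
  then show ?thesis
    unfolding Affine P_def[symmetric] to_jacobi.simps jacobi_def by blast
qed (simp add: jacobi_def)

text \<open>With F = x^2 - 2p, the coordinates \<open>c\<close> and \<open>d\<close> determine (x -
  p) / F and (x - 2) / F. The difference of these quotients determines F because p > 2, and then x
  and y are recovered.\<close>

lemma to_jacobi_inj:
  assumes p: "p > 2" and AB: "A \<in> curve_points (E_cubic p)" "B \<in> curve_points (E_cubic p)"
    and eq: "to_jacobi (of_nat p) A = to_jacobi (of_nat p) B"
  shows "A = B"
proof -
  define P :: rat where "P = of_nat p"
  have P: "P > 2" using p by (simp add: P_def)
  have F: "x ^ 2 - 2 * P \<noteq> 0" if "Affine x y \<in> curve_points (E_cubic p)" for x y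
    using that curve_x_square_ne[OF P, of y x] by (simp add: Affine_in_curve_points P_def)
  have ne: "to_jacobi P (Affine x y) \<noteq> to_jacobi P Infinity"
    if "Affine x y \<in> curve_points (E_cubic p)" for x y
  proof
    assume "to_jacobi P (Affine x y) = to_jacobi P Infinity"
    \<comment> \<open>A value 1 of the second coordinate forces x = p, a value 1 of the third forces
      x = 2.\<close>
    then have "x ^ 2 - 4 * x + 2 * P = x ^ 2 - 2 * P" "x ^ 2 - 2 * P * x + 2 * P = x ^ 2 - 2 * P"
      using F[OF that] unfolding to_jacobi.simps prod.inject
      by (metis (no_types) divide_eq_1_iff)+
    then have "x = P" "P * x = P * 2" by Groebner_Basis.algebra+
    then show False using P by simp
  qed
  show ?thesis
  proof (cases A)
    case Infinity
    then show ?thesis using ne AB eq by (cases B) (auto simp: P_def)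
  next
    case A: (Affine x y)
    then obtain x' y' where B: "B = Affine x' y'"
      using ne AB eq by (cases B) (auto simp: P_def)
    define F1 where "F1 = x ^ 2 - 2 * P"
    define F2 where "F2 = x' ^ 2 - 2 * P"
    have F0: "F1 \<noteq> 0" "F2 \<noteq> 0" using F[of x y] F[of x' y'] AB unfolding A B F1_def F2_def by blast+
    have "2 * y / F1 = 2 * y' / F2"
      and c: "(F1 - 4 * (x - P)) / F1 = (F2 - 4 * (x' - P)) / F2"
      and d: "(F1 - 2 * P * (x - 2)) / F1 = (F2 - 2 * P * (x' - 2)) / F2"
      using eq unfolding A B P_def[symmetric] by (simp_all add: F1_def F2_def algebra_simps)
    then have s: "y * F2 = y' * F1" using F0 by (simp add: frac_eq_eq)
    have c': "(x - P) * F2 = (x' - P) * F1"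
      using c unfolding frac_eq_eq[OF F0] by Groebner_Basis.algebra
    have "P * ((x - 2) * F2) = P * ((x' - 2) * F1)"
      using d unfolding frac_eq_eq[OF F0] by Groebner_Basis.algebra
    then have d': "(x - 2) * F2 = (x' - 2) * F1" using P by simp
    have "(P - 2) * F2 = (P - 2) * F1" using c' d' by Groebner_Basis.algebra
    then have "F1 = F2" using P by simp
    then show ?thesis using s c' F0 A B by simp
  qed
qed

lemma curve_add_closed:
  assumes "A \<in> curve_points (E_cubic p)" "B \<in> curve_points (E_cubic p)"
  shows "curve_add (E_cubic p) A B \<in> curve_points (E_cubic p)"
proof (cases "A = Infinity \<or> B = Infinity")
  case True
  then show ?thesis using assms by (cases A; cases B) auto
next
  case False
  then obtain x1 y1 x2 y2 where AB: "A = Affine x1 y1" "B = Affine x2 y2"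
    by (cases A; cases B) auto
  define P :: rat where "P = of_nat p"
  have 1: "y1 ^ 2 = x1 * (x1 - P) * (x1 - 2)" and 2: "y2 ^ 2 = x2 * (x2 - P) * (x2 - 2)"
    using assms by (auto simp: AB Affine_in_curve_points P_def)
  show ?thesis
  proof (cases "x1 = x2 \<and> y1 = - y2")
    case True
    then show ?thesis by (simp add: AB curve_points_def)
  next
    case ne: False
    define l where "l = (if x1 = x2 then (3 * x1 ^ 2 - 2 * (P + 2) * x1 + 2 * P) / (2 * y1)
                 else (y2 - y1) / (x2 - x1))"
    define x3 where "x3 = l ^ 2 + P + 2 - x1 - x2"
    define m where "m = y1 - l * x1"
    note r = line_through_points[OF 1 2 ne l_def x3_def m_def]
    have sum: "curve_add (E_cubic p) A B = Affine x3 (l * (x1 - x3) - y1)"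
      unfolding AB curve_add_E_cubic P_def[symmetric] l_def[symmetric] Let_def x3_def[symmetric]
      by (simp only: ne if_False)
    have "(l * (x1 - x3) - y1) ^ 2 = l ^ 2 * x3 ^ 2 + (2 * l * m) * x3 + m ^ 2"
      unfolding m_def by Groebner_Basis.algebra
    also have "\<dots> = x3 * (x3 - P) * (x3 - 2)"
      unfolding r(1-3) by Groebner_Basis.algebra
    finally show ?thesis
      unfolding sum Affine_in_curve_points P_def .
  qed
qed

text \<open>Apart from \<open>Infinity\<close> and opposite points this is
  \<open>jacobi_sum_collinear\<close> for the line through the two points. The sum is the reflection
  of the third intersection point, whence \<open>- y3\<close>.\<close>

lemma to_jacobi_add:
  assumes p: "p > 2" and AB: "A \<in> curve_points (E_cubic p)" "B \<in> curve_points (E_cubic p)"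
  shows "to_jacobi (of_nat p) (curve_add (E_cubic p) A B) =
    jacobi_add (of_nat p) (to_jacobi (of_nat p) A) (to_jacobi (of_nat p) B)"
proof (cases "A = Infinity \<or> B = Infinity")
  case True
  then show ?thesis by (cases A; cases B) auto
next
  case False
  then obtain x1 y1 x2 y2 where A: "A = Affine x1 y1" and B: "B = Affine x2 y2"
    by (cases A; cases B) auto
  define P :: rat where "P = of_nat p"
  have P: "P > 2" using p by (simp add: P_def)
  have 1: "y1 ^ 2 = x1 * (x1 - P) * (x1 - 2)" and 2: "y2 ^ 2 = x2 * (x2 - P) * (x2 - 2)"
    using AB by (auto simp: A B Affine_in_curve_points P_def)
  have J: "to_jacobi P A \<in> jacobi P" "to_jacobi P B \<in> jacobi P"
    using to_jacobi_in[OF p] AB P_def by auto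
  show ?thesis
  proof (cases "x1 = x2 \<and> y1 = - y2")
    case True
    obtain s c d where s: "to_jacobi P B = (s, c, d)" "to_jacobi P A = (- s, c, d)"
      using True by (simp add: A B)
    have h: "c ^ 2 = 1 - 2 * s ^ 2" "d ^ 2 = 1 - P * s ^ 2"
      using J(2) unfolding s jacobi_def by auto
    define z where "z = 1 - 2 * P * s ^ 2 * s ^ 2"
    have z: "z \<noteq> 0"
      using jacobi_denom_nonzero[OF P, of s c d s c d] J(2) unfolding s z_def by simp
    have "c ^ 2 + 2 * s ^ 2 * d ^ 2 = z" "d ^ 2 + P * s ^ 2 * c ^ 2 = z"
      unfolding h z_def by Groebner_Basis.algebra+
    moreover have "c * c - 2 * (- s) * s * d * d = c ^ 2 + 2 * s ^ 2 * d ^ 2"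
      "d * d - P * (- s) * s * c * c = d ^ 2 + P * s ^ 2 * c ^ 2" 
      by Groebner_Basis.algebra+
    ultimately have "jacobi_add P (to_jacobi P A) (to_jacobi P B) = (0, 1, 1)"
      unfolding s jacobi_add.simps Let_def power2_minus z_def[symmetric] using z by simp
    then show ?thesis using True by (simp add: A B P_def)
  next
    case ne: False
    define l where "l = (if x1 = x2 then (3 * x1 ^ 2 - 2 * (P + 2) * x1 + 2 * P) / (2 * y1)
                 else (y2 - y1) / (x2 - x1))"
    define x3 where "x3 = l ^ 2 + P + 2 - x1 - x2"
    define m where "m = y1 - l * x1"
    note r = line_through_points[OF 1 2 ne l_def x3_def m_def]
    define y3 where "y3 = l * x3 + m"
    have sum: "curve_add (E_cubic p) A B = Affine x3 (- y3)"
      unfolding A B curve_add_E_cubic P_def[symmetric] l_def[symmetric] Let_def x3_def[symmetric]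
      unfolding y3_def m_def by (simp only: ne if_False) (simp add: algebra_simps)
    define F where "F = (\<lambda>x. x ^ 2 - 2 * P)"
    define C where "C = (\<lambda>x. x ^ 2 - 4 * x + 2 * P)"
    define D where "D = (\<lambda>x. x ^ 2 - 2 * P * x + 2 * P)"
    define W where "W = F x1 ^ 2 * F x2 ^ 2 - 32 * P * y1 ^ 2 * y2 ^ 2"
    note R = jacobi_sum_collinear[OF r(1-5) y3_def F_def C_def D_def W_def]
    have "Affine x3 (- y3) \<in> curve_points (E_cubic p)"
      using curve_add_closed[OF AB] sum by simp
    then have "(- y3) ^ 2 = x3 * (x3 - P) * (x3 - 2)"
      by (simp add: Affine_in_curve_points P_def)
    then have F0: "F x1 \<noteq> 0" "F x2 \<noteq> 0" "F x3 \<noteq> 0"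
      using curve_x_square_ne[OF P] 1 2 unfolding F_def by blast+
    define G where "G = F x1 * F x2"
    have G: "G \<noteq> 0" using F0 by (simp add: G_def)
    have z: "1 - 2 * P * (2 * y1 / F x1) ^ 2 * (2 * y2 / F x2) ^ 2 = W / G ^ 2"
      using F0 by (simp add: W_def G_def power_divide power_mult_distrib diff_divide_distrib)
    \<comment> \<open>Up to \<open>G ^ 2\<close>, \<open>W\<close> is the denominator of the Jacobi
      addition, so the model supplies its nonvanishing.\<close>
    have "W / G ^ 2 \<noteq> 0"
      using jacobi_denom_nonzero[OF P J[unfolded A B to_jacobi.simps]]
      unfolding z[symmetric] F_def .
    then have W: "W \<noteq> 0" by auto
    have tj: "to_jacobi P (Affine x y) = (2 * y / F x, C x / F x, D x / F x)" for x y
      by (simp add: F_def C_def D_def)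
    have N: "2 * y1 / F x1 * (C x2 / F x2) * (D x2 / F x2) + 2 * y2 / F x2 * (C x1 / F x1) * (D x1 / F x1)
        = 2 * (y1 * C x2 * D x2 * F x1 + y2 * C x1 * D x1 * F x2) / G ^ 2"
      "C x1 / F x1 * (C x2 / F x2) - 2 * (2 * y1 / F x1) * (2 * y2 / F x2) * (D x1 / F x1) * (D x2 / F x2)
        = (C x1 * C x2 * F x1 * F x2 - 8 * y1 * y2 * D x1 * D x2) / G ^ 2"
      "D x1 / F x1 * (D x2 / F x2) - P * (2 * y1 / F x1) * (2 * y2 / F x2) * (C x1 / F x1) * (C x2 / F x2)
        = (D x1 * D x2 * F x1 * F x2 - 4 * P * y1 * y2 * C x1 * C x2) / G ^ 2"
      using F0 unfolding G_def
      by (simp_all add: add_divide_distrib diff_divide_distrib power2_eq_square ac_simps)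
    have cancel: "(N / G ^ 2) / (W / G ^ 2) = N / W" for N
      using G by simp
    have "2 * (- y3) / F x3 = 2 * (y1 * C x2 * D x2 * F x1 + y2 * C x1 * D x1 * F x2) / W"
      "C x3 / F x3 = (C x1 * C x2 * F x1 * F x2 - 8 * y1 * y2 * D x1 * D x2) / W"
      "D x3 / F x3 = (D x1 * D x2 * F x1 * F x2 - 4 * P * y1 * y2 * C x1 * C x2) / W"
      unfolding frac_eq_eq[OF F0(3) W] using R by (simp_all only: mult.commute mult.left_commute)
    then show ?thesis
      unfolding sum P_def[symmetric] unfolding A B tj jacobi_add.simps Let_def z N cancel
      by (simp only:)
  qed
qed

text \<open>Associativity and commutativity are pulled back along the injective additive map
  \<open>to_jacobi\<close>; the inverse, reflection in the x-axis, is visible on the curve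
  itself.\<close>

theorem comm_group_E:
  assumes p: "p > 2"
  shows "comm_group (E_group p)"
proof -
  have [simp]: "carrier (E_group p) = curve_points (E_cubic p)"
    "monoid.mult (E_group p) = curve_add (E_cubic p)" "\<one>\<^bsub>E_group p\<^esub> = Infinity"
    by (simp_all add: curve_group_def)
  have inf: "Infinity \<in> curve_points (E_cubic p)" by (simp add: curve_points_def)
  show ?thesis
  proof (rule comm_groupI; simp)
    show "curve_add (E_cubic p) A B \<in> curve_points (E_cubic p)"
      if "A \<in> curve_points (E_cubic p)" "B \<in> curve_points (E_cubic p)" for A B
      using curve_add_closed that .
    show "Infinity \<in> curve_points (E_cubic p)" by (rule inf)
    show "curve_add (E_cubic p) (curve_add (E_cubic p) A B) Q =
        curve_add (E_cubic p) A (curve_add (E_cubic p) B Q)"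
      if "A \<in> curve_points (E_cubic p)" "B \<in> curve_points (E_cubic p)" "Q \<in> curve_points (E_cubic p)"
      for A B Q
      using that jacobi_add_assoc[of "of_nat p :: rat"] p
      by (intro to_jacobi_inj[OF p]) (simp_all add: curve_add_closed to_jacobi_add to_jacobi_in)
    show "curve_add (E_cubic p) A B = curve_add (E_cubic p) B A"
      if "A \<in> curve_points (E_cubic p)" "B \<in> curve_points (E_cubic p)" for A B
      using that p
      by (intro to_jacobi_inj[OF p]) (simp_all add: curve_add_closed to_jacobi_add jacobi_add_commute)
    show "\<exists>B\<in>curve_points (E_cubic p). curve_add (E_cubic p) B A = Infinity"
      if "A \<in> curve_points (E_cubic p)" for A
    proof (cases A)
      case Infinity
      then show ?thesis using inf by (intro bexI[of _ Infinity]) simp_all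
    next
      case (Affine x y)
      then show ?thesis using that
        by (intro bexI[of _ "Affine x (- y)"]) (simp_all add: Affine_in_curve_points)
    qed
  qed
qed

section \<open>Infinite descent in abelian groups\<close>

context comm_group
begin

text \<open>Used twice on an orbit that repeats: from its starting point to the repeated point, and
  once around the cycle.\<close>

lemma descent_iterate:
  assumes H: "subgroup H G" and g: "g \<in> H"
    and D: "\<And>x. x \<in> H \<Longrightarrow> D x \<in> H" "\<And>x. x \<in> H \<Longrightarrow> \<exists>e::int. x = g [^] e \<otimes> D x [^] (2::int)"
    and x: "x \<in> H"
  shows "(D ^^ n) x \<in> H \<and> (\<exists>c::int. x = g [^] c \<otimes> (D ^^ n) x [^] ((2::int) ^ n))"
proof (induction n)
  case 0
  then show ?case using x subgroup.mem_carrier[OF H] 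
    by (auto intro!: exI[of _ 0] simp: int_pow_1)
next
  case (Suc n)
  then obtain c :: int where y: "(D ^^ n) x \<in> H" and c: "x = g [^] c \<otimes> (D ^^ n) x [^] ((2::int) ^ n)"
    by blast
  define y where "y = (D ^^ n) x"
  obtain e :: int where e: "y = g [^] e \<otimes> D y [^] (2::int)" using D(2) y y_def by blast
  have mem: "y \<in> H" "D y \<in> H" using y D(1) by (auto simp: y_def)
  have car: "g \<in> carrier G" "y \<in> carrier G" "D y \<in> carrier G"
    using subgroup.mem_carrier[OF H] g mem by auto
  have "y [^] ((2::int) ^ n) = (g [^] e \<otimes> D y [^] (2::int)) [^] ((2::int) ^ n)"
    using e by simp
  also have "\<dots> = g [^] (e * 2 ^ n) \<otimes> D y [^] ((2::int) ^ Suc n)"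
    using car by (simp add: int_pow_distrib int_pow_pow)
  finally have "x = g [^] (c + e * 2 ^ n) \<otimes> D y [^] ((2::int) ^ Suc n)"
    using c car by (simp add: y_def[symmetric] int_pow_mult m_assoc)
  then show ?case using mem y_def by auto
qed

lemma power_in_cyclic_mult:
  assumes "g \<in> carrier G" "x \<in> carrier G" "x [^] (N::int) = g [^] (c::int)" "N dvd M"
  shows "\<exists>c::int. x [^] M = g [^] c"
proof -
  obtain k where "M = N * k" using assms(4) by blast
  then have "x [^] M = g [^] (c * k)"
    using assms by (simp add: int_pow_pow[symmetric])
  then show ?thesis by blast
qed

text \<open>No descent step leaves the finite set of elements of height at most \<open>K\<close>, so
  orbits there are eventually periodic and each element has an exponent. The product of these
  finitely many exponents serves the whole set. It also serves all of \<open>H\<close>: if it works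
  for \<open>D x\<close>, it works for \<open>x\<close>, because x = g^e (D x)^2.\<close>

lemma uniform_power_in_cyclic:
  fixes h :: "'a \<Rightarrow> nat" and K :: nat
  assumes H: "subgroup H G" and g: "g \<in> H"
    and fin: "finite {x \<in> H. h x \<le> K}"
    and descent: "\<And>x. x \<in> H \<Longrightarrow> \<exists>y\<in>H. (\<exists>e::int. x = g [^] e \<otimes> y [^] (2::int)) \<and> (h y < h x \<or> h y \<le> K)"
  shows "\<exists>N::int. N > 0 \<and> (\<forall>x\<in>H. \<exists>c::int. x [^] N = g [^] c)"
proof -
  define S where "S = {x \<in> H. h x \<le> K}"
  have "\<exists>D. \<forall>x\<in>H. D x \<in> H \<and> (\<exists>e::int. x = g [^] e \<otimes> D x [^] (2::int)) \<and> (h (D x) < h x \<or> h (D x) \<le> K)"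
    using descent by (intro bchoice) blast
  then obtain D where D: "\<And>x. x \<in> H \<Longrightarrow> D x \<in> H"
      "\<And>x. x \<in> H \<Longrightarrow> \<exists>e::int. x = g [^] e \<otimes> D x [^] (2::int)"
      "\<And>x. x \<in> H \<Longrightarrow> h (D x) < h x \<or> h (D x) \<le> K"
    by blast
  note car = subgroup.mem_carrier[OF H]
  have ex: "\<exists>N::int. N > 0 \<and> (\<exists>c::int. x [^] N = g [^] c)" if x: "x \<in> S" for x
  proof -
    \<comment> \<open>A repetition \<open>y\<close> in the orbit of \<open>x\<close> satisfies \<open>y = c g + 2\<^sup>k y\<close>, so \<open>(2\<^sup>k - 1) y\<close> is a multiple of \<open>g\<close>.\<close>
    have S: "(D ^^ n) x \<in> S" for n
      by (induction n) (use x D in \<open>force simp: S_def\<close>)+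
    have "\<not> inj (\<lambda>n. (D ^^ n) x)"
      using S fin unfolding S_def by (metis (no_types, lifting) finite_subset image_subsetI range_inj_infinite)
    then obtain i j where ij: "i < j" "(D ^^ i) x = (D ^^ j) x"
      unfolding inj_def by (metis nat_neq_iff)
    define k where "k = j - i"
    define y where "y = (D ^^ i) x"
    have xH: "x \<in> H" and yH: "y \<in> H" using x S by (auto simp: S_def y_def)
    have "(D ^^ k) y = (D ^^ (k + i)) x" by (simp add: y_def funpow_add)
    then have "(D ^^ k) y = y" using ij by (simp add: y_def k_def)
    then obtain c :: int where c: "y = g [^] c \<otimes> y [^] ((2::int) ^ k)"
      using descent_iterate[OF H g D(1,2) yH, of k] by auto
    obtain c' :: int where c': "x = g [^] c' \<otimes> y [^] ((2::int) ^ i)"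
      using descent_iterate[OF H g D(1,2) xH, of i] y_def by auto
    define N :: int where "N = 2 ^ k - 1"
    have N: "N > 0" using ij by (simp add: N_def k_def)
    have yg: "y \<in> carrier G" "g \<in> carrier G" using yH g car by auto
    have "y [^] ((2::int) ^ k) = y [^] (1 + N)" by (simp add: N_def)
    also have "\<dots> = y \<otimes> y [^] N" using yg by (simp only: int_pow_mult int_pow_1)
    finally have "y = g [^] c \<otimes> (y \<otimes> y [^] N)"
      using c by simp
    then have "y = y \<otimes> (g [^] c \<otimes> y [^] N)"
      using yg by (simp only: m_lcomm int_pow_closed)
    then have "g [^] c \<otimes> y [^] N = \<one>"
      using yg r_cancel_one'[of y "g [^] c \<otimes> y [^] N"] l_cancel_one'[of y "g [^] c \<otimes> y [^] N"] by simp
    then have yN: "y [^] N = g [^] (- c)"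
      using yg by (metis int_pow_closed int_pow_neg inv_equality m_comm)
    have "x [^] N = g [^] (c' * N) \<otimes> (y [^] N) [^] ((2::int) ^ i)"
      using yg unfolding c' by (simp add: int_pow_distrib int_pow_pow mult.commute)
    also have "\<dots> = g [^] (c' * N + - c * 2 ^ i)"
      using yg unfolding yN by (simp only: int_pow_pow int_pow_mult)
    finally show ?thesis using N by blast
  qed
  then obtain M :: "'a \<Rightarrow> int" where M: "\<And>x. x \<in> S \<Longrightarrow> M x > 0" "\<And>x. x \<in> S \<Longrightarrow> \<exists>c::int. x [^] M x = g [^] c"
    by metis
  define N where "N = (\<Prod>x\<in>S. M x)"
  have S: "\<exists>c::int. x [^] N = g [^] c" if "x \<in> S" for x
    using power_in_cyclic_mult[of g x "M x" _ N] M(2)[OF that] that g car fin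
    unfolding N_def by (auto simp: S_def intro: dvd_prodI)
  have "\<exists>c::int. x [^] N = g [^] c" if "x \<in> H" for x
    using that
  proof (induction "h x" arbitrary: x rule: less_induct)
    case less
    show ?case
    proof (cases "h x \<le> K")
      case True
      then show ?thesis using S less.prems by (simp add: S_def)
    next
      case False
      obtain e :: int where e: "x = g [^] e \<otimes> D x [^] (2::int)" using D(2) less.prems by blast
      have "h (D x) < h x" using False D(3)[OF less.prems] by auto
      then obtain c :: int where c: "D x [^] N = g [^] c"
        using less.hyps D(1) less.prems by blast
      have dx: "D x \<in> carrier G" "g \<in> carrier G" using D(1) less.prems g car by auto
      have "x [^] N = (g [^] e \<otimes> D x [^] (2::int)) [^] N" using e by simp
      also have "\<dots> = g [^] (e * N) \<otimes> (D x [^] N) [^] (2::int)"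
        using dx by (simp add: int_pow_distrib int_pow_pow mult.commute)
      also have "\<dots> = g [^] (e * N + c * 2)"
        using dx unfolding c by (simp only: int_pow_pow int_pow_mult)
      finally show ?thesis by blast
    qed
  qed
  moreover have "N > 0" using M(1) unfolding N_def by (simp add: prod_pos)
  ultimately show ?thesis by blast
qed

text \<open>The N-th power map sends \<open>H\<close> into the powers of \<open>g\<close>, and by
  torsion-freeness it is injective; so \<open>H\<close> is cyclic like every subgroup of a cyclic
  group, by division with remainder of exponents.\<close>

lemma cyclic_if_uniform_power:
  assumes H: "subgroup H G" and g: "g \<in> H"
    and tf: "\<And>x n. x \<in> H \<Longrightarrow> n > 0 \<Longrightarrow> x [^] (n::nat) = \<one> \<Longrightarrow> x = \<one>"
    and N: "N > 0" "\<And>x. x \<in> H \<Longrightarrow> \<exists>c::int. x [^] (N::int) = g [^] c"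
  shows "\<exists>q\<in>H. \<forall>x\<in>H. \<exists>n::int. x = q [^] n"
proof -
  note car = subgroup.mem_carrier[OF H]
  have tf': "x = \<one>" if "x \<in> H" "n \<noteq> 0" "x [^] (n::int) = \<one>" for x n
  proof -
    have "x [^] \<bar>n\<bar> = \<one>" using that car by (cases "n \<ge> 0") (auto simp: int_pow_neg)
    then have "x [^] nat \<bar>n\<bar> = \<one>" by (metis abs_ge_zero int_pow_int nat_0_le)
    then show ?thesis by (rule tf[OF that(1), rotated]) (use that(2) in simp)
  qed
  have Hpow: "x [^] (n::int) \<in> H" if "x \<in> H" for x n
    using that H by (metis subgroup_int_pow_closed)
  have gc: "g \<in> carrier G" using g car by blast
  \<comment> \<open>The exponents of \<open>g\<close> reached by N-th powers from \<open>H\<close>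
    are closed under differences, so the least positive one divides all of them. \<open>N\<close> is
    such an exponent, by the choice x = g.\<close>
  define I where "I = {c::int. \<exists>x\<in>H. x [^] N = g [^] c}"
  have NI: "N \<in> I" using g by (auto simp: I_def)
  define d where "d = (LEAST n::nat. n > 0 \<and> int n \<in> I)"
  have "nat N > 0 \<and> int (nat N) \<in> I" using NI N by simp
  then have d: "d > 0" "int d \<in> I" and dmin: "\<And>n. n > 0 \<Longrightarrow> int n \<in> I \<Longrightarrow> d \<le> n"
    unfolding d_def by (metis (mono_tags, lifting) LeastI_ex, metis (mono_tags, lifting) LeastI_ex,
      simp add: Least_le)
  obtain q where q: "q \<in> H" "q [^] N = g [^] int d" using d I_def by blast
  have qc: "q \<in> carrier G" using q car by blast
  have "\<exists>n::int. x = q [^] n" if x: "x \<in> H" for x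
  proof -
    obtain c :: int where c: "x [^] N = g [^] c" using N(2)[OF x] by blast
    define k where "k = c div int d"
    define r where "r = c mod int d"
    have xc: "x \<in> carrier G" using x car by blast
    define y where "y = x \<otimes> q [^] (- k)"
    have yH: "y \<in> H" using x Hpow[OF q(1)] H by (simp add: y_def subgroup.m_closed)
    have "y [^] N = x [^] N \<otimes> (q [^] N) [^] (- k)"
      using xc qc unfolding y_def by (simp add: int_pow_distrib int_pow_pow mult.commute)
    also have "\<dots> = g [^] (c + int d * - k)"
      using gc unfolding c q(2) by (simp only: int_pow_pow int_pow_mult)
    also have "c + int d * - k = r" by (simp add: k_def r_def minus_div_mult_eq_mod[symmetric] mult.commute)
    finally have y: "y [^] N = g [^] r" .
    have "r = 0"
    proof (rule ccontr)
      assume "r \<noteq> 0"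
      moreover have "r \<ge> 0" "r < int d" using d by (simp_all add: r_def)
      moreover have "r \<in> I" using y yH by (auto simp: I_def)
      ultimately show False using dmin[of "nat r"] by auto
    qed
    then have "y = \<one>" using y tf'[OF yH, of N] N by simp
    then have "x = q [^] k"
      using xc qc unfolding y_def by (metis int_pow_closed int_pow_neg inv_solve_right l_one one_closed)
    then show ?thesis by blast
  qed
  then show ?thesis using q by blast
qed

end

section \<open>Rank and structure\<close>

context comm_group
begin

lemma involution_pow_mod2:
  assumes "x \<in> carrier G" "x \<otimes> x = \<one>"
  shows "x [^] (k mod 2) = x [^] (k::int)"
proof -
  have "x [^] (2::int) = x \<otimes> x" using assms(1) int_pow_mult[of x 1 1] by (simp add: int_pow_1)
  then have "x [^] (2 * (k div 2)) = \<one>"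
    using assms by (simp add: int_pow_pow[symmetric] int_pow_one)
  then have "x [^] (2 * (k div 2) + k mod 2) = x [^] (k mod 2)"
    using assms(1) by (simp only: int_pow_mult l_one int_pow_closed)
  then show ?thesis by simp
qed

lemma klein_four_iso:
  assumes a: "a \<in> carrier G" "a \<otimes> a = \<one>" "a \<noteq> \<one>" and b: "b \<in> carrier G" "b \<otimes> b = \<one>" "b \<noteq> \<one>"
    and "a \<noteq> b" and T: "T = {\<one>, a, b, a \<otimes> b}"
  shows "integer_mod_group 2 \<times>\<times> integer_mod_group 2 \<cong> G\<lparr>carrier := T\<rparr>"
proof -
  define f where "f = (\<lambda>(i::int, j::int). a [^] i \<otimes> b [^] j)"
  have mult: "f ((i + i') mod 2, (j + j') mod 2) = f (i, j) \<otimes> f (i', j')" for i j i' j'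
    using a b unfolding f_def
    by (simp add: involution_pow_mod2 int_pow_mult m_ac)
  have car: "{0..<2::int} = {0, 1}" by auto
  have f: "f (0, 0) = \<one>" "f (1, 0) = a" "f (0, 1) = b" "f (1, 1) = a \<otimes> b"
    using a b by (simp_all add: f_def int_pow_1)
  then have img: "f ` ({0, 1} \<times> {0, 1}) = T" by (auto simp: T image_iff)
  have "f \<in> hom (integer_mod_group 2 \<times>\<times> integer_mod_group 2) (G\<lparr>carrier := T\<rparr>)"
  proof (rule homI)
    show "f x \<in> carrier (G\<lparr>carrier := T\<rparr>)"
      if "x \<in> carrier (integer_mod_group 2 \<times>\<times> integer_mod_group 2)" for x
      using that img by (auto simp: carrier_integer_mod_group car)
    show "f (x \<otimes>\<^bsub>integer_mod_group 2 \<times>\<times> integer_mod_group 2\<^esub> y) = f x \<otimes>\<^bsub>G\<lparr>carrier := T\<rparr>\<^esub> f y" for x y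
      by (cases x; cases y) (simp add: mult)
  qed
  moreover have "bij_betw f ({0, 1} \<times> {0, 1}) T"
  proof -
    have "a \<otimes> b \<noteq> \<one>" using a b \<open>a \<noteq> b\<close> by (metis inv_equality inv_unique')
    moreover have "a \<otimes> b \<noteq> a" "a \<otimes> b \<noteq> b" using a b by simp_all
    ultimately have "inj_on f ({0, 1} \<times> {0, 1})"
      using a(3) b(3) \<open>a \<noteq> b\<close> unfolding inj_on_def by (auto simp: f)
    then show ?thesis using img by (simp add: bij_betw_def)
  qed
  ultimately show ?thesis
    by (auto simp: is_iso_def iso_def carrier_integer_mod_group car)
qed

text \<open>Squaring has kernel \<open>T\<close>, and its image is infinite cyclic with generator
  \<open>r \<otimes> r\<close>; the element \<open>r\<close> splits it. If the square of x is the
  n-th power of \<open>r \<otimes> r\<close>, then x differs from the n-th power of \<open>r\<close>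
  by an element of \<open>T\<close>.\<close>

lemma iso_integer_times_two_torsion:
  assumes T: "T = {x \<in> carrier G. x \<otimes> x = \<one>}"
    and r: "r \<in> carrier G" and cyc: "\<And>x. x \<in> carrier G \<Longrightarrow> \<exists>n::int. x \<otimes> x = (r \<otimes> r) [^] n"
    and inf: "\<And>n::int. (r \<otimes> r) [^] n = \<one> \<Longrightarrow> n = 0"
  shows "integer_group \<times>\<times> G\<lparr>carrier := T\<rparr> \<cong> G"
proof -
  define f where "f = (\<lambda>(n::int, t). r [^] n \<otimes> t)"
  have sq: "r [^] n \<otimes> r [^] n = (r \<otimes> r) [^] n" for n :: int
    using r by (simp add: int_pow_distrib)
  have Tc: "t \<in> carrier G" "t \<otimes> t = \<one>" if "t \<in> T" for t using that T by auto
  have "f \<in> hom (integer_group \<times>\<times> G\<lparr>carrier := T\<rparr>) G"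
    using r Tc by (auto simp: hom_def f_def int_pow_mult m_ac)
  moreover have "inj_on f (UNIV \<times> T)"
  proof (rule inj_onI, clarify)
    fix n t n' t' assume t: "t \<in> T" "t' \<in> T" "f (n, t) = f (n', t')"
    have "f (n, t) \<otimes> f (n, t) = (r \<otimes> r) [^] n" if "t \<in> T" for n t
    proof -
      have "f (n, t) \<otimes> f (n, t) = (r [^] n \<otimes> r [^] n) \<otimes> (t \<otimes> t)"
        using r Tc(1)[OF that] by (simp add: f_def m_ac)
      then show ?thesis using r Tc[OF that] sq by simp
    qed
    then have "(r \<otimes> r) [^] n = (r \<otimes> r) [^] n'" using t by metis
    then have "(r \<otimes> r) [^] (n - n') = \<one>" using r by (simp add: int_pow_diff)
    then have "n = n'" using inf by fastforce
    then show "n = n' \<and> t = t'" using t Tc r by (simp add: f_def)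
  qed
  moreover have "f ` (UNIV \<times> T) = carrier G"
  proof
    show "f ` (UNIV \<times> T) \<subseteq> carrier G" using r Tc by (auto simp: f_def)
    show "carrier G \<subseteq> f ` (UNIV \<times> T)"
    proof
      fix x assume x: "x \<in> carrier G"
      obtain n :: int where n: "x \<otimes> x = (r \<otimes> r) [^] n" using cyc x by blast
      define t where "t = r [^] (- n) \<otimes> x"
      have "t \<otimes> t = (r [^] (- n) \<otimes> r [^] (- n)) \<otimes> (x \<otimes> x)"
        using r x by (simp add: t_def m_ac)
      also have "\<dots> = (r \<otimes> r) [^] (- n + n)"
        using r unfolding sq n by (simp only: int_pow_mult m_closed)
      finally have "t \<in> T" using r x by (simp add: T t_def)
      moreover have "r [^] n \<otimes> t = x"
        using r x by (simp add: t_def m_assoc[symmetric] int_pow_mult[symmetric])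
      then have "f (n, t) = x" by (simp add: f_def)
      ultimately show "x \<in> f ` (UNIV \<times> T)" by (metis UNIV_I image_eqI mem_Sigma_iff)
    qed
  qed
  ultimately show ?thesis
    by (auto simp: is_iso_def iso_def bij_betw_def)
qed

end

section \<open>Existence and uniqueness of the free rank\<close>

lemma free_group_Z_1: "integer_group \<cong> free_group_Z 1"
proof -
  define f where "f = (\<lambda>n::int. \<lambda>i\<in>{..<1::nat}. n)"
  have "f \<in> hom integer_group (free_group_Z 1)"
    by (auto simp: hom_def f_def free_group_Z_def fun_eq_iff)
  moreover have "bij_betw f UNIV ({..<1} \<rightarrow>\<^sub>E UNIV)"
  proof (rule bij_betwI[of _ _ _ "\<lambda>g. g 0"])
    show "f (g 0) = g" if "g \<in> {..<1} \<rightarrow>\<^sub>E UNIV" for g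
      using that by (auto simp: f_def fun_eq_iff PiE_iff extensional_def)
  qed (auto simp: f_def)
  ultimately show ?thesis
    by (auto simp: is_iso_def iso_def free_group_Z_def)
qed

lemma free_group_Z_0_DirProd: "H \<cong> free_group_Z 0 \<times>\<times> H"
proof -
  \<comment> \<open>On the empty index set \<open>\<lambda>_. undefined\<close> is the only
    extensional function, hence the single element of \<open>free_group_Z 0\<close>.\<close>
  have "(\<lambda>h. (\<lambda>_. undefined, h)) \<in> iso H (free_group_Z 0 \<times>\<times> H)"
    by (auto simp: iso_def hom_def free_group_Z_def bij_betw_def inj_on_def image_iff restrict_def)
  then show ?thesis by (auto simp: is_iso_def)
qed

context comm_group
begin

text \<open>For \<open>r \<ge> 2\<close> two standard basis vectors would both have to be congruent to the image of \<open>g\<close>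
  modulo 2.\<close>

lemma rank_of_iso:
  assumes T: "T = {x \<in> carrier G. x \<otimes> x = \<one>}" and tors: "torsion_subgroup G = G\<lparr>carrier := T\<rparr>"
    and g: "g \<in> carrier G"
    and weak: "\<And>x. x \<in> carrier G \<Longrightarrow> \<exists>t\<in>T. \<exists>y\<in>carrier G. x = t \<otimes> (y \<otimes> y) \<or> x = t \<otimes> (g \<otimes> (y \<otimes> y))"
    and iso: "G \<cong> free_group_Z r \<times>\<times> torsion_subgroup G"
  shows "r = (if carrier G = T then 0 else 1)"
proof -
  obtain f where f: "f \<in> hom G (free_group_Z r \<times>\<times> G\<lparr>carrier := T\<rparr>)"
    "bij_betw f (carrier G) (carrier (free_group_Z r \<times>\<times> G\<lparr>carrier := T\<rparr>))"
    using iso unfolding tors is_iso_def iso_def by blast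
  define \<pi> where "\<pi> i x = fst (f x) i" for i x
  have mult: "f (x \<otimes> y) = f x \<otimes>\<^bsub>free_group_Z r \<times>\<times> G\<lparr>carrier := T\<rparr>\<^esub> f y"
    if "x \<in> carrier G" "y \<in> carrier G" for x y
    using f(1) that by (auto simp: hom_def)
  have mem: "fst (f x) \<in> {..<r} \<rightarrow>\<^sub>E UNIV" "snd (f x) \<in> T" if "x \<in> carrier G" for x
    using f(1) that by (auto simp: hom_def free_group_Z_def Pi_iff mem_Times_iff)
  have \<pi>: "\<pi> i (x \<otimes> y) = \<pi> i x + \<pi> i y" if "x \<in> carrier G" "y \<in> carrier G" "i < r" for i x y
    using mult[OF that(1,2)] that(3) by (simp add: \<pi>_def mult_DirProd' free_group_Z_def)
  have \<pi>1: "\<pi> i \<one> = 0" if "i < r" for i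
    using \<pi>[of \<one> \<one> i] that by simp
  have \<pi>T: "\<pi> i t = 0" if "t \<in> T" "i < r" for i t
    using \<pi>[of t t i] \<pi>1[OF that(2)] that T by simp
  have surj: "\<exists>x\<in>carrier G. \<forall>i<r. \<pi> i x = k i" for k :: "nat \<Rightarrow> int"
  proof -
    have "((\<lambda>i\<in>{..<r}. k i), \<one>) \<in> carrier (free_group_Z r \<times>\<times> G\<lparr>carrier := T\<rparr>)"
      using T by (simp add: free_group_Z_def)
    then obtain x where "x \<in> carrier G" "f x = ((\<lambda>i\<in>{..<r}. k i), \<one>)"
      using f(2) unfolding bij_betw_def by (metis imageE)
    then show ?thesis by (intro bexI[of _ x]) (simp_all add: \<pi>_def)
  qed
  have "r < 2"
  proof (rule ccontr)
    assume "\<not> r < 2"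
    then have r: "0 < r" "1 < r" by simp_all
    obtain x where x: "x \<in> carrier G" "\<forall>i<r. \<pi> i x = (if i = 0 then 1 else 0)"
      using surj[of "\<lambda>i. if i = 0 then 1 else 0"] by blast
    obtain y where y: "y \<in> carrier G" "\<forall>i<r. \<pi> i y = (if i = 1 then 1 else 0)"
      using surj[of "\<lambda>i. if i = 1 then 1 else 0"] by blast
    have parity: "\<exists>e::int. e \<in> {0, 1} \<and> (\<forall>i<r. even (\<pi> i x - e * \<pi> i g))" if x: "x \<in> carrier G" for x
    proof -
      obtain t z where tz: "t \<in> T" "z \<in> carrier G" "x = t \<otimes> (z \<otimes> z) \<or> x = t \<otimes> (g \<otimes> (z \<otimes> z))"
        using weak x by blast
      have tc: "t \<in> carrier G" using tz T by simp
      from tz(3) show ?thesis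
      proof
        assume "x = t \<otimes> (z \<otimes> z)"
        then show ?thesis using tz tc by (intro exI[of _ 0]) (simp add: \<pi> \<pi>T)
      next
        assume "x = t \<otimes> (g \<otimes> (z \<otimes> z))"
        then show ?thesis using tz tc g by (intro exI[of _ 1]) (simp add: \<pi> \<pi>T)
      qed
    qed
    obtain e :: int where e: "e \<in> {0, 1}" "\<forall>i<r. even (\<pi> i x - e * \<pi> i g)" using parity x(1) by blast
    obtain e' :: int where e': "e' \<in> {0, 1}" "\<forall>i<r. even (\<pi> i y - e' * \<pi> i g)" using parity y(1) by blast
    \<comment> \<open>The basis vector of index 0 forces \<open>\<pi> 0 g\<close> odd and
      \<open>\<pi> 1 g\<close> even; the one of index 1 forces the reverse.\<close>
    have "even (1 - e * \<pi> 0 g)" "even (0 - e * \<pi> 1 g)" using e(2) x(2) r by force+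
    moreover have "even (0 - e' * \<pi> 0 g)" "even (1 - e' * \<pi> 1 g)" using e'(2) y(2) r by force+
    ultimately show False using e(1) e'(1) by auto
  qed
  moreover have "carrier G \<noteq> T" if r1: "r = 1"
  proof -
    obtain x where "x \<in> carrier G" "\<pi> 0 x = 1" using surj[of "\<lambda>_. 1"] r1 by auto
    then show ?thesis using \<pi>T[of x 0] r1 by force
  qed
  moreover have "carrier G = T" if "r = 0"
  proof -
    \<comment> \<open>Without free coordinates the first component of \<open>f\<close> is constant,
      so \<open>f\<close> is determined by its component in \<open>T\<close>, where every element
      squares to the neutral one.\<close>
    have triv: "fst (f x) = fst (f y)" if "x \<in> carrier G" "y \<in> carrier G" for x y
      using mem(1)[OF that(1)] mem(1)[OF that(2)] \<open>r = 0\<close> by auto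
    have "x \<otimes> x = \<one>" if x: "x \<in> carrier G" for x
    proof -
      have s: "snd (f (x \<otimes> y)) = snd (f x) \<otimes> snd (f y)" if "x \<in> carrier G" "y \<in> carrier G" for x y
        using mult[OF that] by (simp add: mult_DirProd')
      have sc: "snd (f x) \<in> carrier G" "snd (f x) \<otimes> snd (f x) = \<one>" if "x \<in> carrier G" for x
        using mem(2)[OF that] T by auto
      have "snd (f (x \<otimes> x)) = \<one>" "snd (f \<one>) = \<one>"
        using s[OF x x] sc(2)[OF x] s[of \<one> \<one>] sc(2)[of \<one>] by simp_all
      then have "f (x \<otimes> x) = f \<one>" using triv[of "x \<otimes> x" \<one>] x by (simp add: prod_eq_iff)
      then show ?thesis using f(2) x by (auto simp: bij_betw_def inj_on_def)
    qed
    then show ?thesis using T by auto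
  qed
  ultimately show ?thesis by (cases r) auto
qed

text \<open>The case split asks whether the generator \<open>r \<otimes> r\<close> of the squares is
  trivial. In each case an explicit isomorphism supplies existence for the definite description in
  \<open>abelian_rank\<close>, and \<open>rank_of_iso\<close> supplies uniqueness.\<close>

lemma rank_and_structure:
  assumes T: "T = {x \<in> carrier G. x \<otimes> x = \<one>}" and tors: "torsion_subgroup G = G\<lparr>carrier := T\<rparr>"
    and g: "g \<in> carrier G"
    and weak: "\<And>x. x \<in> carrier G \<Longrightarrow> \<exists>t\<in>T. \<exists>y\<in>carrier G. x = t \<otimes> (y \<otimes> y) \<or> x = t \<otimes> (g \<otimes> (y \<otimes> y))"
    and four: "a \<in> T" "b \<in> T" "a \<noteq> \<one>" "b \<noteq> \<one>" "a \<noteq> b" "T = {\<one>, a, b, a \<otimes> b}"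
    and r: "r \<in> carrier G" and cyc: "\<And>x. x \<in> carrier G \<Longrightarrow> \<exists>n::int. x \<otimes> x = (r \<otimes> r) [^] n"
    and inf: "r \<otimes> r \<noteq> \<one> \<Longrightarrow> (\<And>n::int. (r \<otimes> r) [^] n = \<one> \<Longrightarrow> n = 0)"
  shows "abelian_rank G \<le> 1 \<and>
    (G \<cong> integer_mod_group 2 \<times>\<times> integer_mod_group 2 \<or>
     G \<cong> integer_group \<times>\<times> integer_mod_group 2 \<times>\<times> integer_mod_group 2)"
proof -
  let ?V = "integer_mod_group 2 \<times>\<times> integer_mod_group 2"
  have V: "?V \<cong> G\<lparr>carrier := T\<rparr>"
    using klein_four_iso[of a b T] four T by auto
  have grV: "group ?V" by (simp add: DirProd_group)
  have V': "G\<lparr>carrier := T\<rparr> \<cong> ?V" using group.iso_sym[OF grV V] .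
  have rank: "abelian_rank G = k" if "G \<cong> free_group_Z k \<times>\<times> torsion_subgroup G" for k
    unfolding abelian_rank_def
    using that rank_of_iso[OF T tors g weak] by (intro the_equality) metis+
  show ?thesis
  proof (cases "r \<otimes> r = \<one>")
    case True
    then have "carrier G = T" using cyc T by (auto simp: int_pow_one)
    then have GT: "G\<lparr>carrier := T\<rparr> = G" by (metis partial_object.update_convs(1) partial_object.surjective)
    have "G \<cong> free_group_Z 0 \<times>\<times> torsion_subgroup G"
      unfolding tors GT by (rule free_group_Z_0_DirProd)
    then have "abelian_rank G = 0" by (rule rank)
    then show ?thesis using V' GT by simp
  next
    case False
    have iso: "integer_group \<times>\<times> G\<lparr>carrier := T\<rparr> \<cong> G"
      using iso_integer_times_two_torsion[OF T r cyc inf[OF False]] .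
    have "subgroup T G"
    proof (rule subgroupI)
      show "T \<subseteq> carrier G" "T \<noteq> {}" using T by auto
      show "inv x \<in> T" if "x \<in> T" for x
        using that T by (auto simp: inv_mult[symmetric])
      show "x \<otimes> y \<in> T" if xy: "x \<in> T" "y \<in> T" for x y
      proof -
        have "(x \<otimes> y) \<otimes> (x \<otimes> y) = (x \<otimes> x) \<otimes> (y \<otimes> y)" using xy T by (simp add: m_ac)
        then show ?thesis using xy T by simp
      qed
    qed
    then have "group (G\<lparr>carrier := T\<rparr>)" by (rule subgroup_imp_group)
    then have "group (integer_group \<times>\<times> G\<lparr>carrier := T\<rparr>)" by (simp add: DirProd_group)
    then have iso': "G \<cong> integer_group \<times>\<times> G\<lparr>carrier := T\<rparr>"
      using iso by (rule group.iso_sym)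
    have "integer_group \<times>\<times> G\<lparr>carrier := T\<rparr> \<cong> integer_group \<times>\<times> ?V"
      by (rule group.DirProd_iso_trans[OF group_integer_group iso_refl V'])
    then have 1: "G \<cong> integer_group \<times>\<times> ?V" by (rule iso_trans[OF iso'])
    have "integer_group \<times>\<times> G\<lparr>carrier := T\<rparr> \<cong> free_group_Z 1 \<times>\<times> G\<lparr>carrier := T\<rparr>"
      by (rule group.DirProd_iso_trans[OF group_integer_group free_group_Z_1 iso_refl])
    then have "G \<cong> free_group_Z 1 \<times>\<times> torsion_subgroup G"
      unfolding tors by (rule iso_trans[OF iso'])
    then have "abelian_rank G = 1" by (rule rank)
    then show ?thesis using 1 by simp
  qed
qed

end

section \<open>Arithmetic of rational squares\<close>

text \<open>Gauss's lemma with q = 8k + 3: among the numbers 2, 4, ..., 8k + 2, those beyond (q - 1)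
  / 2 = 4k + 1 are the doubles of 2k + 1, ..., 4k + 1. Their number 2k + 1 is odd.\<close>

lemma two_nonresidue:
  assumes "prime q" "q mod 8 = 3"
  shows "\<not> QuadRes (int q) 2"
proof -
  define k where "k = q div 8"
  have q: "q = 8 * k + 3" using assms(2) by (simp add: k_def) presburger
  have ndvd: "\<not> int q dvd 2"
  proof
    assume "int q dvd 2"
    then have "int q \<le> 2" by (rule zdvd_imp_le) simp
    then show False using q by simp
  qed
  interpret GAUSS q 2
    using assms ndvd q by unfold_locales (auto simp: cong_0_iff)
  have half: "(int q - 1) div 2 = 4 * int k + 1" by (simp add: q)
  have "C = (\<lambda>y. y * 2 mod int q) ` {0 <.. 4 * int k + 1}"
    unfolding C_def B_def A_def half by (simp add: image_image)
  \<comment> \<open>The largest double, 8k + 2, is below q, so no reduction takes place.\<close>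
  also have "\<dots> = (\<lambda>y. 2 * y) ` {0 <.. 4 * int k + 1}"
    using q by (intro image_cong) auto
  finally have "E = (\<lambda>y. 2 * y) ` {2 * int k + 1 .. 4 * int k + 1}"
    unfolding E_def half by auto
  then have "card E = 2 * k + 1"
    by (simp add: card_image inj_on_def)
  then have "Legendre 2 (int q) = - 1" using gauss_lemma by simp
  then show ?thesis by (auto simp: Legendre_def split: if_splits)
qed

text \<open>If \<open>e\<close> were invertible modulo \<open>q\<close>, then \<open>a\<close>
  divided by \<open>e\<close> would be a square root of 2.\<close>

lemma square_eq_two_square_mod_prime:
  fixes a e :: int
  assumes "prime q" "q mod 8 = 3" "int q dvd a ^ 2 - 2 * e ^ 2"
  shows "int q dvd e"
proof (rule ccontr)
  assume "\<not> int q dvd e"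
  then have "coprime e (int q)"
    using assms(1) by (metis coprime_commute prime_imp_coprime prime_nat_int_transfer)
  then obtain f where f: "[e * f = 1] (mod int q)"
    using cong_solve_coprime_int by blast
  have "[a ^ 2 = 2 * e ^ 2] (mod int q)"
    using assms(3) by (simp add: cong_iff_dvd_diff)
  then have "[(a * f) ^ 2 = 2 * (e * f) ^ 2] (mod int q)"
    using cong_scalar_right[of "a ^ 2" "2 * e ^ 2" "int q" "f ^ 2"] by (simp add: power_mult_distrib mult.assoc)
  also have "[2 * (e * f) ^ 2 = 2 * 1 ^ 2] (mod int q)"
    using f by (intro cong_mult cong_pow) auto
  finally show False using two_nonresidue[OF assms(1,2)] by (auto simp: QuadRes_def)
qed

lemma quotient_of_eqI:
  assumes "x = of_int a / of_int b" "coprime a b" "b > 0"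
  shows "quotient_of x = (a, b)"
  using assms by (metis Fract_of_int_quotient normalize_stable quotient_of_Fract)

lemma of_int_square_rat:
  fixes r :: rat
  assumes "r ^ 2 = of_int n"
  obtains b where "r = of_int b" "b ^ 2 = n"
proof -
  obtain a b where ab: "quotient_of r = (a, b)" by fastforce
  have b: "b > 0" "coprime a b" "r = of_int a / of_int b"
    using ab quotient_of_denom_pos quotient_of_coprime quotient_of_div by blast+
  have "r ^ 2 * of_int b ^ 2 = of_int a ^ 2" using b by (simp add: power_divide)
  then have "of_int (n * b ^ 2) = (of_int (a ^ 2) :: rat)" using assms by simp
  then have "n * b ^ 2 = a ^ 2" by (simp only: of_int_eq_iff)
  then have "b ^ 2 dvd a ^ 2" by (metis dvd_triv_right)
  moreover have "coprime (a ^ 2) (b ^ 2)" using b by simp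
  ultimately have "b ^ 2 = 1" using b(1)
    by (metis coprime_absorb_right coprime_commute is_unit_power_iff zdvd1_eq abs_of_pos zero_less_power pos2)
  then have "b = 1" using b(1) by (simp add: power2_eq_1_iff)
  then show ?thesis using b that[of a] assms by (metis div_by_1 of_int_1 of_int_eq_iff of_int_power)
qed

lemma coprime_square_factor_int:
  fixes a b c :: int
  assumes "coprime a b" "a * b = c ^ 2" "a \<noteq> 0" "b \<noteq> 0"
  obtains u v where "\<bar>a\<bar> = u ^ 2" "\<bar>b\<bar> = v ^ 2"
proof -
  have "nat \<bar>a\<bar> * nat \<bar>b\<bar> = (nat \<bar>c\<bar>) ^ 2"
    using assms(2) by (metis abs_mult abs_power2 nat_abs_mult_distrib nat_power_eq power2_abs abs_ge_zero)
  moreover have "coprime (nat \<bar>a\<bar>) (nat \<bar>b\<bar>)" using assms(1) by simp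
  ultimately have "is_nth_power 2 (nat \<bar>a\<bar>)" "is_nth_power 2 (nat \<bar>b\<bar>)"
    using is_nth_power_mult_coprime_natD[of "nat \<bar>a\<bar>" "nat \<bar>b\<bar>" 2] assms(3,4) by auto
  then obtain u v where "nat \<bar>a\<bar> = u ^ 2" "nat \<bar>b\<bar> = v ^ 2" by (auto elim!: is_nth_powerE)
  then have "\<bar>a\<bar> = int u ^ 2" "\<bar>b\<bar> = int v ^ 2"
    by (metis abs_ge_zero nat_0_le of_nat_power)+
  then show ?thesis using that by blast
qed

text \<open>Write x = (a / e)^2. If e is odd, then a^2 - 2 e^2 = b^2 for an integer b; but 2 e^2 is
  2 modulo 4, which is never a difference of two squares.\<close>

lemma even_denominator:
  fixes x \<alpha> \<beta> :: rat
  assumes "x = \<alpha> ^ 2" "x - 2 = \<beta> ^ 2"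
  shows "even (snd (quotient_of x))"
proof (rule ccontr)
  assume odd: "odd (snd (quotient_of x))"
  obtain a e where "quotient_of \<alpha> = (a, e)" by fastforce
  then have ae: "e > 0" "coprime a e" "\<alpha> = of_int a / of_int e"
    using quotient_of_denom_pos quotient_of_coprime quotient_of_div by blast+
  have "quotient_of x = (a ^ 2, e ^ 2)"
    using ae assms(1) by (intro quotient_of_eqI) (auto simp: power_divide)
  then have e: "odd e" using odd by simp
  have "x * of_int e ^ 2 = of_int a ^ 2"
    using assms(1) ae by (simp add: power_divide)
  then have "(\<beta> * of_int e) ^ 2 = of_int (a ^ 2 - 2 * e ^ 2)"
    by (simp add: power_mult_distrib assms(2)[symmetric] left_diff_distrib)
  then obtain b where b: "b ^ 2 = a ^ 2 - 2 * e ^ 2" by (rule of_int_square_rat)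
  obtain e' where e': "e = 2 * e' + 1" using e by (rule oddE)
  show False
  proof (cases "even a")
    case True
    then have "even (b ^ 2)" using b by simp
    then have "even b" by simp
    then obtain a' b' where "a = 2 * a'" "b = 2 * b'" using True by (auto elim!: evenE)
    then have "2 * (2 * b' ^ 2) = 2 * (2 * a' ^ 2 - (2 * (2 * e' ^ 2 + 2 * e') + 1))"
      using b e' by (simp add: power2_eq_square algebra_simps)
    then show False by presburger
  next
    case False
    then have "odd (b ^ 2)" using b by simp
    then have "odd b" by simp
    then obtain a' b' where "a = 2 * a' + 1" "b = 2 * b' + 1" using False by (auto elim!: oddE)
    then have "4 * (b' ^ 2 + b') = 4 * (a' ^ 2 + a') - 2 * (4 * (e' ^ 2 + e') + 1)"
      using b e' by (simp add: power2_eq_square algebra_simps)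
    then show False by presburger
  qed
qed

lemma power_two_dvd_denominator:
  assumes x': "x' = of_int A / of_int B" and "odd A" "B \<noteq> 0" "2 ^ k dvd B"
  shows "2 ^ k dvd snd (quotient_of x')"
proof -
  obtain c d where cd: "quotient_of x' = (c, d)" by fastforce
  have d: "d > 0" "x' = of_int c / of_int d"
    using cd quotient_of_denom_pos quotient_of_div by blast+
  have "(of_int c :: rat) / of_int d = of_int A / of_int B" using x' d by simp
  then have "of_int (c * B) = (of_int (A * d) :: rat)"
    using d(1) assms(3) by (simp add: frac_eq_eq)
  then have "c * B = A * d" by (simp only: of_int_eq_iff)
  then have "2 ^ k dvd A * d" using assms(4) by (metis dvd_mult)
  moreover have "coprime (2 ^ k) A" using assms(2) by simp
  ultimately show ?thesis using cd by (simp add: coprime_dvd_mult_right_iff)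
qed

section \<open>Halving and doubling points\<close>

text \<open>Converse of \<open>double_point\<close>: the three square roots determine a half point,
  with x-coordinate equal to x plus the sum of their pairwise products. The factorised form
  \<open>u\<close> shows at once that \<open>u - 2\<close> and \<open>u - P\<close> factor in the
  same way.\<close>

lemma halving:
  fixes \<alpha> \<beta> \<gamma> :: rat
  assumes p: "p > 2" and xy: "Affine x y \<in> curve_points (E_cubic p)"
    and x: "x = \<alpha> ^ 2" "x - 2 = \<beta> ^ 2" "x - of_nat p = \<gamma> ^ 2"
  shows "\<exists>Q\<in>curve_points (E_cubic p). curve_add (E_cubic p) Q Q = Affine x y"
proof -
  define P :: rat where "P = of_nat p"
  have P: "P > 2" using p by (simp add: P_def)
  have y: "y ^ 2 = \<alpha> ^ 2 * \<gamma> ^ 2 * \<beta> ^ 2"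
    using xy x by (simp add: Affine_in_curve_points)
  then have "y ^ 2 = (\<alpha> * \<beta> * \<gamma>) ^ 2" by (simp add: power_mult_distrib)
  then have "y = \<alpha> * \<beta> * \<gamma> \<or> y = \<alpha> * \<beta> * (- \<gamma>)" by (simp add: power2_eq_iff)
  \<comment> \<open>The sign of \<open>\<gamma>\<close> is adjusted so that the product of the three
    roots is \<open>y\<close> and not \<open>- y\<close>.\<close>
  then obtain c where c: "c ^ 2 = \<gamma> ^ 2" "y = \<alpha> * \<beta> * c" by (metis power2_minus)
  have e: "\<beta> ^ 2 = \<alpha> ^ 2 - 2" "c ^ 2 = \<alpha> ^ 2 - P"
    using x(2,3) unfolding x(1) c(1) P_def by linarith+
  \<comment> \<open>The tangent at the half point has slope \<open>\<alpha> + \<beta> + c\<close>.\<close>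
  define u where "u = (\<alpha> + \<beta>) * (\<alpha> + c)"
  define v where "v = (\<alpha> + \<beta>) * (\<alpha> + c) * (\<beta> + c)"
  have "(\<alpha> + \<beta>) * (\<alpha> - \<beta>) = \<alpha> ^ 2 - \<beta> ^ 2" "(\<alpha> + c) * (\<alpha> - c) = \<alpha> ^ 2 - c ^ 2"
    "(\<beta> + c) * (\<beta> - c) = \<beta> ^ 2 - c ^ 2"
    by (simp_all add: algebra_simps power2_eq_square)
  then have "(\<alpha> + \<beta>) * (\<alpha> - \<beta>) = 2" "(\<alpha> + c) * (\<alpha> - c) = P" "(\<beta> + c) * (\<beta> - c) = P - 2"
    unfolding e by simp_all
  \<comment> \<open>Each of these sums times its conjugate is a difference of two roots of the
    cubic: 2, p or p - 2.\<close>
  then have nz: "\<alpha> + \<beta> \<noteq> 0" "\<alpha> + c \<noteq> 0" "\<beta> + c \<noteq> 0" using P by auto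
  then have v0: "v \<noteq> 0" by (simp add: v_def)
  have "u - (\<alpha> ^ 2 - \<beta> ^ 2) = (\<alpha> + \<beta>) * (\<beta> + c)" "u - (\<alpha> ^ 2 - c ^ 2) = (\<alpha> + c) * (\<beta> + c)"
    unfolding u_def by (simp_all add: algebra_simps power2_eq_square)
  then have u2: "u - 2 = (\<alpha> + \<beta>) * (\<beta> + c)" and uP: "u - P = (\<alpha> + c) * (\<beta> + c)"
    unfolding e by simp_all
  have "v ^ 2 = u * (u - P) * (u - 2)"
    unfolding u2 uP unfolding u_def v_def by (simp add: power2_eq_square)
  then have Q: "Affine u v \<in> curve_points (E_cubic p)"
    by (simp add: Affine_in_curve_points P_def)
  have "3 * u ^ 2 - 2 * (P + 2) * u + 2 * P = u * (u - P) + u * (u - 2) + (u - P) * (u - 2)"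
    by Groebner_Basis.algebra
  also have "\<dots> = (\<alpha> + \<beta> + c) * (2 * v)"
    unfolding u2 uP unfolding u_def v_def by Groebner_Basis.algebra
  finally have l: "(3 * u ^ 2 - 2 * (P + 2) * u + 2 * P) / (2 * v) = \<alpha> + \<beta> + c"
    using v0 by simp
  have "(\<alpha> + \<beta> + c) ^ 2 - (u - P) - (u - 2) = x"
    unfolding u2 uP x(1) by Groebner_Basis.algebra
  then have x3: "(\<alpha> + \<beta> + c) ^ 2 + P + 2 - u - u = x" by simp
  have y3: "(\<alpha> + \<beta> + c) * (u - x) - v = y"
    unfolding c(2) x(1) u_def v_def by Groebner_Basis.algebra
  have ne: "(v = - v) = False" using v0 by simp
  have "curve_add (E_cubic p) (Affine u v) (Affine u v) = Affine x y"
    unfolding curve_add_E_cubic P_def[symmetric] Let_def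
    by (simp only: l x3 y3 simp_thms if_True if_False ne)
  then show ?thesis using Q by blast
qed

text \<open>The duplication formula together with the three square roots that it exhibits: a double
  has x, x - 2 and x - p squares. Over the denominator 4 y^2 everything is a polynomial identity
  modulo the curve equation.\<close>

lemma double_point:
  assumes xy: "Affine x y \<in> curve_points (E_cubic p)" and y0: "y \<noteq> 0"
  shows "\<exists>y'. curve_add (E_cubic p) (Affine x y) (Affine x y) =
      Affine ((x ^ 2 - 2 * of_nat p) ^ 2 / (4 * y ^ 2)) y'"
    "(x ^ 2 - 2 * of_nat p) ^ 2 / (4 * y ^ 2) = ((x ^ 2 - 2 * of_nat p) / (2 * y)) ^ 2"
    "(x ^ 2 - 2 * of_nat p) ^ 2 / (4 * y ^ 2) - 2 = ((x ^ 2 - 4 * x + 2 * of_nat p) / (2 * y)) ^ 2"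
    "(x ^ 2 - 2 * of_nat p) ^ 2 / (4 * y ^ 2) - of_nat p =
      ((x ^ 2 - 2 * of_nat p * x + 2 * of_nat p) / (2 * y)) ^ 2"
proof -
  define P :: rat where "P = of_nat p"
  have y: "y ^ 2 = x * (x - P) * (x - 2)"
    using xy by (simp add: Affine_in_curve_points P_def)
  have sq: "(N / (2 * y)) ^ 2 = N ^ 2 / (4 * y ^ 2)" for N
    by (simp add: power_divide power_mult_distrib)
  have sub: "N / (4 * y ^ 2) + k = (N + k * (4 * y ^ 2)) / (4 * y ^ 2)" for N k
    using y0 by (simp add: add_divide_distrib)
  define l where "l = (3 * x ^ 2 - 2 * (P + 2) * x + 2 * P) / (2 * y)"
  have "l ^ 2 + (P + 2 - 2 * x) = (x ^ 2 - 2 * P) ^ 2 / (4 * y ^ 2)"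
    unfolding l_def sq sub
    by (rule arg_cong[of _ _ "\<lambda>N. N / (4 * y ^ 2)"]) (unfold y, Groebner_Basis.algebra)
  then have "l ^ 2 + P + 2 - x - x = (x ^ 2 - 2 * P) ^ 2 / (4 * y ^ 2)" by simp
  then show "\<exists>y'. curve_add (E_cubic p) (Affine x y) (Affine x y) =
      Affine ((x ^ 2 - 2 * of_nat p) ^ 2 / (4 * y ^ 2)) y'"
    using y0 unfolding curve_add_E_cubic P_def[symmetric] Let_def l_def by simp
  show "(x ^ 2 - 2 * of_nat p) ^ 2 / (4 * y ^ 2) = ((x ^ 2 - 2 * of_nat p) / (2 * y)) ^ 2"
    by (simp add: sq)
  have "(x ^ 2 - 2 * P) ^ 2 / (4 * y ^ 2) + (- 2) = ((x ^ 2 - 4 * x + 2 * P) / (2 * y)) ^ 2"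
    unfolding sq sub
    by (rule arg_cong[of _ _ "\<lambda>N. N / (4 * y ^ 2)"]) (unfold y, Groebner_Basis.algebra)
  then show "(x ^ 2 - 2 * of_nat p) ^ 2 / (4 * y ^ 2) - 2 = ((x ^ 2 - 4 * x + 2 * of_nat p) / (2 * y)) ^ 2"
    by (simp add: P_def)
  have "(x ^ 2 - 2 * P) ^ 2 / (4 * y ^ 2) + (- P) = ((x ^ 2 - 2 * P * x + 2 * P) / (2 * y)) ^ 2"
    unfolding sq sub
    by (rule arg_cong[of _ _ "\<lambda>N. N / (4 * y ^ 2)"]) (unfold y, Groebner_Basis.algebra)
  then show "(x ^ 2 - 2 * of_nat p) ^ 2 / (4 * y ^ 2) - of_nat p =
      ((x ^ 2 - 2 * of_nat p * x + 2 * of_nat p) / (2 * y)) ^ 2"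
    by (simp add: P_def)
qed

text \<open>Let x = m / n in lowest terms, with n even and so m odd. The double has the odd
  numerator (m^2 - 2 p n^2)^2 over 4 m n (m - p n) (m - 2 n), so cancellation leaves the powers of 2
  in 4 n intact.\<close>

lemma double_denominator:
  assumes xy: "Affine x y \<in> curve_points (E_cubic p)"
    and ev: "2 ^ k dvd snd (quotient_of x)" "k > 0"
  shows "y \<noteq> 0 \<and> 2 ^ Suc k dvd snd (quotient_of ((x ^ 2 - 2 * of_nat p) ^ 2 / (4 * y ^ 2)))"
proof -
  obtain m n where mn: "quotient_of x = (m, n)" by fastforce
  then have n: "n > 0" "coprime m n" "x = of_int m / of_int n"
    using quotient_of_denom_pos quotient_of_coprime quotient_of_div by blast+
  have "2 ^ k dvd n" using ev mn by simp
  then have en: "even n" using ev(2) by (metis dvd_power dvd_trans)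
  then have om: "odd m" using n(2) by (metis coprime_common_divisor odd_one)
  have y: "y ^ 2 = x * (x - of_nat p) * (x - 2)"
    using xy by (simp add: Affine_in_curve_points)
  define B where "B = 4 * (m * n * (m - int p * n) * (m - 2 * n))"
  define A where "A = (m ^ 2 - 2 * int p * n ^ 2) ^ 2"
  have B0: "B \<noteq> 0" using om n(1) en unfolding B_def by (auto simp: mult.assoc)
  have xn: "x * of_int n = of_int m" using n by simp
  have yB: "4 * y ^ 2 * of_int n ^ 4 = of_int B"
    unfolding y B_def of_int_mult of_int_diff xn[symmetric] by (simp add: power4_eq_xxxx algebra_simps)
  then have y0: "y \<noteq> 0" using B0 by auto
  have "(x ^ 2 - 2 * of_nat p) ^ 2 * of_int n ^ 4 = of_int A"
    unfolding A_def of_int_mult of_int_diff of_int_power xn[symmetric]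
    by (simp add: power4_eq_xxxx power2_eq_square algebra_simps)
  then have "(x ^ 2 - 2 * of_nat p) ^ 2 / (4 * y ^ 2) = of_int A / of_int B"
    using yB n(1) by (metis mult_divide_mult_cancel_right of_int_0_eq_iff order_less_irrefl power_not_zero)
  moreover have "odd A" using om by (simp add: A_def)
  moreover have "2 ^ Suc k dvd B"
  proof -
    have "2 * 2 ^ k dvd 4 * (n * (m * (m - int p * n) * (m - 2 * n)))"
      using \<open>2 ^ k dvd n\<close> by (intro mult_dvd_mono) (auto intro: dvd_mult2)
    then show ?thesis by (simp add: B_def mult.assoc mult.left_commute)
  qed
  ultimately show ?thesis using power_two_dvd_denominator B0 y0 by blast
qed

section \<open>Heights\<close>

text \<open>The multiplicative Weil height, kept integral so that growth estimates avoid
  logarithms.\<close>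

definition rat_height :: "rat \<Rightarrow> int" where
  "rat_height x = max \<bar>fst (quotient_of x)\<bar> (snd (quotient_of x))"

lemma rat_height_pos: "rat_height x \<ge> 1"
  using quotient_of_denom_pos'[of x] unfolding rat_height_def by linarith

lemma rat_height_fraction:
  assumes x: "x = of_int A / of_int B" and B: "B \<noteq> 0"
  obtains d where "d \<noteq> 0" "A = fst (quotient_of x) * d" "B = snd (quotient_of x) * d"
proof -
  obtain m n where mn: "quotient_of x = (m, n)" by fastforce
  then have n: "n > 0" "coprime m n" "x = of_int m / of_int n"
    using quotient_of_denom_pos quotient_of_coprime quotient_of_div by blast+
  have "(of_int m :: rat) / of_int n = of_int A / of_int B" using x n by simp
  then have "of_int (m * B) = (of_int (A * n) :: rat)"
    using n(1) B by (simp add: frac_eq_eq)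
  then have eq: "m * B = A * n" by (simp only: of_int_eq_iff)
  then have "n dvd m * B" by simp
  then have "n dvd B" using n(2) by (simp add: coprime_commute coprime_dvd_mult_right_iff)
  then obtain d where d: "B = n * d" by blast
  have "A = m * d" using eq d n(1) by simp
  then show ?thesis using that[of d] d B mn by auto
qed

lemma rat_height_le:
  assumes "x = of_int A / of_int B" "B \<noteq> 0" "\<bar>A\<bar> \<le> K" "\<bar>B\<bar> \<le> K"
  shows "rat_height x \<le> K"
proof -
  obtain d where d: "d \<noteq> 0" "A = fst (quotient_of x) * d" "B = snd (quotient_of x) * d"
    using rat_height_fraction assms(1,2) .
  have "\<bar>k\<bar> \<le> \<bar>k * d\<bar>" for k
    using d(1) mult_left_mono[of 1 "\<bar>d\<bar>" "\<bar>k\<bar>"] by (simp add: abs_mult)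
  then show ?thesis
    using assms(3,4) d abs_ge_self[of "snd (quotient_of x)"] unfolding rat_height_def
    by (metis abs_le_D1 max.bounded_iff order_trans)
qed

text \<open>Passing to lowest terms divides both \<open>A\<close> and \<open>B\<close> by a common
  divisor, so a bound \<open>C\<close> on common divisors bounds the loss.\<close>

lemma rat_height_ge:
  assumes "x = of_int A / of_int B" "B \<noteq> 0"
    and C: "\<And>d. d dvd A \<Longrightarrow> d dvd B \<Longrightarrow> \<bar>d\<bar> \<le> C"
  shows "max \<bar>A\<bar> \<bar>B\<bar> \<le> C * rat_height x"
proof -
  obtain d where d: "d \<noteq> 0" "A = fst (quotient_of x) * d" "B = snd (quotient_of x) * d"
    using rat_height_fraction assms(1,2) .
  have dC: "\<bar>d\<bar> \<le> C" using C d by simp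
  have "\<bar>fst (quotient_of x)\<bar> \<le> rat_height x" "\<bar>snd (quotient_of x)\<bar> \<le> rat_height x"
    using quotient_of_denom_pos'[of x] by (auto simp: rat_height_def)
  then have "\<bar>fst (quotient_of x)\<bar> * \<bar>d\<bar> \<le> rat_height x * C" "\<bar>snd (quotient_of x)\<bar> * \<bar>d\<bar> \<le> rat_height x * C"
    using dC rat_height_pos[of x] by (auto intro!: mult_mono)
  then show ?thesis by (simp add: d(2,3) abs_mult mult.commute)
qed

fun height :: "rat curve_point \<Rightarrow> int" where
  "height Infinity = 1"
| "height (Affine x y) = rat_height x"

lemma height_pos: "height A \<ge> 1"
  by (cases A) (simp_all add: rat_height_pos)

section \<open>Torsion and 2-descent\<close>

locale twin_prime_curve =
  fixes p :: nat
  assumes prime_p: "prime p" and prime_q: "prime (p - 2)" and p_cong: "[p = 5] (mod 8)"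
begin

lemma p_gt2: "p > 2"
  using prime_q prime_gt_1_nat[OF prime_q] by simp

lemma p_gt2_rat: "(of_nat p :: rat) > 2"
  using p_gt2 by simp

lemma q_mod8: "(p - 2) mod 8 = 3"
proof -
  have "p mod 8 = 5" using p_cong by (simp add: cong_def)
  then have "p - 2 = 8 * (p div 8) + 3"
    using mult_div_mod_eq[of 8 p] by linarith
  then show ?thesis by simp
qed

sublocale comm_group "E_group p"
  using comm_group_E p_gt2 .

abbreviation add_E (infixl "\<oplus>\<^sub>E" 65) where "A \<oplus>\<^sub>E B \<equiv> A \<otimes>\<^bsub>E_group p\<^esub> B"

lemma E_simps: "carrier (E_group p) = curve_points (E_cubic p)"
    "monoid.mult (E_group p) = curve_add (E_cubic p)" "\<one>\<^bsub>E_group p\<^esub> = Infinity"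
  by (simp_all add: curve_group_def)

lemma Affine_carrier:
  "Affine x y \<in> carrier (E_group p) \<longleftrightarrow> y ^ 2 = x * (x - of_nat p) * (x - 2)"
  by (rule Affine_in_E_group)

section \<open>The 2-torsion points and the subgroup 2E\<close>

definition T :: "rat curve_point set" where "T = {Infinity, Affine 0 0, Affine 2 0, Affine (of_nat p) 0}"

lemma self_inverse_iff:
  assumes "A \<in> carrier (E_group p)"
  shows "A \<oplus>\<^sub>E A = Infinity \<longleftrightarrow> A \<in> T"
proof (cases A)
  case (Affine x y)
  have "A \<oplus>\<^sub>E A = Infinity \<longleftrightarrow> y = 0"
    unfolding Affine E_simps curve_add_E_cubic Let_def by simp
  also have "\<dots> \<longleftrightarrow> A \<in> T"
    using assms by (auto simp: Affine Affine_carrier T_def)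
  finally show ?thesis .
qed (simp add: E_simps T_def)

lemma T_carrier: "T \<subseteq> carrier (E_group p)"
  by (auto simp: T_def Affine_carrier) (simp add: E_simps curve_points_def)

lemma T_self_inverse: "A \<in> T \<Longrightarrow> A \<oplus>\<^sub>E A = Infinity"
  using self_inverse_iff T_carrier by blast

definition doubles where "doubles = (\<lambda>A. A \<oplus>\<^sub>E A) ` carrier (E_group p)"

lemma doubles_carrier: "doubles \<subseteq> carrier (E_group p)"
  by (auto simp: doubles_def)

lemma subgroup_doubles: "subgroup doubles (E_group p)"
proof (rule subgroupI)
  show "doubles \<noteq> {}" by (auto simp: doubles_def)
  show "inv\<^bsub>E_group p\<^esub> A \<in> doubles" if "A \<in> doubles" for A
    using that by (auto simp: doubles_def inv_mult)
  show "A \<oplus>\<^sub>E B \<in> doubles" if AB: "A \<in> doubles" "B \<in> doubles" for A B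
  proof -
    obtain a where "A = a \<oplus>\<^sub>E a" "a \<in> carrier (E_group p)"
      using AB(1) unfolding doubles_def by (rule imageE)
    moreover obtain b where "B = b \<oplus>\<^sub>E b" "b \<in> carrier (E_group p)"
      using AB(2) unfolding doubles_def by (rule imageE)
    ultimately have "A \<oplus>\<^sub>E B = (a \<oplus>\<^sub>E b) \<oplus>\<^sub>E (a \<oplus>\<^sub>E b)" "a \<oplus>\<^sub>E b \<in> carrier (E_group p)"
      by (simp_all add: m_ac)
    then show ?thesis unfolding doubles_def by (rule image_eqI)
  qed
qed (rule doubles_carrier)

section \<open>2-adic growth and torsion-freeness of 2E\<close>

lemma doubles_denominator:
  assumes "Affine x y \<in> doubles"
  shows "even (snd (quotient_of x))"
proof -
  obtain A where A: "A \<in> carrier (E_group p)" "Affine x y = A \<oplus>\<^sub>E A"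
    using assms by (auto simp: doubles_def)
  then obtain u v where uv: "A = Affine u v" by (cases A) (auto simp: E_simps)
  have "v \<noteq> 0"
    using A uv by (auto simp: E_simps curve_add_E_cubic)
  note d = double_point[OF A(1)[unfolded uv E_simps] this]
  have "x = (u ^ 2 - 2 * of_nat p) ^ 2 / (4 * v ^ 2)"
    using d(1) A uv by (auto simp: E_simps)
  then show ?thesis using even_denominator d(2,3) by metis
qed

text \<open>The comparison with every earlier index, not just the preceding one, makes A, 2A, 4A,
  ... pairwise distinct without further argument.\<close>

lemma doubles_power2:
  assumes "A \<in> doubles" "A \<noteq> Infinity"
  shows "\<exists>x y. A [^]\<^bsub>E_group p\<^esub> (2 ^ k :: nat) = Affine x y \<and> Affine x y \<in> doubles \<and>
    2 ^ Suc k dvd snd (quotient_of x) \<and>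
    (\<forall>j<k. \<forall>u v. A [^]\<^bsub>E_group p\<^esub> (2 ^ j :: nat) = Affine u v \<longrightarrow>
      multiplicity 2 (snd (quotient_of u)) < multiplicity 2 (snd (quotient_of x)))"
proof (induction k)
  case 0
  have "A \<in> carrier (E_group p)" using assms doubles_carrier by blast
  then show ?case using assms doubles_denominator by (cases A) (auto simp: nat_pow_eone)
next
  case (Suc k)
  then obtain x y where xy: "A [^]\<^bsub>E_group p\<^esub> (2 ^ k :: nat) = Affine x y" "Affine x y \<in> doubles"
    "2 ^ Suc k dvd snd (quotient_of x)"
    and lt: "\<And>j u v. j < k \<Longrightarrow> A [^]\<^bsub>E_group p\<^esub> (2 ^ j :: nat) = Affine u v \<Longrightarrow>
      multiplicity 2 (snd (quotient_of u)) < multiplicity 2 (snd (quotient_of x))"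
    by blast
  have car: "A \<in> carrier (E_group p)" "Affine x y \<in> curve_points (E_cubic p)"
    using assms xy doubles_carrier by (auto simp: E_simps)
  define x' where "x' = (x ^ 2 - 2 * of_nat p) ^ 2 / (4 * y ^ 2)"
  have d: "y \<noteq> 0" "2 ^ k' dvd snd (quotient_of x) \<Longrightarrow> k' > 0 \<Longrightarrow> 2 ^ Suc k' dvd snd (quotient_of x')" for k'
    using double_denominator[OF car(2)] xy(3) unfolding x'_def by blast+
  obtain y' where y': "Affine x y \<oplus>\<^sub>E Affine x y = Affine x' y'"
    using double_point(1)[OF car(2) d(1)] by (auto simp: E_simps x'_def)
  have "A [^]\<^bsub>E_group p\<^esub> (2 ^ Suc k :: nat) =
      A [^]\<^bsub>E_group p\<^esub> (2 ^ k :: nat) \<oplus>\<^sub>E A [^]\<^bsub>E_group p\<^esub> (2 ^ k :: nat)"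
    using car by (simp add: nat_pow_mult mult_2)
  then have eq: "A [^]\<^bsub>E_group p\<^esub> (2 ^ Suc k :: nat) = Affine x' y'"
    using xy y' by simp
  have mem: "Affine x' y' \<in> doubles"
    using y' car by (auto simp: doubles_def E_simps intro!: image_eqI[of _ _ "Affine x y"])
  have den0: "snd (quotient_of x') \<noteq> 0" for x' :: rat
    using quotient_of_denom_pos'[of x'] by linarith
  \<comment> \<open>The gain is measured from the exact valuation \<open>M\<close>, as divisibility
    by \<open>2 ^ Suc k\<close> is only a lower bound.\<close>
  define M where "M = multiplicity 2 (snd (quotient_of x))"
  have "M \<ge> Suc k" unfolding M_def using xy(3) den0 by (intro multiplicity_geI) auto
  moreover have "2 ^ M dvd snd (quotient_of x)" by (simp add: M_def multiplicity_dvd)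
  ultimately have "2 ^ Suc M dvd snd (quotient_of x')" using d(2) by simp
  then have "Suc M \<le> multiplicity 2 (snd (quotient_of x'))"
    using den0 by (intro multiplicity_geI) auto
  then have "M < multiplicity 2 (snd (quotient_of x'))" by simp
  then have "multiplicity 2 (snd (quotient_of u)) < multiplicity 2 (snd (quotient_of x'))"
    if "j < Suc k" "A [^]\<^bsub>E_group p\<^esub> (2 ^ j :: nat) = Affine u v" for j u v
    using that lt[of j u v] xy(1) unfolding M_def by (cases "j = k") auto
  moreover have "2 ^ Suc (Suc k) dvd snd (quotient_of x')" using d(2)[OF xy(3)] by simp
  ultimately show ?case using eq mem by blast
qed

lemma torsion_free_doubles:
  assumes A: "A \<in> doubles" and n: "n > 0" "A [^]\<^bsub>E_group p\<^esub> (n::nat) = Infinity"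
  shows "A = Infinity"
proof (rule ccontr)
  assume A0: "A \<noteq> Infinity"
  have car: "A \<in> carrier (E_group p)" using A doubles_carrier by blast
  \<comment> \<open>If \<open>A\<close> had order dividing \<open>n\<close>, all its powers would be
    among the first \<open>n\<close>, whereas \<open>doubles_power2\<close> produces infinitely
    many.\<close>
  have "A [^]\<^bsub>E_group p\<^esub> m \<in> (\<lambda>i. A [^]\<^bsub>E_group p\<^esub> i) ` {..<n}" for m :: nat
  proof -
    have "A [^]\<^bsub>E_group p\<^esub> m = A [^]\<^bsub>E_group p\<^esub> (n * (m div n) + m mod n)" by simp
    also have "\<dots> = (A [^]\<^bsub>E_group p\<^esub> n) [^]\<^bsub>E_group p\<^esub> (m div n) \<oplus>\<^sub>E A [^]\<^bsub>E_group p\<^esub> (m mod n)"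
      using car by (simp only: nat_pow_mult nat_pow_pow)
    also have "\<dots> = A [^]\<^bsub>E_group p\<^esub> (m mod n)"
      using n(2) car nat_pow_one l_one by (simp add: E_simps(3)[symmetric] del: E_simps)
    finally show ?thesis using n(1) by (metis image_eqI lessThan_iff mod_less_divisor)
  qed
  then have "finite (range (\<lambda>k. A [^]\<^bsub>E_group p\<^esub> (2 ^ k :: nat)))"
    by (intro finite_subset[OF _ finite_imageI[OF finite_lessThan[of n]]]) blast
  then have "\<not> inj (\<lambda>k. A [^]\<^bsub>E_group p\<^esub> (2 ^ k :: nat))"
    using range_inj_infinite by blast
  then obtain j k where "j < k" "A [^]\<^bsub>E_group p\<^esub> (2 ^ j :: nat) = A [^]\<^bsub>E_group p\<^esub> (2 ^ k :: nat)"
    unfolding inj_def by (metis nat_neq_iff)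
  then show False using doubles_power2[OF A A0, of k] by (metis less_irrefl)
qed

text \<open>With x = (a / e)^2, the curve equation makes \<open>M * N\<close> a nonzero square. Once
  \<open>M\<close> and \<open>N\<close> are known to be coprime, both are squares up to sign, and
  the sign is common because the product is positive.\<close>

lemma sign_alternative:
  assumes A: "Affine x y \<in> carrier (E_group p)" "y \<noteq> 0" and x: "x = \<alpha> ^ 2"
  shows "(\<exists>\<beta> \<gamma>. x - 2 = \<beta> ^ 2 \<and> x - of_nat p = \<gamma> ^ 2) \<or>
    (\<exists>\<beta> \<gamma>. x - 2 = - (\<beta> ^ 2) \<and> x - of_nat p = - (\<gamma> ^ 2))"
proof -
  define q where "q = p - 2"
  have pq: "int p = int q + 2" using p_gt2 by (simp add: q_def)
  obtain a e where "quotient_of \<alpha> = (a, e)" by fastforce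
  then have ae: "e > 0" "coprime a e" "\<alpha> = of_int a / of_int e"
    using quotient_of_denom_pos quotient_of_coprime quotient_of_div by blast+
  define M where "M = a ^ 2 - 2 * e ^ 2"
  define N where "N = a ^ 2 - int p * e ^ 2"
  have y: "y ^ 2 = x * (x - of_nat p) * (x - 2)" using A by (simp add: Affine_carrier)
  have e0: "(of_int e :: rat) \<noteq> 0" using ae by simp
  have xe: "x * of_int e ^ 2 = of_int a ^ 2" using x ae by (simp add: power_divide)
  have M: "(x - 2) * of_int e ^ 2 = of_int M"
    unfolding M_def left_diff_distrib xe by simp
  have N: "(x - of_nat p) * of_int e ^ 2 = of_int N"
    unfolding N_def left_diff_distrib xe by simp
  have a0: "a \<noteq> 0" using A(2) y xe e0 by auto
  have "(y * of_int e ^ 3) ^ 2 = (x * of_int e ^ 2) * ((x - 2) * of_int e ^ 2) * ((x - of_nat p) * of_int e ^ 2)"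
    unfolding power_mult_distrib y by Groebner_Basis.algebra
  then have "(y * of_int e ^ 3) ^ 2 = of_int a ^ 2 * of_int (M * N)"
    unfolding xe M N by simp
  then have "(y * of_int e ^ 3 / of_int a) ^ 2 = of_int (M * N)"
    using a0 by (simp add: power_divide)
  then obtain z where z: "M * N = z ^ 2" by (metis of_int_square_rat)
  have nz: "M \<noteq> 0" "N \<noteq> 0" using M N A(2) y e0 by auto
  have no_common: "\<not> int r dvd e" if "prime r" "int r dvd a" for r
    using that ae(2) by (metis coprime_common_divisor not_prime_unit prime_nat_int_transfer)
  have cop: "coprime M N"
  proof (rule ccontr)
    assume "\<not> coprime M N"
    then have "\<not> is_unit (gcd M N)" "gcd M N \<noteq> 0"
      using nz is_unit_gcd[of M N] by (blast, simp)
    then obtain r where "r dvd gcd M N" "prime r" using prime_divisor_exists by blast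
    then have r: "prime r" "r dvd M" "r dvd N" by simp_all
    define s where "s = nat r"
    have rs: "r = int s" "prime s" using r(1) by (auto simp: s_def prime_ge_0_int)
    \<comment> \<open>These combinations eliminate a^2 and e^2 in turn, leaving multiples of q = p -
      2. As \<open>a\<close> and \<open>e\<close> are coprime, a common prime factor must be
      \<open>q\<close> itself.\<close>
    have "r dvd M - N" "r dvd int p * M - 2 * N" using r by simp_all
    moreover have "M - N = int q * e ^ 2" "int p * M - 2 * N = int q * a ^ 2"
      unfolding M_def N_def pq by Groebner_Basis.algebra+
    ultimately have "r dvd int q * e ^ 2" "r dvd int q * a ^ 2" by simp_all
    then have "r dvd int q \<or> r dvd e" "r dvd int q \<or> r dvd a"
      using r(1) by (auto simp: prime_dvd_mult_iff dest: prime_dvd_power)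
    then have "r dvd int q"
      using rs no_common by blast
    then have "s = q"
      using rs prime_q by (simp add: q_def primes_dvd_imp_eq)
    \<comment> \<open>Here p = 5 modulo 8 enters: q dividing a^2 - 2 e^2 forces q to divide e and
      then a, against coprimality.\<close>
    then have "int q dvd M" using r rs by simp
    then have qe: "int q dvd e"
      using square_eq_two_square_mod_prime[of q a e] prime_q q_mod8 by (simp add: q_def M_def)
    moreover have "a ^ 2 = M + 2 * (e * e)" by (simp add: M_def power2_eq_square)
    ultimately have "int q dvd a ^ 2"
      using \<open>int q dvd M\<close> by (metis dvd_add dvd_mult dvd_mult2)
    moreover have "prime (int q)" using prime_q by (simp add: q_def)
    ultimately have "int q dvd a" by (metis prime_dvd_power)
    then show False using qe no_common[of q] prime_q by (simp add: q_def)
  qed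
  obtain u v where uv: "\<bar>M\<bar> = u ^ 2" "\<bar>N\<bar> = v ^ 2"
    using coprime_square_factor_int[OF cop z nz] .
  have frac: "of_int k ^ 2 / of_int e ^ 2 = (of_int k / of_int e :: rat) ^ 2" for k
    by (simp add: power_divide)
  have xM: "x - 2 = of_int M / of_int e ^ 2" "x - of_nat p = of_int N / of_int e ^ 2"
    using M N e0 by (simp_all add: nonzero_eq_divide_eq)
  have "z \<noteq> 0" using z nz by auto
  then have "M * N > 0" unfolding z by simp
  then consider "M > 0" "N > 0" | "M < 0" "N < 0" by (auto simp: zero_less_mult_iff)
  then show ?thesis
  proof cases
    case 1
    then have "x - 2 = (of_int u / of_int e) ^ 2" "x - of_nat p = (of_int v / of_int e) ^ 2"
      using uv unfolding xM by (simp_all add: power_divide)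
    then show ?thesis by blast
  next
    case 2
    then have "M = - (u ^ 2)" "N = - (v ^ 2)" using uv by simp_all
    then have "x - 2 = - ((of_int u / of_int e) ^ 2)" "x - of_nat p = - ((of_int v / of_int e) ^ 2)"
      unfolding xM by (simp_all add: power_divide)
    then show ?thesis by blast
  qed
qed

text \<open>In lowest terms x = m / n, the product n * (m * R) is a square with n coprime to m * R.
  So n is a square, and the class of x is that of gcd(m, R), a divisor of 2p; positivity of x
  excludes the negative classes.\<close>

lemma x_square_class:
  assumes A: "Affine x y \<in> carrier (E_group p)" "y \<noteq> 0"
  shows "\<exists>g\<in>{1, 2, of_nat p, 2 * of_nat p}. \<exists>a. a \<noteq> 0 \<and> x = g * a ^ 2"
proof -
  define P :: rat where "P = of_nat p"
  have P: "P > 2" using p_gt2_rat by (simp add: P_def)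
  have y: "y ^ 2 = x * (x - P) * (x - 2)" using A by (simp add: Affine_carrier P_def)
  have ypos: "y ^ 2 > 0" using A(2) by simp
  have x0: "x > 0"
  proof (rule ccontr)
    assume "\<not> x > 0"
    then have "x \<le> 0" "x - P < 0" "x - 2 < 0" using P by simp_all
    then have "x * (x - P) * (x - 2) \<le> 0"
      by (intro mult_nonneg_nonpos mult_nonpos_nonpos) simp_all
    then show False using ypos y by simp
  qed
  obtain m n where mn: "quotient_of x = (m, n)" by fastforce
  then have n: "n > 0" "coprime m n" "x = of_int m / of_int n"
    using quotient_of_denom_pos quotient_of_coprime quotient_of_div by blast+
  have m0: "m > 0" using x0 n by (simp add: zero_less_divide_iff)
  have xn: "x * of_int n = of_int m" using n by simp
  define R where "R = (m - int p * n) * (m - 2 * n)"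
  have "(y * of_int n ^ 2) ^ 2 = of_int n * ((x * of_int n) * ((x * of_int n - P * of_int n) * (x * of_int n - 2 * of_int n)))"
    unfolding power_mult_distrib y by Groebner_Basis.algebra
  also have "\<dots> = of_int (n * (m * R))"
    unfolding xn R_def P_def by simp
  finally obtain w where w: "w ^ 2 = n * (m * R)" and yw: "y * of_int n ^ 2 = of_int w"
    by (rule of_int_square_rat)
  have w0: "w \<noteq> 0" using yw A(2) n(1) by auto
  then have R0: "R > 0" using w n(1) m0 by (metis mult_pos_neg not_less_iff_gr_or_eq zero_less_mult_pos zero_less_power2 mult_zero_right)
  \<comment> \<open>Modulo \<open>m\<close>, \<open>R\<close> is 2 p n^2, and n is coprime to m;
    this is why the gcd divides 2p.\<close>
  have R_eq: "R = m * (m - 2 * n - int p * n) + 2 * int p * n ^ 2"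
    unfolding R_def by (simp add: algebra_simps power2_eq_square)
  have "coprime n (m * R)"
  proof -
    have "R = m ^ 2 + n * (2 * int p * n - (2 + int p) * m)"
      unfolding R_def by (simp add: algebra_simps power2_eq_square)
    then have "gcd n R = gcd n (m ^ 2)"
      by (metis add.commute gcd_add_mult mult.commute)
    also have "\<dots> = 1" using n(2) by (simp add: coprime_commute)
    finally have "coprime n R" by (simp only: coprime_iff_gcd_eq_1)
    moreover have "coprime n m" using n(2) by (simp add: coprime_commute)
    ultimately show ?thesis by simp
  qed
  then obtain u v where uv: "\<bar>n\<bar> = u ^ 2" "\<bar>m * R\<bar> = v ^ 2"
    using coprime_square_factor_int[of n "m * R" w] w n(1) m0 R0 by fastforce
  then have nu: "n = u ^ 2" and mv: "m * R = v ^ 2" using n(1) m0 R0 by auto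
  \<comment> \<open>After division by \<open>g ^ 2\<close> the square \<open>m * R\<close> splits
    into coprime factors, so m / g is a square.\<close>
  define g where "g = gcd m R"
  obtain m' R' where m': "m = g * m'" "R = g * R'" "coprime m' R'"
    using gcd_coprime_exists[of m R] m0 unfolding g_def by (metis gcd_eq_0_iff less_irrefl mult.commute)
  have g0: "g > 0" using m0 by (simp add: g_def)
  then have pos: "m' > 0" "R' > 0" using m0 R0 m' by (metis zero_less_mult_pos)+
  have "g ^ 2 * (m' * R') = v ^ 2" using mv m' by (simp add: power2_eq_square mult_ac)
  then have "g dvd v" by (metis dvd_triv_left pow_divides_pow_iff zero_less_numeral)
  then obtain s where "v = g * s" by blast
  then have "m' * R' = s ^ 2" using \<open>g ^ 2 * (m' * R') = v ^ 2\<close> g0 by (simp add: power_mult_distrib)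
  then obtain a b where "\<bar>m'\<bar> = a ^ 2"
    using coprime_square_factor_int[OF m'(3)] pos by (metis less_irrefl)
  then have ma: "m = g * a ^ 2" using m' pos by simp
  have "g dvd 2 * int p * n ^ 2" using R_eq
    by (metis dvd_add_right_iff dvd_mult2 g_def gcd_dvd1 gcd_dvd2)
  moreover have "coprime g (n ^ 2)" using n(2) unfolding g_def
    by (metis coprime_divisors coprime_power_right_iff dvd_refl gcd_dvd1)
  ultimately have "g dvd 2 * int p" by (simp add: coprime_dvd_mult_left_iff)
  then have "nat g dvd 2 * p" using g0
    by (metis int_dvd_int_iff nat_0_le of_nat_mult of_nat_numeral order_less_imp_le)
  then obtain c d where cd: "nat g = c * d" "c dvd 2" "d dvd p" by (metis division_decomp)
  then have "c \<in> {1, 2}" "d \<in> {1, p}" using prime_p two_is_prime_nat by (auto simp: prime_nat_iff)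
  then have "nat g \<in> {1, 2, p, 2 * p}" using cd(1) by auto
  then have "of_nat (nat g) \<in> {1, 2, of_nat p, 2 * of_nat p :: rat}" by auto
  then have g: "of_int g \<in> {1, 2, of_nat p, 2 * of_nat p :: rat}" using g0 by (simp add: of_nat_nat)
  have "x = of_int g * (of_int a / of_int u) ^ 2"
    using n(3) ma nu by (simp add: power_divide)
  moreover have "of_int a / of_int u \<noteq> (0::rat)" using ma nu m0 n(1) by auto
  ultimately show ?thesis using g by blast
qed

text \<open>Adding a nonzero 2-torsion point multiplies the class of x modulo squares by 2 for (2,
  0), by p for (p, 0) and by 2p for (0, 0). The point \<open>t\<close> is the one whose class is
  that of x.\<close>

lemma translate_to_square:
  assumes A: "Affine x y \<in> carrier (E_group p)" "y \<noteq> 0"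
  shows "\<exists>t\<in>T. \<exists>x' y' a. Affine x y \<oplus>\<^sub>E t = Affine x' y' \<and> x' = a ^ 2"
proof -
  define P :: rat where "P = of_nat p"
  have y: "y ^ 2 = x * (x - P) * (x - 2)" using A by (simp add: Affine_carrier P_def)
  have x: "x \<noteq> 0" "x - 2 \<noteq> 0" "x - P \<noteq> 0" using y A(2) by auto
  have add: "\<exists>y'. Affine x y \<oplus>\<^sub>E Affine e 0 = Affine ((y / (x - e)) ^ 2 + P + 2 - x - e) y'"
    if "x - e \<noteq> 0" for e
  proof -
    have "((0 - y) / (e - x)) ^ 2 = (y / (x - e)) ^ 2" using that by (simp add: divide_simps power2_commute)
    then show ?thesis using that
      unfolding E_simps curve_add_E_cubic Let_def P_def by auto
  qed
  obtain g a where g: "g \<in> {1, 2, P, 2 * P}" and a: "a \<noteq> 0" "x = g * a ^ 2"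
    using x_square_class[OF A] P_def by blast
  have g0: "g \<noteq> 0" using a x by auto
  consider "g = 1" | "g = 2" | "g = P" | "g = 2 * P" using g by blast
  then show ?thesis
  proof cases
    case 1
    have "Affine x y \<oplus>\<^sub>E Infinity = Affine x y" by (simp add: E_simps)
    then show ?thesis using a 1 by (auto simp: T_def)
  next
    case 2
    have "(y / (x - 2)) ^ 2 = x * (x - P) / (x - 2)"
      unfolding power_divide y using x by (simp add: power2_eq_square)
    then have "(y / (x - 2)) ^ 2 + P + 2 - x - 2 = 2 * (x - P) / (x - 2)"
      using x by (simp add: field_simps)
    \<comment> \<open>Since (x - P) / (x - 2) is (y / (x - 2))^2 / x, the factor 2 cancels against x
      = 2 a^2.\<close>
    also have "\<dots> = (y / (a * (x - 2))) ^ 2"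
    proof -
      have "x / a ^ 2 = 2" using a 2 by simp
      moreover have "(x - P) * (x - 2) / (x - 2) ^ 2 = (x - P) / (x - 2)"
        using x by (simp add: power2_eq_square)
      moreover have "(y / (a * (x - 2))) ^ 2 = (x / a ^ 2) * ((x - P) * (x - 2) / (x - 2) ^ 2)"
        by (simp add: power_divide power_mult_distrib y mult_ac)
      ultimately show ?thesis by simp
    qed
    finally show ?thesis using add[of 2] x unfolding T_def by (metis insertCI)
  next
    case 3
    have "(y / (x - P)) ^ 2 = x * (x - 2) / (x - P)"
      unfolding power_divide y using x by (simp add: power2_eq_square)
    then have "(y / (x - P)) ^ 2 + P + 2 - x - P = P * (x - 2) / (x - P)"
      using x by (simp add: field_simps)
    also have "\<dots> = (y / (a * (x - P))) ^ 2"
    proof -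
      have "x / a ^ 2 = P" using a 3 by simp
      moreover have "(x - 2) * (x - P) / (x - P) ^ 2 = (x - 2) / (x - P)"
        using x by (simp add: power2_eq_square)
      moreover have "(y / (a * (x - P))) ^ 2 = (x / a ^ 2) * ((x - 2) * (x - P) / (x - P) ^ 2)"
        by (simp add: power_divide power_mult_distrib y mult_ac)
      ultimately show ?thesis by simp
    qed
    finally show ?thesis using add[of P] x unfolding T_def P_def by (metis insertCI)
  next
    case 4
    have "(y / (x - 0)) ^ 2 = (x - P) * (x - 2) / x"
      unfolding power_divide y using x by (simp add: power2_eq_square)
    then have "(y / (x - 0)) ^ 2 + P + 2 - x - 0 = 2 * P / x"
      using x by (simp add: field_simps)
    also have "\<dots> = (1 / a) ^ 2"
      using x a 4 by (simp add: field_simps power2_eq_square)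
    finally show ?thesis using add[of 0] x unfolding T_def by (metis insertCI diff_zero)
  qed
qed

lemma square_coordinates_double:
  assumes "Affine x y \<in> carrier (E_group p)" "x = \<alpha> ^ 2" "x - 2 = \<beta> ^ 2" "x - of_nat p = \<gamma> ^ 2"
  shows "Affine x y \<in> doubles"
proof -
  obtain Q where "Q \<in> curve_points (E_cubic p)" "Affine x y = curve_add (E_cubic p) Q Q"
    using halving[OF p_gt2 assms(1)[unfolded E_simps] assms(2-4)] by fastforce
  then show ?thesis unfolding doubles_def E_simps by (rule image_eqI[rotated])
qed

text \<open>For each root e of the cubic, the product of the three numbers x_i - e on a line is the
  square of the value of the line at e. The two negative signs cancel, so x3 - e is a square for e =
  0, 2, p and \<open>halving\<close> applies.\<close>

lemma negative_sum_in_doubles: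
  assumes A: "Affine x1 y1 \<in> carrier (E_group p)" "y1 \<noteq> 0"
      "x1 = \<alpha>1 ^ 2" "x1 - 2 = - (\<beta>1 ^ 2)" "x1 - of_nat p = - (\<gamma>1 ^ 2)"
    and B: "Affine x2 y2 \<in> carrier (E_group p)" "y2 \<noteq> 0"
      "x2 = \<alpha>2 ^ 2" "x2 - 2 = - (\<beta>2 ^ 2)" "x2 - of_nat p = - (\<gamma>2 ^ 2)"
  shows "Affine x1 y1 \<oplus>\<^sub>E Affine x2 y2 \<in> doubles"
proof (cases "x1 = x2 \<and> y1 = - y2")
  case True
  then have "Affine x1 y1 \<oplus>\<^sub>E Affine x2 y2 = \<one>\<^bsub>E_group p\<^esub>"
    unfolding E_simps curve_add_E_cubic by simp
  then show ?thesis using subgroup_doubles subgroup.one_closed by metis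
next
  case ne: False
  define P :: rat where "P = of_nat p"
  have 1: "y1 ^ 2 = x1 * (x1 - P) * (x1 - 2)" and 2: "y2 ^ 2 = x2 * (x2 - P) * (x2 - 2)"
    using A B by (simp_all add: Affine_carrier P_def)
  define l where "l = (if x1 = x2 then (3 * x1 ^ 2 - 2 * (P + 2) * x1 + 2 * P) / (2 * y1)
               else (y2 - y1) / (x2 - x1))"
  define x3 where "x3 = l ^ 2 + P + 2 - x1 - x2"
  define m where "m = y1 - l * x1"
  note r = line_through_points[OF 1 2 ne l_def x3_def m_def]
  have sum: "Affine x1 y1 \<oplus>\<^sub>E Affine x2 y2 = Affine x3 (l * (x1 - x3) - y1)"
    unfolding E_simps curve_add_E_cubic P_def[symmetric] l_def[symmetric] Let_def x3_def[symmetric]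
    by (simp only: ne if_False)
  have r': "l ^ 2 + P + 2 = x1 + x2 + x3" "2 * P - 2 * l * m = x1 * x2 + x1 * x3 + x2 * x3"
    using r(1,2) by simp_all
  have prod: "(x1 - e) * (x2 - e) * (x3 - e) =
      m ^ 2 - e * (2 * P - 2 * l * m) + e ^ 2 * (l ^ 2 + P + 2) - e ^ 3" for e
    unfolding r' r(3) by Groebner_Basis.algebra
  have "(x1 - 2) * (x2 - 2) * (x3 - 2) = (2 * l + m) ^ 2"
    "(x1 - P) * (x2 - P) * (x3 - P) = (P * l + m) ^ 2"
    unfolding prod by Groebner_Basis.algebra+
  then have e: "(\<beta>1 * \<beta>2) ^ 2 * (x3 - 2) = (2 * l + m) ^ 2" "(\<gamma>1 * \<gamma>2) ^ 2 * (x3 - P) = (P * l + m) ^ 2"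
    using A(4,5) B(4,5) by (simp_all add: P_def power_mult_distrib)
  have e': "(\<alpha>1 * \<alpha>2) ^ 2 * x3 = m ^ 2"
    using r(3) A(3) B(3) by (simp add: power_mult_distrib)
  have "\<alpha>1 \<noteq> 0" "\<beta>1 \<noteq> 0" "\<gamma>1 \<noteq> 0" "\<alpha>2 \<noteq> 0" "\<beta>2 \<noteq> 0" "\<gamma>2 \<noteq> 0"
    using 1 2 A B by (auto simp: P_def)
  then have "x3 = (m / (\<alpha>1 * \<alpha>2)) ^ 2" "x3 - 2 = ((2 * l + m) / (\<beta>1 * \<beta>2)) ^ 2"
    "x3 - of_nat p = ((P * l + m) / (\<gamma>1 * \<gamma>2)) ^ 2"
    using e e' unfolding P_def[symmetric] power_divide by (simp_all add: eq_divide_eq mult.commute)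
  then show ?thesis
    using square_coordinates_double sum m_closed[OF A(1) B(1)] by metis
qed

text \<open>After translation by \<open>T\<close> every point is a double or of type
  \<open>neg\<close>. Two points of type \<open>neg\<close> add up to a double, so a single one
  represents the whole type.\<close>

lemma weak_mordell_weil:
  "\<exists>g\<in>carrier (E_group p). \<forall>A\<in>carrier (E_group p).
    \<exists>t\<in>T. \<exists>R\<in>doubles. A = t \<oplus>\<^sub>E R \<or> A = t \<oplus>\<^sub>E (g \<oplus>\<^sub>E R)"
proof -
  define neg where "neg B \<longleftrightarrow> B \<in> carrier (E_group p) \<and> (\<exists>x y \<alpha> \<beta> \<gamma>. B = Affine x y \<and> y \<noteq> 0 \<and> x = \<alpha> ^ 2 \<and> x - 2 = - (\<beta> ^ 2) \<and> x - of_nat p = - (\<gamma> ^ 2))" for B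
  have neg_sum: "A \<oplus>\<^sub>E B \<in> doubles" if "neg A" "neg B" for A B
    using that negative_sum_in_doubles unfolding neg_def by blast
  have one: "\<one>\<^bsub>E_group p\<^esub> \<in> doubles" using subgroup_doubles subgroup.one_closed by metis
  have step: "\<exists>t\<in>T. A \<oplus>\<^sub>E t \<in> doubles \<or> neg (A \<oplus>\<^sub>E t)" if A: "A \<in> carrier (E_group p)" for A
  proof (cases "A \<in> T")
    case True
    then show ?thesis using T_self_inverse one E_simps(3) by metis
  next
    case False
    then obtain x y where xy: "A = Affine x y"
      by (cases A) (auto simp: T_def)
    have y0: "y \<noteq> 0"
      using A False by (auto simp: xy T_def Affine_carrier)
    obtain t x' y' a where t: "t \<in> T" "A \<oplus>\<^sub>E t = Affine x' y'" "x' = a ^ 2"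
      using translate_to_square A xy y0 by metis
    have tc: "t \<in> carrier (E_group p)" using t T_carrier by blast
    have car: "Affine x' y' \<in> carrier (E_group p)" using t A tc by (metis m_closed)
    \<comment> \<open>Otherwise the translate, and with it \<open>A\<close>, would lie in
      \<open>T\<close>.\<close>
    have "y' \<noteq> 0"
    proof
      assume "y' = 0"
      then have "Affine x' y' \<in> T" using car by (auto simp: T_def Affine_carrier)
      then have "(A \<oplus>\<^sub>E t) \<oplus>\<^sub>E (A \<oplus>\<^sub>E t) = \<one>\<^bsub>E_group p\<^esub>"
        using T_self_inverse t E_simps(3) by metis
      moreover have "(A \<oplus>\<^sub>E t) \<oplus>\<^sub>E (A \<oplus>\<^sub>E t) = (A \<oplus>\<^sub>E A) \<oplus>\<^sub>E (t \<oplus>\<^sub>E t)"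
        using A tc by (simp add: m_ac)
      moreover have "t \<oplus>\<^sub>E t = \<one>\<^bsub>E_group p\<^esub>" using T_self_inverse t E_simps(3) by metis
      ultimately have "A \<oplus>\<^sub>E A = Infinity" using A E_simps(3) by (metis m_closed r_one)
      then show False using self_inverse_iff A False by blast
    qed
    then have "Affine x' y' \<in> doubles \<or> neg (Affine x' y')"
      using sign_alternative[OF car _ t(3)] square_coordinates_double[OF car t(3)] car t(3)
      unfolding neg_def by blast
    then show ?thesis using t by metis
  qed
  have recover: "A = t \<oplus>\<^sub>E (A \<oplus>\<^sub>E t)" if "A \<in> carrier (E_group p)" "t \<in> T" for A t
  proof -
    have "t \<in> carrier (E_group p)" "t \<oplus>\<^sub>E t = \<one>\<^bsub>E_group p\<^esub>"
      using that T_carrier T_self_inverse E_simps(3) by (blast, metis)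
    then show ?thesis using that(1) by (metis m_assoc m_comm r_one m_closed)
  qed
  show ?thesis
  proof (cases "\<exists>g. neg g")
    case True
    then obtain g where g: "neg g" by blast
    then have gc: "g \<in> carrier (E_group p)" by (simp add: neg_def)
    have "\<exists>t\<in>T. \<exists>R\<in>doubles. A = t \<oplus>\<^sub>E R \<or> A = t \<oplus>\<^sub>E (g \<oplus>\<^sub>E R)" if A: "A \<in> carrier (E_group p)" for A
    proof -
      obtain t where t: "t \<in> T" "A \<oplus>\<^sub>E t \<in> doubles \<or> neg (A \<oplus>\<^sub>E t)" using step A by blast
      show ?thesis
      proof (cases "A \<oplus>\<^sub>E t \<in> doubles")
        case True
        then show ?thesis using t recover[OF A t(1)] by blast
      next
        case False
        define B where "B = A \<oplus>\<^sub>E t"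
        have B: "neg B" "B \<in> carrier (E_group p)" using t False by (auto simp: B_def neg_def)
        \<comment> \<open>B - g is written as - 2g + (g + B), a sum of two elements of
          \<open>doubles\<close>.\<close>
        define R where "R = inv\<^bsub>E_group p\<^esub> (g \<oplus>\<^sub>E g) \<oplus>\<^sub>E (g \<oplus>\<^sub>E B)"
        have "g \<oplus>\<^sub>E g \<in> doubles" "g \<oplus>\<^sub>E B \<in> doubles" using gc neg_sum g B by (auto simp: doubles_def)
        then have R: "R \<in> doubles" unfolding R_def
          using subgroup_doubles by (simp add: subgroup.m_closed subgroup.m_inv_closed)
        have "g \<oplus>\<^sub>E R = B"
          unfolding R_def using gc B by (simp add: inv_mult m_ac r_inv l_inv)
        then have "A = t \<oplus>\<^sub>E (g \<oplus>\<^sub>E R)" using recover[OF A t(1)] B_def by simp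
        then show ?thesis using t R by blast
      qed
    qed
    then show ?thesis using gc by blast
  next
    case False
    then have "\<exists>t\<in>T. \<exists>R\<in>doubles. A = t \<oplus>\<^sub>E R" if "A \<in> carrier (E_group p)" for A
      using step[OF that] recover[OF that] by blast
    \<comment> \<open>If no point has type \<open>neg\<close>, any \<open>g\<close> will do; the
      neutral element is taken.\<close>
    then show ?thesis using one_closed by blast
  qed
qed

subsection \<open>Growth of heights\<close>

lemma finite_bounded_height: "finite {A \<in> carrier (E_group p). height A \<le> K}"
proof -
  define X :: "rat set" where "X = (\<lambda>(m, n). of_int m / of_int n) ` ({-K..K} \<times> {-K..K})"
  have X: "x \<in> X" if "rat_height x \<le> K" for x
  proof -
    obtain m n where mn: "quotient_of x = (m, n)" by fastforce
    then have "x = of_int m / of_int n" "n > 0" using quotient_of_div quotient_of_denom_pos by blast+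
    moreover have "\<bar>m\<bar> \<le> K" "n \<le> K" using that mn by (auto simp: rat_height_def)
    ultimately show ?thesis unfolding X_def by (intro image_eqI[of _ _ "(m, n)"]) auto
  qed
  have Y: "finite {y. y ^ 2 = c}" for c :: rat
  proof (cases "\<exists>y. y ^ 2 = c")
    case True
    then obtain z where "z ^ 2 = c" by blast
    then have "{y. y ^ 2 = c} = {y. y ^ 2 = z ^ 2}" by simp
    also have "\<dots> = {z, - z}" unfolding power2_eq_iff by blast
    finally show ?thesis by simp
  qed simp
  have "{A \<in> carrier (E_group p). height A \<le> K} \<subseteq>
      insert Infinity (\<Union>x\<in>X. Affine x ` {y. y ^ 2 = x * (x - of_nat p) * (x - 2)})"
  proof
    fix A assume A: "A \<in> {A \<in> carrier (E_group p). height A \<le> K}"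
    show "A \<in> insert Infinity (\<Union>x\<in>X. Affine x ` {y. y ^ 2 = x * (x - of_nat p) * (x - 2)})"
    proof (cases A)
      case (Affine x y)
      then show ?thesis using A X[of x] by (auto simp: Affine_carrier)
    qed simp
  qed
  moreover have "finite X" by (simp add: X_def)
  ultimately show ?thesis using Y by (meson finite_UN_I finite_imageI finite_insert finite_subset)
qed

text \<open>Duplication has degree 4, so the height grows to the fourth power unless numerator and
  denominator share a large factor or are both small. In place of a resultant, the argument uses the
  quadratic forms whose squares are the numerators of x', x' - 2 and x' - p over
  \<open>B\<close>.\<close>

lemma height_double:
  "\<exists>C\<ge>1. \<forall>A\<in>doubles. height A ^ 4 \<le> C * height (A \<oplus>\<^sub>E A)"
proof -
  \<comment> \<open>\<open>c\<close> is the coefficient of m n in f1 - f2, which serves to eliminate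
    m n. \<open>C\<close> is a common multiple of the coefficients 2c of m^2 and 4pc of n^2 in
    \<open>comb\<close>.\<close>
  define c where "c = 2 * int p - 4"
  define C where "C = 8 * int p * c"
  have c: "c \<ge> 1" using p_gt2 by (simp add: c_def)
  have C1: "C \<ge> 1" using c p_gt2 mult_mono[of 1 "8 * int p" 1 c] unfolding C_def by simp
  \<comment> \<open>The factor 2c + 8 bounds the coefficients in \<open>comb\<close>, p + 1 bounds
    the squares of the forms against \<open>X\<close>, and \<open>C ^ 2\<close> accounts for
    cancellation.\<close>
  define C' where "C' = (2 * c + 8) ^ 2 * (int p + 1) * C ^ 2"
  have "height A ^ 4 \<le> C' * height (A \<oplus>\<^sub>E A)" if A: "A \<in> doubles" "A \<noteq> Infinity" for A
  proof -
    obtain x y where xy: "A = Affine x y" using A(2) by (cases A) auto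
    have car: "Affine x y \<in> curve_points (E_cubic p)" using A(1) doubles_carrier xy E_simps by blast
    have y: "y ^ 2 = x * (x - of_nat p) * (x - 2)" using car by (simp add: Affine_in_curve_points)
    \<comment> \<open>The x-coordinate of a double has even denominator, which already excludes
      2-torsion.\<close>
    have y0: "y \<noteq> 0"
      using double_denominator[OF car, of 1] doubles_denominator A(1) xy by simp
    obtain m n where mn: "quotient_of x = (m, n)" by fastforce
    then have n: "n > 0" "coprime m n" "x = of_int m / of_int n"
      using quotient_of_denom_pos quotient_of_coprime quotient_of_div by blast+
    have xn: "x * of_int n = of_int m" using n by simp
    define f0 where "f0 = m ^ 2 - 2 * int p * n ^ 2"
    define f1 where "f1 = m ^ 2 - 4 * m * n + 2 * int p * n ^ 2"
    define f2 where "f2 = m ^ 2 - 2 * int p * m * n + 2 * int p * n ^ 2"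
    define B where "B = 4 * (m * n * (m - int p * n) * (m - 2 * n))"
    define x' where "x' = (x ^ 2 - 2 * of_nat p) ^ 2 / (4 * y ^ 2)"
    have yB: "4 * y ^ 2 * of_int n ^ 4 = of_int B"
      unfolding y B_def of_int_mult of_int_diff xn[symmetric] by (simp add: power4_eq_xxxx algebra_simps)
    have B0: "B \<noteq> 0" using yB y0 n(1) by auto
    have "(x ^ 2 - 2 * of_nat p) ^ 2 * of_int n ^ 4 = of_int (f0 ^ 2)"
      unfolding f0_def of_int_mult of_int_diff of_int_power xn[symmetric]
      by (simp add: power4_eq_xxxx power2_eq_square algebra_simps)
    then have x': "x' = of_int (f0 ^ 2) / of_int B"
      using yB n(1) unfolding x'_def
      by (metis mult_divide_mult_cancel_right of_int_0_eq_iff order_less_irrefl power_not_zero)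
    have f: "f1 ^ 2 = f0 ^ 2 - 2 * B" "f2 ^ 2 = f0 ^ 2 - int p * B"
      unfolding f0_def f1_def f2_def B_def by Groebner_Basis.algebra+
    \<comment> \<open>The forms \<open>f0\<close>, \<open>f1\<close>, \<open>f2\<close> span all quadratic forms in \<open>m\<close>, \<open>n\<close>: this bounds both their common divisors and, from below, their maximum.\<close>
    have comb: "c * 2 * m ^ 2 = c * (f0 + f1) + 4 * (f1 - f2)" "c * 4 * int p * n ^ 2 = c * (f1 - f0) + 4 * (f1 - f2)"
      unfolding f0_def f1_def f2_def c_def by Groebner_Basis.algebra+
    have "\<bar>d\<bar> \<le> C ^ 2" if d: "d dvd f0 ^ 2" "d dvd B" for d
    proof -
      define g where "g = gcd f0 (gcd f1 f2)"
      have "d dvd f1 ^ 2" "d dvd f2 ^ 2" using d unfolding f by simp_all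
      then have "d dvd gcd (f0 ^ 2) (gcd (f1 ^ 2) (f2 ^ 2))" by (intro gcd_greatest d(1))
      also have "\<dots> = g ^ 2" unfolding g_def by (simp only: gcd_exp)
      finally have "d dvd g ^ 2" .
      have g: "g dvd f0" "g dvd f1" "g dvd f2" unfolding g_def by (simp_all add: gcd_dvdI2)
      then have "g dvd c * 2 * m ^ 2" and "g dvd c * 4 * int p * n ^ 2" unfolding comb by simp_all
      then have "g dvd (4 * int p) * (c * 2 * m ^ 2)" "g dvd 2 * (c * 4 * int p * n ^ 2)"
        by (simp_all only: dvd_mult)
      moreover have "(4 * int p) * (c * 2 * m ^ 2) = C * m ^ 2" "2 * (c * 4 * int p * n ^ 2) = C * n ^ 2"
        by (simp_all add: C_def)
      ultimately have "g dvd gcd (C * m ^ 2) (C * n ^ 2)" by simp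
      also have "\<dots> = C" using n(2) C1 by (simp add: gcd_mult_distrib_int[symmetric])
      finally have "g ^ 2 dvd C ^ 2" by simp
      with \<open>d dvd g ^ 2\<close> have "d dvd C ^ 2" by (rule dvd_trans)
      then show ?thesis using C1 by (intro zdvd_imp_le) auto
    qed
    then have X: "max \<bar>f0 ^ 2\<bar> \<bar>B\<bar> \<le> C ^ 2 * rat_height x'"
      using rat_height_ge[OF x' B0] by blast
    define X where "X = max \<bar>f0 ^ 2\<bar> \<bar>B\<bar>"
    have X': "f0 ^ 2 \<le> X" "\<bar>B\<bar> \<le> X" "X \<ge> 0" by (auto simp: X_def)
    have pB: "\<bar>int p * B\<bar> \<le> int p * X" "\<bar>2 * B\<bar> \<le> int p * X"
      using X' p_gt2 mult_mono[of 2 "int p" "\<bar>B\<bar>" X] by (auto simp: abs_mult intro: mult_left_mono)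
    have pX: "0 \<le> int p * X" using X' by simp
    define F where "F = max \<bar>f0\<bar> (max \<bar>f1\<bar> \<bar>f2\<bar>)"
    have F: "\<bar>f0\<bar> \<le> F" "\<bar>f1\<bar> \<le> F" "\<bar>f2\<bar> \<le> F" "F \<ge> 0" by (auto simp: F_def)
    have "F ^ 2 \<in> {f0 ^ 2, f1 ^ 2, f2 ^ 2}" unfolding F_def max_def by auto
    moreover have "f0 ^ 2 \<le> (int p + 1) * X" using X' pX unfolding distrib_right by linarith
    moreover have "f1 ^ 2 \<le> (int p + 1) * X" "f2 ^ 2 \<le> (int p + 1) * X"
      unfolding f distrib_right using X' pB by linarith+
    ultimately have F2: "F ^ 2 \<le> (int p + 1) * X" by auto
    have cf: "c * (f0 + f1) \<le> c * (2 * F)" "c * (f1 - f0) \<le> c * (2 * F)"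
      using F c by (auto intro!: mult_left_mono)
    have "c * 2 * m ^ 2 \<le> (2 * c + 8) * F" "c * 4 * int p * n ^ 2 \<le> (2 * c + 8) * F"
      unfolding comb using cf F by (simp_all add: algebra_simps)
    moreover have "1 * m ^ 2 \<le> c * 2 * m ^ 2" "1 * n ^ 2 \<le> (c * 4 * int p) * n ^ 2"
      using c p_gt2 mult_mono[of 1 "c * 4" 1 "int p"] by (intro mult_right_mono; simp)+
    ultimately have mn2: "m ^ 2 \<le> (2 * c + 8) * F" "n ^ 2 \<le> (2 * c + 8) * F" by simp_all
    have "rat_height x ^ 2 \<in> {m ^ 2, n ^ 2}" unfolding rat_height_def mn max_def by auto
    then have "rat_height x ^ 2 \<le> (2 * c + 8) * F" using mn2 by auto
    then have "(rat_height x ^ 2) ^ 2 \<le> ((2 * c + 8) * F) ^ 2" by (intro power_mono) simp_all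
    also have "\<dots> \<le> (2 * c + 8) ^ 2 * ((int p + 1) * X)"
      unfolding power_mult_distrib using F2 by (intro mult_left_mono) simp_all
    also have "\<dots> \<le> (2 * c + 8) ^ 2 * ((int p + 1) * (C ^ 2 * rat_height x'))"
      using X unfolding X_def by (intro mult_left_mono) simp_all
    finally have "rat_height x ^ 4 \<le> C' * rat_height x'" by (simp add: C'_def mult.assoc)
    moreover obtain y' where "A \<oplus>\<^sub>E A = Affine x' y'"
      using double_point(1)[OF car y0] xy by (auto simp: E_simps x'_def)
    ultimately show ?thesis using xy by simp
  qed
  moreover have C': "C' \<ge> 1"
    using c C1 unfolding C'_def by (simp add: int_one_le_iff_zero_less)
  moreover have "height A ^ 4 \<le> C' * height (A \<oplus>\<^sub>E A)" if "A = Infinity" for A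
    using that C' by (simp add: E_simps)
  ultimately show ?thesis by blast
qed

text \<open>In the chord formula the curve equations remove y^2 and y0^2 and the cubic terms cancel.
  What remains is quadratic in x and linear in y, hence at most quadratic in the height;
  \<open>Q\<close> enters only through constants.\<close>

lemma height_add_const:
  assumes Q: "Q \<in> carrier (E_group p)"
  shows "\<exists>C\<ge>1. \<forall>A\<in>carrier (E_group p). height (A \<oplus>\<^sub>E Q) \<le> C * height A ^ 2"
proof (cases Q)
  case Infinity
  have "height (A \<oplus>\<^sub>E Q) \<le> 1 * height A ^ 2" if "A \<in> carrier (E_group p)" for A
  proof -
    have "A \<oplus>\<^sub>E Q = A" using that Infinity E_simps(3) r_one by metis
    then show ?thesis using height_pos[of A] by (simp add: self_le_power)
  qed
  then show ?thesis by (intro exI[of _ 1]) simp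
next
  case Q': (Affine x0 y0)
  define P :: rat where "P = of_nat p"
  obtain r s where rs: "quotient_of x0 = (r, s)" by fastforce
  then have s: "s > 0" "x0 = of_int r / of_int s"
    using quotient_of_denom_pos quotient_of_div by blast+
  obtain u v where uv: "quotient_of y0 = (u, v)" by fastforce
  then have v: "v > 0" "y0 = of_int u / of_int v"
    using quotient_of_denom_pos quotient_of_div by blast+
  have q: "y0 ^ 2 = x0 * (x0 - P) * (x0 - 2)" using Q Q' by (simp add: Affine_carrier P_def)
  \<comment> \<open>The bounds (1 + p) * M for m - p n and 3 * M for m - 2 n give w^2 <= K *
    M^4.\<close>
  define K where "K = 3 * (1 + int p)"
  have K1: "K \<ge> 1" by (simp add: K_def)
  \<comment> \<open>Coefficients of m^2, m n, n^2 and w in the numerator after clearing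
    denominators; \<open>L1\<close> and \<open>L2\<close> bound numerator and denominator.\<close>
  define c0 c1 c2 c3 where "c0 = v * r * s" and "c1 = v * (r ^ 2 + 2 * int p * s ^ 2 - 2 * (int p + 2) * r * s)"
    and "c2 = v * (2 * int p * r * s)" and "c3 = - 2 * s ^ 2 * u"
  define L1 where "L1 = \<bar>c0\<bar> + \<bar>c1\<bar> + \<bar>c2\<bar> + \<bar>c3\<bar> * K"
  define L2 where "L2 = \<bar>v * s ^ 2\<bar> + \<bar>2 * v * r * s\<bar> + \<bar>v * r ^ 2\<bar>"
  have generic: "height (A \<oplus>\<^sub>E Q) \<le> (L1 + L2) * height A ^ 2"
    if A: "A = Affine x y" "A \<in> carrier (E_group p)" "x \<noteq> x0" for A x y
  proof -
    have y: "y ^ 2 = x * (x - P) * (x - 2)" using A by (simp add: Affine_carrier P_def)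
    obtain m n where mn: "quotient_of x = (m, n)" by fastforce
    then have n: "n > 0" "coprime m n" "x = of_int m / of_int n"
      using quotient_of_denom_pos quotient_of_coprime quotient_of_div by blast+
    have xn: "x * of_int n = of_int m" using n by simp
    define M where "M = height A"
    have M: "\<bar>m\<bar> \<le> M" "\<bar>n\<bar> \<le> M" "M \<ge> 0" using n(1) by (auto simp: M_def A rat_height_def mn)
    \<comment> \<open>The rational number y n^2 has an integral square, so it is an integer
      \<open>w\<close>.\<close>
    have "(y * of_int n ^ 2) ^ 2 = of_int n * ((x * of_int n) * ((x * of_int n - P * of_int n) * (x * of_int n - 2 * of_int n)))"
      unfolding power_mult_distrib y by Groebner_Basis.algebra
    also have "\<dots> = of_int (n * (m * ((m - int p * n) * (m - 2 * n))))"
      unfolding xn P_def by simp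
    finally obtain w where yw: "y * of_int n ^ 2 = of_int w" and w: "w ^ 2 = n * (m * ((m - int p * n) * (m - 2 * n)))"
      by (rule of_int_square_rat)
    have w2: "\<bar>w\<bar> \<le> K * M ^ 2"
    proof -
      have a: "\<bar>m - int p * n\<bar> \<le> (1 + int p) * M"
      proof -
        have "\<bar>int p * n\<bar> \<le> int p * M" using M by (simp add: abs_mult mult_left_mono)
        then show ?thesis using M(1) by (simp add: distrib_right)
      qed
      have b: "\<bar>m - 2 * n\<bar> \<le> 3 * M" using M by linarith
      have "w ^ 2 = \<bar>n\<bar> * (\<bar>m\<bar> * (\<bar>m - int p * n\<bar> * \<bar>m - 2 * n\<bar>))"
        using w by (metis abs_mult abs_power2)
      also have "\<dots> \<le> M * (M * (((1 + int p) * M) * (3 * M)))"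
        using M a b by (intro mult_mono) auto
      also have "\<dots> = K * (M ^ 2) ^ 2" by (simp add: K_def power2_eq_square)
      also have "\<dots> \<le> K ^ 2 * (M ^ 2) ^ 2"
        using K1 by (intro mult_right_mono) (simp_all add: self_le_power)
      finally have "\<bar>w\<bar> ^ 2 \<le> (K * M ^ 2) ^ 2" by (simp add: power_mult_distrib)
      then show ?thesis by (rule power2_le_imp_le) (use K1 in simp)
    qed
    have quad: "\<bar>a * m ^ 2 + b * (m * n) + c * n ^ 2\<bar> \<le> (\<bar>a\<bar> + \<bar>b\<bar> + \<bar>c\<bar>) * M ^ 2" for a b c
    proof -
      have "\<bar>m ^ 2\<bar> \<le> M ^ 2" "\<bar>m * n\<bar> \<le> M ^ 2" "\<bar>n ^ 2\<bar> \<le> M ^ 2"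
        unfolding power2_eq_square abs_mult by (intro mult_mono M abs_ge_zero)+
      then have "\<bar>a * m ^ 2\<bar> \<le> \<bar>a\<bar> * M ^ 2" "\<bar>b * (m * n)\<bar> \<le> \<bar>b\<bar> * M ^ 2" "\<bar>c * n ^ 2\<bar> \<le> \<bar>c\<bar> * M ^ 2"
        unfolding abs_mult[of a] abs_mult[of b] abs_mult[of c] by (auto intro!: mult_left_mono)
      then show ?thesis unfolding distrib_right by linarith
    qed
    define N where "N = c0 * m ^ 2 + c1 * (m * n) + c2 * n ^ 2 + c3 * w"
    define D where "D = v * s ^ 2 * m ^ 2 + (- 2 * v * r * s) * (m * n) + v * r ^ 2 * n ^ 2"
    have M2: "M ^ 2 \<ge> 0" by simp
    have "\<bar>c3 * w\<bar> \<le> \<bar>c3\<bar> * (K * M ^ 2)" unfolding abs_mult using w2 by (intro mult_left_mono) auto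
    then have "\<bar>N\<bar> \<le> L1 * M ^ 2"
      using quad[of c0 c1 c2] mult.assoc[of "\<bar>c3\<bar>" K "M ^ 2"]
      unfolding N_def L1_def distrib_right by linarith
    moreover have "L1 \<ge> 0" "L2 \<ge> 0" using K1 by (simp_all add: L1_def L2_def)
    ultimately have N: "\<bar>N\<bar> \<le> (L1 + L2) * M ^ 2" by (simp add: distrib_right add_increasing2)
    have "\<bar>D\<bar> \<le> L2 * M ^ 2" using quad[of "v * s ^ 2" "- 2 * v * r * s" "v * r ^ 2"]
      unfolding D_def L2_def by (simp add: abs_mult)
    then have D: "\<bar>D\<bar> \<le> (L1 + L2) * M ^ 2" using \<open>L1 \<ge> 0\<close> by (simp add: distrib_right add_increasing)
    define x3 where "x3 = ((y0 - y) / (x0 - x)) ^ 2 + P + 2 - x - x0"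
    have sum: "\<exists>y3. A \<oplus>\<^sub>E Q = Affine x3 y3"
      using A(3) unfolding A(1) Q' E_simps curve_add_E_cubic Let_def x3_def P_def by simp
    have xs: "x0 * of_int s = of_int r" and yv: "y0 * of_int v = of_int u" using s v by simp_all
    have D': "of_int D = (x0 - x) ^ 2 * (of_int s ^ 2 * of_int n ^ 2 * of_int v)"
      unfolding D_def of_int_mult of_int_add of_int_power of_int_minus of_int_numeral xs[symmetric] xn[symmetric]
      by Groebner_Basis.algebra
    then have D0: "D \<noteq> 0" using A(3) s(1) v(1) n(1) by auto
    have "x3 * (x0 - x) ^ 2 = (y0 - y) ^ 2 + (P + 2 - x - x0) * (x0 - x) ^ 2"
      unfolding x3_def using A(3) by (simp add: power_divide algebra_simps)
    also have "\<dots> = y0 ^ 2 + y ^ 2 - 2 * y * y0 + (P + 2 - x - x0) * (x0 - x) ^ 2"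
      by Groebner_Basis.algebra
    also have "\<dots> = (x * x0 + 2 * P) * (x + x0) - 2 * (P + 2) * x * x0 - 2 * y * y0"
      unfolding q y by Groebner_Basis.algebra
    finally have x3: "x3 * (x0 - x) ^ 2 = (x * x0 + 2 * P) * (x + x0) - 2 * (P + 2) * x * x0 - 2 * y * y0" .
    have "of_int N = ((x * x0 + 2 * P) * (x + x0) - 2 * (P + 2) * x * x0 - 2 * y * y0) * (of_int s ^ 2 * of_int n ^ 2 * of_int v)"
      unfolding N_def c0_def c1_def c2_def c3_def P_def
        of_int_mult of_int_add of_int_diff of_int_power of_int_minus of_int_numeral of_int_of_nat_eq
        xs[symmetric] xn[symmetric] yv[symmetric] yw[symmetric]
      by Groebner_Basis.algebra
    then have "of_int N = x3 * of_int D" unfolding D' x3[symmetric] by simp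
    then have "x3 = of_int N / of_int D" using D0 by simp
    then have "rat_height x3 \<le> (L1 + L2) * M ^ 2" using rat_height_le D0 N D by blast
    then show ?thesis using sum M_def by auto
  qed
  \<comment> \<open>The summands after \<open>L1 + L2\<close> absorb the points outside the chord
    formula: A equal to \<open>Infinity\<close>, Q or - Q, with sums Q, 2Q and
    \<open>Infinity\<close>.\<close>
  define C where "C = \<bar>L1 + L2\<bar> + height Q + height (Q \<oplus>\<^sub>E Q) + 1"
  have hp: "height Q \<ge> 1" "height (Q \<oplus>\<^sub>E Q) \<ge> 1" by (rule height_pos)+
  have C1: "C \<ge> 1" using hp by (simp add: C_def)
  have "height (A \<oplus>\<^sub>E Q) \<le> C * height A ^ 2" if A: "A \<in> carrier (E_group p)" for A
  proof -
    have h2: "height A ^ 2 \<ge> 1" using height_pos[of A] by (simp add: one_le_power)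
    have const: "k \<le> C * height A ^ 2" if "k \<le> C" for k
    proof -
      have "C * 1 \<le> C * height A ^ 2" using h2 C1 by (intro mult_left_mono) simp_all
      then show ?thesis using that by linarith
    qed
    show ?thesis
    proof (cases A)
      case Infinity
      then have "A \<oplus>\<^sub>E Q = Q" by (simp add: E_simps)
      then show ?thesis using const[of "height Q"] hp by (simp add: C_def)
    next
      case A': (Affine x y)
      show ?thesis
      proof (cases "x = x0")
        case True
        then have "y ^ 2 = y0 ^ 2" using A A' q by (simp add: Affine_carrier P_def)
        then have "y = y0 \<or> y = - y0" by (simp add: power2_eq_iff)
        then consider "A = Q" | "A \<oplus>\<^sub>E Q = Infinity"
          using True A' Q' by (auto simp: E_simps curve_add_E_cubic)
        then show ?thesis
        proof cases
          case 1
          then show ?thesis using const[of "height (Q \<oplus>\<^sub>E Q)"] hp by (simp add: C_def)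
        next
          case 2
          then show ?thesis using const[of 1] hp by (simp add: C_def)
        qed
      next
        case False
        have "(L1 + L2) * height A ^ 2 \<le> C * height A ^ 2"
          using hp by (intro mult_right_mono) (auto simp: C_def)
        then show ?thesis using generic[OF A' A False] by simp
      qed
    qed
  qed
  then show ?thesis using C1 by blast
qed

subsection \<open>Torsion subgroup and rank\<close>

lemma int_pow_2: "A \<in> carrier (E_group p) \<Longrightarrow> A [^]\<^bsub>E_group p\<^esub> (2::int) = A \<oplus>\<^sub>E A"
  using int_pow_mult[of A 1 1] by (simp add: int_pow_1)

text \<open>Write A = 2S and decompose S by \<open>weak_mordell_weil\<close>; doubling kills the
  part in \<open>T\<close>. The remainder lies in \<open>doubles\<close> again, so the descent never
  leaves 2E, and its coset representative is the double of the one for E.\<close>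

lemma descent_step:
  "\<exists>g\<in>doubles. \<exists>K::nat. \<forall>A\<in>doubles. \<exists>B\<in>doubles.
    (\<exists>e::int. A = g [^]\<^bsub>E_group p\<^esub> e \<oplus>\<^sub>E B [^]\<^bsub>E_group p\<^esub> (2::int)) \<and>
    (nat (height B) < nat (height A) \<or> nat (height B) \<le> K)"
proof -
  obtain g0 where g0: "g0 \<in> carrier (E_group p)"
    and weak: "\<And>A. A \<in> carrier (E_group p) \<Longrightarrow>
      \<exists>t\<in>T. \<exists>R\<in>doubles. A = t \<oplus>\<^sub>E R \<or> A = t \<oplus>\<^sub>E (g0 \<oplus>\<^sub>E R)"
    using weak_mordell_weil by blast
  define g where "g = g0 \<oplus>\<^sub>E g0"
  have g: "g \<in> doubles" "g \<in> carrier (E_group p)" using g0 by (auto simp: g_def doubles_def)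
  obtain C1 where C1: "C1 \<ge> 1" "\<And>A. A \<in> doubles \<Longrightarrow> height A ^ 4 \<le> C1 * height (A \<oplus>\<^sub>E A)"
    using height_double by blast
  obtain C2 where C2: "C2 \<ge> 1" "\<And>A. A \<in> carrier (E_group p) \<Longrightarrow>
      height (A \<oplus>\<^sub>E inv\<^bsub>E_group p\<^esub> g) \<le> C2 * height A ^ 2"
    using height_add_const[of "inv\<^bsub>E_group p\<^esub> g"] g by auto
  \<comment> \<open>If h(R) >= h(A) and h(R) > K, then h(R)^4 <= C1 * C2 * h(A)^2 <= K * h(R)^2 <
    h(R)^3, which is impossible.\<close>
  define K where "K = C1 * C2"
  have K1: "K \<ge> 1" using mult_mono[of 1 C1 1 C2] C1(1) C2(1) by (simp add: K_def)
  have small: "height R < height A \<or> height R \<le> K"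
    if "R \<in> doubles" "A \<in> carrier (E_group p)" "R \<oplus>\<^sub>E R = A \<or> R \<oplus>\<^sub>E R = A \<oplus>\<^sub>E inv\<^bsub>E_group p\<^esub> g" for R A
  proof (rule ccontr)
    assume "\<not> ?thesis"
    then have R: "height A \<le> height R" "K < height R" by simp_all
    have A1: "height A \<ge> 1" by (rule height_pos)
    have "1 * height A \<le> C2 * height A ^ 2"
      using C2(1) A1 by (intro mult_mono) (simp_all add: self_le_power)
    then have "height (R \<oplus>\<^sub>E R) \<le> C2 * height A ^ 2"
      using that C2(2)[of A] by auto
    then have "height R ^ 4 \<le> C1 * (C2 * height A ^ 2)"
      using C1 that(1) by (meson mult_left_mono order_trans zero_le_one)
    also have "\<dots> = K * height A ^ 2" by (simp add: K_def)
    also have "\<dots> \<le> K * height R ^ 2"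
      using K1 R(1) A1 by (intro mult_left_mono power_mono) simp_all
    also have "\<dots> < height R * height R ^ 2"
      using R A1 by (intro mult_strict_right_mono) simp_all
    also have "\<dots> = height R ^ 3" by (simp add: power2_eq_square power3_eq_cube)
    also have "\<dots> \<le> height R ^ 4" using R A1 by (intro power_increasing) simp_all
    finally show False by simp
  qed
  have "\<exists>B\<in>doubles. (\<exists>e::int. A = g [^]\<^bsub>E_group p\<^esub> e \<oplus>\<^sub>E B [^]\<^bsub>E_group p\<^esub> (2::int)) \<and>
    (nat (height B) < nat (height A) \<or> nat (height B) \<le> nat K)" if A: "A \<in> doubles" for A
  proof -
    have Ac: "A \<in> carrier (E_group p)" using A doubles_carrier by blast
    obtain S where S: "A = S \<oplus>\<^sub>E S" "S \<in> carrier (E_group p)"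
      using A unfolding doubles_def by (rule imageE)
    obtain t R where tR: "t \<in> T" "R \<in> doubles" "S = t \<oplus>\<^sub>E R \<or> S = t \<oplus>\<^sub>E (g0 \<oplus>\<^sub>E R)"
      using weak[OF S(2)] by blast
    have car: "t \<in> carrier (E_group p)" "R \<in> carrier (E_group p)"
      using tR T_carrier doubles_carrier by blast+
    have tt: "t \<oplus>\<^sub>E t = \<one>\<^bsub>E_group p\<^esub>" using T_self_inverse tR(1) E_simps(3) by simp
    have two: "(t \<oplus>\<^sub>E X) \<oplus>\<^sub>E (t \<oplus>\<^sub>E X) = X \<oplus>\<^sub>E X" if "X \<in> carrier (E_group p)" for X
    proof -
      have "(t \<oplus>\<^sub>E X) \<oplus>\<^sub>E (t \<oplus>\<^sub>E X) = (t \<oplus>\<^sub>E t) \<oplus>\<^sub>E (X \<oplus>\<^sub>E X)" using that car by (simp add: m_ac)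
      then show ?thesis using that unfolding tt by simp
    qed
    from tR(3) have "A = R \<oplus>\<^sub>E R \<or> A = g \<oplus>\<^sub>E (R \<oplus>\<^sub>E R)"
    proof
      assume "S = t \<oplus>\<^sub>E R"
      then show ?thesis using S two car by simp
    next
      assume "S = t \<oplus>\<^sub>E (g0 \<oplus>\<^sub>E R)"
      then have "A = (g0 \<oplus>\<^sub>E R) \<oplus>\<^sub>E (g0 \<oplus>\<^sub>E R)" using S two[of "g0 \<oplus>\<^sub>E R"] car g0 by simp
      also have "\<dots> = g \<oplus>\<^sub>E (R \<oplus>\<^sub>E R)" using car g0 by (simp add: g_def m_ac)
      finally show ?thesis by simp
    qed
    then have "\<exists>e::int. A = g [^]\<^bsub>E_group p\<^esub> e \<oplus>\<^sub>E R [^]\<^bsub>E_group p\<^esub> (2::int)"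
      and "R \<oplus>\<^sub>E R = A \<or> R \<oplus>\<^sub>E R = A \<oplus>\<^sub>E inv\<^bsub>E_group p\<^esub> g"
    proof (atomize (full), elim disjE)
      assume "A = R \<oplus>\<^sub>E R"
      then have "A = g [^]\<^bsub>E_group p\<^esub> (0::int) \<oplus>\<^sub>E R [^]\<^bsub>E_group p\<^esub> (2::int)"
        using car by (simp add: int_pow_2)
      with \<open>A = R \<oplus>\<^sub>E R\<close> show "(\<exists>e::int. A = g [^]\<^bsub>E_group p\<^esub> e \<oplus>\<^sub>E R [^]\<^bsub>E_group p\<^esub> (2::int)) \<and>
          (R \<oplus>\<^sub>E R = A \<or> R \<oplus>\<^sub>E R = A \<oplus>\<^sub>E inv\<^bsub>E_group p\<^esub> g)"
        by blast
    next
      assume A: "A = g \<oplus>\<^sub>E (R \<oplus>\<^sub>E R)"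
      then have 1: "A = g [^]\<^bsub>E_group p\<^esub> (1::int) \<oplus>\<^sub>E R [^]\<^bsub>E_group p\<^esub> (2::int)"
        using car g by (simp add: int_pow_2 int_pow_1)
      have "R \<oplus>\<^sub>E R = A \<oplus>\<^sub>E inv\<^bsub>E_group p\<^esub> g"
        unfolding A using car g by (metis inv_solve_right m_closed m_comm)
      with 1 show "(\<exists>e::int. A = g [^]\<^bsub>E_group p\<^esub> e \<oplus>\<^sub>E R [^]\<^bsub>E_group p\<^esub> (2::int)) \<and>
          (R \<oplus>\<^sub>E R = A \<or> R \<oplus>\<^sub>E R = A \<oplus>\<^sub>E inv\<^bsub>E_group p\<^esub> g)"
        by blast
    qed
    moreover from this(2) have "nat (height R) < nat (height A) \<or> nat (height R) \<le> nat K"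
      using small[OF tR(2) Ac] height_pos[of A] by auto
    ultimately show ?thesis using tR(2) by blast
  qed
  then show ?thesis using g(1) by blast
qed

lemma doubles_cyclic:
  "\<exists>q\<in>doubles. \<forall>A\<in>doubles. \<exists>n::int. A = q [^]\<^bsub>E_group p\<^esub> n"
proof -
  obtain g and K :: nat where g: "g \<in> doubles"
    and d: "\<And>A. A \<in> doubles \<Longrightarrow> \<exists>B\<in>doubles.
      (\<exists>e::int. A = g [^]\<^bsub>E_group p\<^esub> e \<oplus>\<^sub>E B [^]\<^bsub>E_group p\<^esub> (2::int)) \<and>
      (nat (height B) < nat (height A) \<or> nat (height B) \<le> K)"
    using descent_step by blast
  have "{A \<in> doubles. nat (height A) \<le> K} \<subseteq> {A \<in> carrier (E_group p). height A \<le> int K}"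
    using doubles_carrier by auto
  then have fin: "finite {A \<in> doubles. nat (height A) \<le> K}"
    using finite_bounded_height by (rule finite_subset)
  obtain N :: int where N: "N > 0" "\<And>A. A \<in> doubles \<Longrightarrow> \<exists>c::int. A [^]\<^bsub>E_group p\<^esub> N = g [^]\<^bsub>E_group p\<^esub> c"
    using uniform_power_in_cyclic[OF subgroup_doubles g fin d] by blast
  show ?thesis
    using cyclic_if_uniform_power[OF subgroup_doubles g _ N] torsion_free_doubles
    unfolding E_simps(3) by blast
qed

lemma two_torsion: "T = {A \<in> carrier (E_group p). A \<oplus>\<^sub>E A = \<one>\<^bsub>E_group p\<^esub>}"
  using self_inverse_iff T_carrier unfolding E_simps(3) by blast

text \<open>The double of a torsion point is a torsion element of the torsion-free group 2E, hence
  zero.\<close>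

lemma torsion_subgroup_eq: "torsion_subgroup (E_group p) = (E_group p)\<lparr>carrier := T\<rparr>"
proof -
  have "{A \<in> carrier (E_group p). \<exists>n::nat. n > 0 \<and> A [^]\<^bsub>E_group p\<^esub> n = \<one>\<^bsub>E_group p\<^esub>} = T"
  proof (intro equalityI subsetI)
    fix A assume "A \<in> {A \<in> carrier (E_group p). \<exists>n::nat. n > 0 \<and> A [^]\<^bsub>E_group p\<^esub> n = \<one>\<^bsub>E_group p\<^esub>}"
    then obtain n :: nat where A: "A \<in> carrier (E_group p)" "n > 0" "A [^]\<^bsub>E_group p\<^esub> n = \<one>\<^bsub>E_group p\<^esub>"
      by blast
    then have "(A \<oplus>\<^sub>E A) [^]\<^bsub>E_group p\<^esub> n = \<one>\<^bsub>E_group p\<^esub>" by (simp add: nat_pow_distrib)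
    then have "A \<oplus>\<^sub>E A = Infinity"
      using torsion_free_doubles[of "A \<oplus>\<^sub>E A" n] A(1,2) unfolding E_simps(3) by (auto simp: doubles_def)
    then show "A \<in> T" using self_inverse_iff A(1) by blast
  next
    fix A assume A: "A \<in> T"
    then have "A \<in> carrier (E_group p)" "A \<oplus>\<^sub>E A = \<one>\<^bsub>E_group p\<^esub>" using two_torsion by auto
    then have "A [^]\<^bsub>E_group p\<^esub> (2::nat) = \<one>\<^bsub>E_group p\<^esub>" by (simp add: numeral_2_eq_2)
    then show "A \<in> {A \<in> carrier (E_group p). \<exists>n::nat. n > 0 \<and> A [^]\<^bsub>E_group p\<^esub> n = \<one>\<^bsub>E_group p\<^esub>}"
      using \<open>A \<in> carrier (E_group p)\<close> by (auto intro!: exI[of _ 2])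
  qed
  then show ?thesis by (simp add: torsion_subgroup_def)
qed

lemma rank_and_structure_E:
  "abelian_rank (E_group p) \<le> 1 \<and>
    (E_group p \<cong> integer_mod_group 2 \<times>\<times> integer_mod_group 2 \<or>
     E_group p \<cong> integer_group \<times>\<times> integer_mod_group 2 \<times>\<times> integer_mod_group 2)"
proof -
  obtain g where g: "g \<in> carrier (E_group p)"
    and weak: "\<And>A. A \<in> carrier (E_group p) \<Longrightarrow>
      \<exists>t\<in>T. \<exists>R\<in>doubles. A = t \<oplus>\<^sub>E R \<or> A = t \<oplus>\<^sub>E (g \<oplus>\<^sub>E R)"
    using weak_mordell_weil by blast
  have weak': "\<exists>t\<in>T. \<exists>B\<in>carrier (E_group p). A = t \<oplus>\<^sub>E (B \<oplus>\<^sub>E B) \<or> A = t \<oplus>\<^sub>E (g \<oplus>\<^sub>E (B \<oplus>\<^sub>E B))"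
    if "A \<in> carrier (E_group p)" for A
    using weak[OF that] unfolding doubles_def by blast
  obtain q where q: "q \<in> doubles" "\<And>A. A \<in> doubles \<Longrightarrow> \<exists>n::int. A = q [^]\<^bsub>E_group p\<^esub> n"
    using doubles_cyclic by blast
  \<comment> \<open>A half of the generator of 2E, which generates the free part of E when
    \<open>q\<close> is nonzero.\<close>
  obtain r where r: "q = r \<oplus>\<^sub>E r" "r \<in> carrier (E_group p)"
    using q(1) unfolding doubles_def by (rule imageE)
  have cyc: "\<exists>n::int. A \<oplus>\<^sub>E A = (r \<oplus>\<^sub>E r) [^]\<^bsub>E_group p\<^esub> n" if "A \<in> carrier (E_group p)" for A
    using q(2) r that by (auto simp: doubles_def)
  have inf: "n = 0" if "r \<oplus>\<^sub>E r \<noteq> \<one>\<^bsub>E_group p\<^esub>" "(r \<oplus>\<^sub>E r) [^]\<^bsub>E_group p\<^esub> n = \<one>\<^bsub>E_group p\<^esub>" for n :: int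
  proof (rule ccontr)
    assume "n \<noteq> 0"
    have "q [^]\<^bsub>E_group p\<^esub> \<bar>n\<bar> = \<one>\<^bsub>E_group p\<^esub>"
      using that(2) r by (cases "n \<ge> 0") (auto simp: int_pow_neg)
    then have "q [^]\<^bsub>E_group p\<^esub> nat \<bar>n\<bar> = \<one>\<^bsub>E_group p\<^esub>"
      by (metis abs_ge_zero int_pow_int nat_0_le)
    then have "q = Infinity"
      using torsion_free_doubles[OF q(1), of "nat \<bar>n\<bar>"] \<open>n \<noteq> 0\<close> unfolding E_simps(3) by simp
    then show False using that(1) r unfolding E_simps(3) by simp
  qed
  define a where "a = Affine (0::rat) 0"
  define b where "b = Affine (2::rat) 0"
  have "a \<oplus>\<^sub>E b = Affine (of_nat p) 0"
    unfolding a_def b_def E_simps curve_add_E_cubic by simp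
  then have four: "a \<in> T" "b \<in> T" "a \<noteq> \<one>\<^bsub>E_group p\<^esub>" "b \<noteq> \<one>\<^bsub>E_group p\<^esub>" "a \<noteq> b"
    "T = {\<one>\<^bsub>E_group p\<^esub>, a, b, a \<oplus>\<^sub>E b}"
    unfolding E_simps(3) by (simp_all add: a_def b_def T_def)
  show ?thesis
    using rank_and_structure[OF two_torsion torsion_subgroup_eq g weak' four r(2) cyc inf] .
qed

end

theorem theorem1:
  fixes p :: nat
  assumes "prime p" and "prime (p - 2)" and "[p = 5] (mod 8)"
  shows "abelian_rank (E_group p) \<le> 1 \<and>
    (E_group p \<cong> integer_mod_group 2 \<times>\<times> integer_mod_group 2 \<or>
     E_group p \<cong> integer_group \<times>\<times> integer_mod_group 2 \<times>\<times> integer_mod_group 2)"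
  using twin_prime_curve.rank_and_structure_E[OF twin_prime_curve.intro] assms .

end
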